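(* Let $n\ge2$, $1<\mathscr{P}\le n-1$, let $0\le l<k\le\binom{n-1}{\mathscr{P}-1}$ be integers and $p,q$ constants with $p>q-l$. Let $\varphi\in C^2(\mathbb{S}^n)$ be positive and let $u\in C^4(\mathbb{S}^n)$ be a positive admissible solution of $$\frac{\sigma_k(\Lambda(\nabla^2u+uI))}{\sigma_l(\Lambda(\nabla^2u+uI))}=u^{p-1}(u^2+|\nabla u|^2)^{\frac{k+1-q}{2}}\varphi\quad\text{on }\mathbb{S}^n.$$ Then there exists a positive constant $C$, depending only on $n,k,l,p,q$, $\min_{\mathbb{S}^n}\varphi$, $\|u\|_{C^1}$ and $\|\varphi\|_{C^2}$, such that $\max_{\mathbb{S}^n}|\nabla^2u|\le C$.
   Context: $\mathbb{S}^n$ is the unit sphere with its standard metric; $\nabla u$, $\nabla^2u$ are the gradient and covariant Hessian in a local orthonormal frame; $I$ is the identity. Put $N=\binom{n}{\mathscr{P}}$ and let $\mathbf{I}_1,\dots,\mathbf{I}_N$ enumerate the multi-indices $1\le i_1<\dots<i_{\mathscr{P}}\le n$. For a symmetric matrix $A$ with eigenvalues $\lambda$, $\Lambda(A)=(\Lambda_{\mathbf{I}_1},\dots,\Lambda_{\mathbf{I}_N})$ with $\Lambda_{\mathbf{I}}=\lambda_{i_1}+\dots+\lambda_{i_{\mathscr{P}}}$. $\sigma_m$ is the $m$-th elementary symmetric polynomial, $\sigma_0=1$; $\Gamma_k=\{\mu\in\mathbb{R}^N:\sigma_j(\mu)>0,\ 1\le j\le k\}$. A function $u\in C^2(\mathbb{S}^n)$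 is admissible if $\Lambda(\nabla^2u+uI)\in\Gamma_k$ at every point. *)

theory Defs
  imports "HOL-Analysis.Analysis"
begin

fun Ck_on :: "nat \<Rightarrow> 'a::euclidean_space set \<Rightarrow> ('a \<Rightarrow> real) \<Rightarrow> bool" where
  "Ck_on 0 U f = continuous_on U f"
| "Ck_on (Suc k) U f =
     (f differentiable_on U \<and> (\<forall>v. Ck_on k U (\<lambda>x. frechet_derivative f (at x) v)))"

text \<open>Ambient (Euclidean) gradient and Hessian of an extension of a function on the sphere.\<close>
definition egrad :: "('a::euclidean_space \<Rightarrow> real) \<Rightarrow> 'a \<Rightarrow> 'a" where
  "egrad f x = (\<Sum>b\<in>Basis. frechet_derivative f (at x) b *\<^sub>R b)"

definition ehess :: "('a::euclidean_space \<Rightarrow> real) \<Rightarrow> 'a \<Rightarrow> 'a \<Rightarrow> 'a \<Rightarrow> real" where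
  "ehess f x v w = frechet_derivative (\<lambda>y. frechet_derivative f (at y) v) (at x) w"

text \<open>Sphere S^n = unit sphere of the ambient space (of dimension n+1).
  Tangential gradient nabla u at x in S^n, and covariant Hessian nabla^2 u on tangent
  vectors (Gauss formula for the unit sphere: second fundamental form = metric).\<close>
definition sgrad :: "('a::euclidean_space \<Rightarrow> real) \<Rightarrow> 'a \<Rightarrow> 'a" where
  "sgrad f x = egrad f x - (egrad f x \<bullet> x) *\<^sub>R x"

definition shess :: "('a::euclidean_space \<Rightarrow> real) \<Rightarrow> 'a \<Rightarrow> 'a \<Rightarrow> 'a \<Rightarrow> real" where
  "shess f x v w = ehess f x v w - (egrad f x \<bullet> x) * (v \<bullet> w)"

definition tangent_unit :: "'a::euclidean_space \<Rightarrow> 'a \<Rightarrow> bool" where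
  "tangent_unit x v \<longleftrightarrow> v \<bullet> x = 0 \<and> norm v = 1"

definition is_eigvals :: "('a::euclidean_space \<Rightarrow> real) \<Rightarrow> 'a \<Rightarrow> (nat \<Rightarrow> real) \<Rightarrow> bool" where
  "is_eigvals u x lam \<longleftrightarrow>
     (\<exists>e :: nat \<Rightarrow> 'a.
        (\<forall>i < DIM('a) - 1. e i \<bullet> x = 0) \<and>
        (\<forall>i < DIM('a) - 1. \<forall>j < DIM('a) - 1. e i \<bullet> e j = (if i = j then 1 else 0)) \<and>
        (\<forall>i < DIM('a) - 1. \<forall>j < DIM('a) - 1.
            shess u x (e i) (e j) + u x * (e i \<bullet> e j) = (if i = j then lam i else 0)))"

definition eigvals :: "('a::euclidean_space \<Rightarrow> real) \<Rightarrow> 'a \<Rightarrow> nat \<Rightarrow> real" where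
  "eigvals u x = (SOME lam. is_eigvals u x lam)"

text \<open>Multi-indices 1 <= i_1 < ... < i_P <= n, as P-element subsets of {0..<n}.\<close>
definition multi_idx :: "nat \<Rightarrow> nat \<Rightarrow> nat set set" where
  "multi_idx n P = {I. I \<subseteq> {..<n} \<and> card I = P}"

definition LamP :: "(nat \<Rightarrow> real) \<Rightarrow> nat set \<Rightarrow> real" where
  "LamP lam I = (\<Sum>i\<in>I. lam i)"

definition esym :: "nat \<Rightarrow> ('b \<Rightarrow> real) \<Rightarrow> 'b set \<Rightarrow> real" where
  "esym m mu A = (\<Sum>J\<in>{J. J \<subseteq> A \<and> card J = m}. \<Prod>i\<in>J. mu i)"

definition GammaK :: "nat \<Rightarrow> 'b set \<Rightarrow> ('b \<Rightarrow> real) \<Rightarrow> bool" where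
  "GammaK k A mu \<longleftrightarrow> (\<forall>j. 1 \<le> j \<and> j \<le> k \<longrightarrow> esym j mu A > 0)"

definition admissible :: "nat \<Rightarrow> nat \<Rightarrow> ('a::euclidean_space \<Rightarrow> real) \<Rightarrow> bool" where
  "admissible P k u \<longleftrightarrow>
     (\<forall>x \<in> sphere 0 1. GammaK k (multi_idx (DIM('a) - 1) P) (LamP (eigvals u x)))"

end

theory Submission
  imports Defs "HOL-Computational_Algebra.Fundamental_Theorem_Algebra"
begin

text \<open>
  Let \<open>h(x) = |x| u(x/|x|)\<close> be the one-homogeneous extension of \<open>u\<close>. At a point \<open>x\<close> of the sphere the flat
  Hessian \<open>D\<^sup>2h(x)\<close> annihilates \<open>x\<close> and equals \<open>\<nabla>\<^sup>2u + uI\<close> on the tangent space, and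
  \<open>|Dh|\<^sup>2 = u\<^sup>2 + |\<nabla>u|\<^sup>2\<close>; so no commutators of covariant derivatives occur.

  The logarithm of \<open>\<sigma>\<^sub>k/\<sigma>\<^sub>l\<close> is concave on \<open>\<Gamma>\<^sub>k\<close>. A supporting functional \<open>c\<close> at an eigenvalue vector
  is positive on the whole cone, and because \<open>k\<close> does not exceed the number of multi-indices containing a
  given index, the cone contains a neighbourhood of every coordinate axis. Hence
  \<open>c\<^sub>i \<ge> \<theta> (c\<^sub>1 + \<dots> + c\<^sub>n)\<close> with a universal \<open>\<theta>\<close>: the equation is uniformly elliptic. Testing concavity
  against multiples of \<open>(1,\<dots>,1)\<close> bounds \<open>c\<^sub>1 + \<dots> + c\<^sub>n\<close> from below, and at a minimum of \<open>u\<close> it bounds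
  \<open>u\<close> from below, since \<open>p > q - l\<close>.

  At a maximum over \<open>|x| = |v| = 1\<close> of \<open>D\<^sup>2h(x)(v,v) + (A/2)|Dh(x)|\<^sup>2\<close> the function is compared along great
  circles with the equation differentiated twice. With largest eigenvalue \<open>L\<close> and \<open>T = c\<^sub>1 + \<dots> + c\<^sub>n\<close>,
  the good term \<open>A \<theta> T L\<^sup>2\<close> dominates all others once \<open>A\<close> is large, which bounds \<open>L\<close>.
\<close>

section \<open>Newton's inequality\<close>

text \<open>The obstacle is that \<open>eigvals\<close> is a pointwise choice without any regularity
  in x, so the operator is never differentiated as a function of matrices. Concavity replaces its
  derivatives. A functional c supporting the operator at one point bounds it at every other point by
  the sum of c i times the diagonal Hessian entries in any orthonormal tangent frame, because those
  entries are averages of the eigenvalues with doubly stochastic weights. This one-sided inequality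
  is an equality at the base point, and both differentiated equations are read off from that.

  The Hessian of the logarithm of the right-hand side is of size L^2 with a coefficient fixed by the
  data, plus a part of size A L from third derivatives. The gradient term is added because the
  linearised operator applied to it contains A times the sum of c i lam i^2. The lower bound for T
  is what lets A be fixed from the data alone, since the terms to be beaten carry no factor T,
  except one of size T L. Only the largest eigenvalue needs a bound: positivity of the trace on the
  cone then controls the smallest.\<close>

definition splits_real :: "real poly \<Rightarrow> bool" where
  "splits_real p \<longleftrightarrow> (\<exists>c rs. p = smult c (\<Prod>r\<leftarrow>rs. [:-r, 1:]))"

lemma poly_of_real: "poly (map_poly complex_of_real p) (of_real x) = of_real (poly p x)"
  by (induction p) (auto simp: map_poly_pCons)

lemma map_poly_of_real_mult:
  "map_poly complex_of_real (p * q) = map_poly of_real p * map_poly of_real q"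
  by (intro poly_eqI) (simp add: coeff_map_poly coeff_mult)

text \<open>The fundamental theorem of algebra supplies a complex root; the hypothesis makes it
  real, and the polynomial left after dividing out its linear factor inherits the
  hypothesis.\<close>

lemma splits_real_if_no_nonreal_root:
  fixes p :: "real poly"
  assumes "\<And>z. poly (map_poly complex_of_real p) z = 0 \<Longrightarrow> Im z = 0" 
  shows "splits_real p"
  using assms
proof (induction "degree p" arbitrary: p)
  case 0
  then obtain a where "p = [:a:]" using degree_eq_zeroE by metis
  then have "p = smult a (\<Prod>r\<leftarrow>[]. [:-r, 1:])" by simp
  then show ?case unfolding splits_real_def by blast
next
  case (Suc d)
  let ?P = "map_poly complex_of_real p"
  have "degree ?P = Suc d" using Suc(2) by (simp add: degree_map_poly)
  then have "\<not> constant (poly ?P)" by (simp add: constant_degree)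
  then obtain z where z: "poly ?P z = 0" using fundamental_theorem_of_algebra by blast
  then have "Im z = 0" using Suc(3) by blast
  then have zr: "z = of_real (Re z)" by (simp add: complex_eq_iff)
  have "poly ?P (of_real (Re z)) = 0" using z zr by argo
  then have "poly p (Re z) = 0" by (simp add: poly_of_real)
  then obtain g where g: "p = [:-Re z, 1:] * g" by (auto simp: poly_eq_0_iff_dvd dvd_def)
  have g0: "g \<noteq> 0" using g Suc(2) by auto
  have "degree p = Suc (degree g)" unfolding g using g0 by (subst degree_mult_eq) auto
  then have dg: "d = degree g" using Suc(2) by simp
  have "Im w = 0" if "poly (map_poly complex_of_real g) w = 0" for w
    using Suc(3)[of w] that unfolding g map_poly_of_real_mult by simp
  from Suc(1)[OF dg this] obtain c rs where "g = smult c (\<Prod>r\<leftarrow>rs. [:-r, 1:])"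
    unfolding splits_real_def by blast
  then have "p = smult c (\<Prod>r\<leftarrow>Re z # rs. [:-r, 1:])" using g by simp
  then show ?case unfolding splits_real_def by blast
qed

text \<open>The logarithmic derivative is the sum of 1/(z - r), and each summand has imaginary part
  of sign opposite to Im z. The factor Im z treats both half planes at once; strictness for nonempty
  \<open>rs\<close> keeps the derivative from vanishing at z.\<close>

lemma prod_linear_log_deriv:
  assumes "Im z \<noteq> 0"
  defines "Q \<equiv> \<lambda>rs. (\<Prod>r\<leftarrow>rs. [:-complex_of_real r, 1:])"
  shows "poly (Q rs) z \<noteq> 0 \<and>
    Im z * Im (poly (pderiv (Q rs)) z / poly (Q rs) z) \<le> 0 \<and>
    (rs \<noteq> [] \<longrightarrow> Im z * Im (poly (pderiv (Q rs)) z / poly (Q rs) z) < 0)"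
proof (induction rs)
  case Nil
  then show ?case by (simp add: Q_def)
next
  case (Cons r rs)
  have Q: "Q (r # rs) = [:-of_real r, 1:] * Q rs" by (simp add: Q_def)
  have nz: "z - of_real r \<noteq> 0" using assms by (auto simp: complex_eq_iff)
  have "pderiv [:-complex_of_real r, 1:] = 1" by (simp add: pderiv_pCons)
  then have "poly (pderiv (Q (r # rs))) z = (z - of_real r) * poly (pderiv (Q rs)) z + poly (Q rs) z"
    unfolding Q pderiv_mult by (simp add: algebra_simps)
  moreover have P: "poly (Q (r # rs)) z = (z - of_real r) * poly (Q rs) z" by (simp add: Q algebra_simps)
  moreover have "(w * D + q) / (w * q) = D / q + 1 / w" if "w \<noteq> 0" "q \<noteq> 0" for w D q :: complex
    using that by (simp add: field_simps)
  ultimately have e: "poly (pderiv (Q (r # rs))) z / poly (Q (r # rs)) z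
      = poly (pderiv (Q rs)) z / poly (Q rs) z + 1 / (z - of_real r)"
    using nz Cons.IH by presburger
  have "Im z * Im (1 / (z - of_real r)) = - (Im z)\<^sup>2 / (cmod (z - of_real r))\<^sup>2"
    by (simp add: Im_divide cmod_power2) (simp add: power2_eq_square)
  also have "\<dots> < 0" using nz assms by simp
  finally have "Im z * Im (1 / (z - of_real r)) < 0" .
  then show ?case using e P nz Cons.IH by (simp add: distrib_left)
qed

lemma map_poly_of_real_prod_list:
  "map_poly complex_of_real (\<Prod>r\<leftarrow>rs. [:-r, 1:]) = (\<Prod>r\<leftarrow>rs. [:-complex_of_real r, 1:])"
  by (induction rs) (simp_all add: map_poly_of_real_mult map_poly_pCons del: mult_pCons_left)

lemma map_poly_of_real_pderiv:
  "map_poly complex_of_real (pderiv p) = pderiv (map_poly of_real p)"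
  by (intro poly_eqI) (simp add: coeff_map_poly coeff_pderiv)

lemma map_poly_of_real_smult:
  "map_poly complex_of_real (smult c p) = smult (of_real c) (map_poly of_real p)"
  by (intro poly_eqI) (simp add: coeff_map_poly)

text \<open>By Gauss--Lucas, applied to the upper and to the lower half plane.\<close>
lemma splits_real_pderiv:
  assumes "splits_real p"
  shows "splits_real (pderiv p)"
proof -
  obtain c rs where p: "p = smult c (\<Prod>r\<leftarrow>rs. [:-r, 1:])"
    using assms unfolding splits_real_def by blast
  show ?thesis
  \<comment> \<open>The derivative is zero in this case; it counts as split because the leading
    factor in \<open>splits_real\<close> may be 0.\<close>
  proof (cases "c = 0 \<or> rs = []")
    case True
    then have "pderiv p = smult 0 (\<Prod>r\<leftarrow>[]. [:-r, 1:])" using p by (auto simp: pderiv_smult)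
    then show ?thesis unfolding splits_real_def by blast
  next
    case False
    show ?thesis
    proof (rule splits_real_if_no_nonreal_root, rule ccontr)
      fix z assume z: "poly (map_poly complex_of_real (pderiv p)) z = 0" and "Im z \<noteq> 0"
      then show False
        using prod_linear_log_deriv[of z rs] False unfolding p
        by (simp add: map_poly_of_real_pderiv map_poly_of_real_smult pderiv_smult
            map_poly_of_real_prod_list)
    qed
  qed
qed

text \<open>Away from the roots the defect is p^2 times the sum of 1/(x - r)^2. The induction uses a
  division-free form: a new factor x - r turns the defect D of f into f^2 + (x - r)^2 D.\<close>

lemma splits_real_laguerre:
  assumes "splits_real p"
  shows "poly p x * poly (pderiv (pderiv p)) x \<le> (poly (pderiv p) x)\<^sup>2"
proof -
  obtain c rs where p: "p = smult c (\<Prod>r\<leftarrow>rs. [:-r, 1:])"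
    using assms unfolding splits_real_def by blast
  have "poly g x * poly (pderiv (pderiv g)) x \<le> (poly (pderiv g) x)\<^sup>2"
    if "g = (\<Prod>r\<leftarrow>rs. [:-r, 1:])" for g
    using that
  proof (induction rs arbitrary: g)
    case Nil
    then show ?case by simp
  next
    case (Cons r rs)
    define f where "f = (\<Prod>r\<leftarrow>rs. [:-r, 1:])"
    have g: "g = [:-r, 1:] * f" using Cons.prems by (simp add: f_def)
    have 1: "pderiv [:-r, 1:] = 1" by (simp add: pderiv_pCons)
    have IH: "poly f x * poly (pderiv (pderiv f)) x \<le> (poly (pderiv f) x)\<^sup>2"
      using Cons.IH f_def by blast
    have "(poly (pderiv g) x)\<^sup>2 - poly g x * poly (pderiv (pderiv g)) x
       = (poly f x)\<^sup>2 + (x - r)\<^sup>2 * ((poly (pderiv f) x)\<^sup>2 - poly f x * poly (pderiv (pderiv f)) x)"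
      unfolding g pderiv_mult 1 pderiv_add
      by (simp add: pderiv_mult 1 power2_eq_square algebra_simps del: mult_pCons_left)
    also have "\<dots> \<ge> 0" using IH by (intro add_nonneg_nonneg mult_nonneg_nonneg) auto
    finally show ?case by simp
  qed
  from this[OF refl] have "c\<^sup>2 * (poly (\<Prod>r\<leftarrow>rs. [:-r, 1:]) x * poly (pderiv (pderiv (\<Prod>r\<leftarrow>rs. [:-r, 1:]))) x)
     \<le> c\<^sup>2 * (poly (pderiv (\<Prod>r\<leftarrow>rs. [:-r, 1:])) x)\<^sup>2"
    by (intro mult_left_mono) auto
  then show ?thesis unfolding p by (simp add: pderiv_smult power2_eq_square algebra_simps)
qed

text \<open>Laguerre's inequality at 0 for the m-th derivative, whose value and first two
  derivatives there are m!, (m+1)! and (m+2)! times consecutive coefficients of p.\<close>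

lemma splits_real_newton:
  assumes "splits_real p"
  shows "coeff p m * coeff p (Suc (Suc m)) \<le> (coeff p (Suc m))\<^sup>2"
proof -
  have s: "splits_real ((pderiv ^^ m) p)" for m
    by (induction m) (use assms splits_real_pderiv in auto)
  define g where "g = (pderiv ^^ m) p"
  have c: "coeff ((pderiv ^^ j) p) 0 = fact j * coeff p j" for j
    by (simp add: coeff_higher_pderiv pochhammer_fact[symmetric])
  have "poly g 0 * poly (pderiv (pderiv g)) 0 \<le> (poly (pderiv g) 0)\<^sup>2"
    by (intro splits_real_laguerre) (simp add: g_def s)
  then have "(fact m * coeff p m) * (fact (Suc (Suc m)) * coeff p (Suc (Suc m)))
      \<le> (fact (Suc m) * coeff p (Suc m))\<^sup>2"
    using c[of m] c[of "Suc m"] c[of "Suc (Suc m)"] by (simp add: g_def poly_0_coeff_0)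
  then have "(fact m)\<^sup>2 * (real m + 1) * ((real m + 2) * (coeff p m * coeff p (Suc (Suc m))))
     \<le> (fact m)\<^sup>2 * (real m + 1) * ((real m + 1) * (coeff p (Suc m))\<^sup>2)"
    by (simp add: power2_eq_square algebra_simps)
  then have *: "(real m + 2) * (coeff p m * coeff p (Suc (Suc m))) \<le> (real m + 1) * (coeff p (Suc m))\<^sup>2"
    by (subst (asm) mult_le_cancel_left_pos) auto
  \<comment> \<open>The sharper factor (m + 2)/(m + 1) is given up. That weakens the bound only if
    the product is positive, hence the case split.\<close>
  show ?thesis
  proof (cases "coeff p m * coeff p (Suc (Suc m)) \<le> 0")
    case True
    then show ?thesis using zero_le_power2 order_trans by blast
  next
    case False
    then have "(real m + 1) * (coeff p m * coeff p (Suc (Suc m))) \<le> (real m + 1) * (coeff p (Suc m))\<^sup>2"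
      using * by (simp add: algebra_simps)
    then show ?thesis by (subst (asm) mult_le_cancel_left_pos) auto
  qed
qed

section \<open>Elementary symmetric polynomials of a finite family\<close>

lemma esym_0 [simp]: "finite A \<Longrightarrow> esym 0 mu A = 1"
proof -
  assume "finite A"
  then have "{J. J \<subseteq> A \<and> card J = 0} = {{}}" by (auto dest: finite_subset)
  then show ?thesis by (simp add: esym_def)
qed

lemma esym_Suc_empty [simp]: "esym (Suc m) mu {} = 0"
  by (auto simp: esym_def)

lemma esym_insert:
  assumes "finite A" "a \<notin> A"
  shows "esym (Suc m) mu (insert a A) = esym (Suc m) mu A + mu a * esym m mu A"
proof -
  let ?S = "\<lambda>m A. {J. J \<subseteq> A \<and> card J = m}"
  have fin: "finite (?S m A)" for m using assms(1) by auto
  have eq: "?S (Suc m) (insert a A) = ?S (Suc m) A \<union> insert a ` ?S m A"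
  proof (intro equalityI subsetI)
    fix J assume J: "J \<in> ?S (Suc m) (insert a A)"
    then have fJ: "finite J" using assms(1) finite_subset by blast
    show "J \<in> ?S (Suc m) A \<union> insert a ` ?S m A"
    proof (cases "a \<in> J")
      case True
      then have "J = insert a (J - {a})" "J - {a} \<in> ?S m A" using J fJ by auto
      then show ?thesis by blast
    next
      case False
      then show ?thesis using J by auto
    qed
  next
    fix J assume "J \<in> ?S (Suc m) A \<union> insert a ` ?S m A"
    then show "J \<in> ?S (Suc m) (insert a A)"
      using assms by (auto simp: card_insert_if finite_subset dest: subsetD)
  qed
  have disj: "?S (Suc m) A \<inter> insert a ` ?S m A = {}" using assms by auto
  have inj: "inj_on (insert a) (?S m A)" using assms by (auto simp: inj_on_def)
  have "esym (Suc m) mu (insert a A) = esym (Suc m) mu A + (\<Sum>J\<in>?S m A. \<Prod>i\<in>insert a J. mu i)"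
    unfolding esym_def eq using fin disj inj
    by (simp add: sum.union_disjoint sum.reindex)
  also have "(\<Sum>J\<in>?S m A. \<Prod>i\<in>insert a J. mu i) = (\<Sum>J\<in>?S m A. mu a * (\<Prod>i\<in>J. mu i))"
    using assms by (intro sum.cong refl prod.insert) (auto dest: finite_subset)
  finally show ?thesis by (simp add: esym_def sum_distrib_left)
qed

lemma esym_remove:
  assumes "finite A" "a \<in> A"
  shows "esym (Suc m) mu A = esym (Suc m) mu (A - {a}) + mu a * esym m mu (A - {a})"
  using esym_insert[of "A - {a}" a m mu] assms by (simp add: insert_absorb)

lemma coeff_prod_esym:
  "finite A \<Longrightarrow> coeff (\<Prod>a\<in>A. [:1, mu a:]) m = esym m mu A"
proof (induction A arbitrary: m rule: finite_induct)
  case empty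
  then show ?case by (cases m) auto
next
  case (insert a A)
  then show ?case by (cases m) (auto simp: esym_insert mult_pCons_left)
qed

text \<open>These are coefficients of the product of the factors 1 + mu a X. A root z solves 1 + z
  mu a = 0 for some a; if z were not real, the imaginary part would force mu a = 0, and then 1 =
  0.\<close>

lemma esym_newton:
  assumes "finite A"
  shows "esym m mu A * esym (Suc (Suc m)) mu A \<le> (esym (Suc m) mu A)\<^sup>2"
proof -
  have "splits_real (\<Prod>a\<in>A. [:1, mu a:])"
  proof (rule splits_real_if_no_nonreal_root, rule ccontr)
    fix z assume z: "poly (map_poly complex_of_real (\<Prod>a\<in>A. [:1, mu a:])) z = 0" "Im z \<noteq> 0"
    have "map_poly complex_of_real (\<Prod>a\<in>A. [:1, mu a:]) = (\<Prod>a\<in>A. [:1, of_real (mu a):])"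
      using assms
      by induction (auto simp: map_poly_of_real_mult map_poly_pCons simp del: mult_pCons_left)
    then obtain a where "1 + z * of_real (mu a) = 0"
      using z assms by (auto simp: poly_prod)
    then have "1 + Re z * mu a = 0" "Im z * mu a = 0" by (simp_all add: complex_eq_iff)
    then show False using z(2) by auto
  qed
  from splits_real_newton[OF this, of m] show ?thesis
    using assms by (simp add: coeff_prod_esym)
qed

section \<open>Concavity of quotients of elementary symmetric functions\<close>

lemma GammaK_mono: "GammaK k A x \<Longrightarrow> j \<le> k \<Longrightarrow> GammaK j A x"
  unfolding GammaK_def by auto

lemma GammaK_pos: "GammaK k A x \<Longrightarrow> finite A \<Longrightarrow> j \<le> k \<Longrightarrow> esym j x A > 0"
  unfolding GammaK_def by (cases j) auto

text \<open>Write s_m for the functions without a, and suppose s_{m+1} is the first that is not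
  positive. Positivity over A gives x a s_m > - s_{m+1} and s_{m+2} > - x a s_{m+1}; combined, s_m
  s_{m+2} > s_{m+1}^2, against Newton. This lets later inductions drop one index and one order
  together.\<close>

lemma GammaK_remove:
  assumes fin: "finite A" and a: "a \<in> A" and G: "GammaK (Suc j) A x"
  shows "GammaK j (A - {a}) x"
proof -
  have "m \<le> j \<longrightarrow> esym m x (A - {a}) > 0" for m
  proof (induction m)
    case 0
    then show ?case using fin by simp
  next
    case (Suc m)
    show ?case
    proof (intro impI, rule ccontr)
      assume mj: "Suc m \<le> j" and neg: "\<not> 0 < esym (Suc m) x (A - {a})"
      let ?s = "\<lambda>m. esym m x (A - {a})"
      have s0: "?s m > 0" using Suc mj by simp
      have 1: "?s (Suc m) + x a * ?s m > 0"
        using GammaK_pos[OF G fin, of "Suc m"] mj esym_remove[OF fin a, of m x] by simp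
      have 2: "?s (Suc (Suc m)) + x a * ?s (Suc m) > 0"
        using GammaK_pos[OF G fin, of "Suc (Suc m)"] mj esym_remove[OF fin a, of "Suc m" x] by simp
      have "(?s (Suc m))\<^sup>2 \<le> (x a * ?s m) * (- ?s (Suc m))"
        using mult_right_mono[of "- ?s (Suc m)" "x a * ?s m" "- ?s (Suc m)"] 1 neg
        by (simp add: power2_eq_square)
      also have "\<dots> = ?s m * (- (x a * ?s (Suc m)))" by simp
      also have "\<dots> < ?s m * ?s (Suc (Suc m))" using 2 s0 by (intro mult_strict_left_mono) auto
      also have "\<dots> \<le> (?s (Suc m))\<^sup>2" using esym_newton[of "A - {a}" m x] fin by simp
      finally show False by simp
    qed
  qed
  then show ?thesis unfolding GammaK_def by blast
qed

text \<open>On the right each product over m + 1 indices is counted once for every index in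
  it.\<close>

lemma esym_euler:
  assumes "finite A"
  shows "real (Suc m) * esym (Suc m) mu A = (\<Sum>a\<in>A. mu a * esym m mu (A - {a}))"
  using assms
proof (induction A arbitrary: m rule: finite_induct)
  case empty
  then show ?case by simp
next
  case (insert b A)
  have s: "(\<Sum>a\<in>insert b A. mu a * esym m mu (insert b A - {a}))
     = mu b * esym m mu A + (\<Sum>a\<in>A. mu a * esym m mu (insert b (A - {a})))"
  proof -
    have "insert b A - {a} = insert b (A - {a})" if "a \<in> A" for a using insert that by auto
    then show ?thesis using insert by (simp add: insert_Diff_if)
  qed
  show ?case
  proof (cases m)
    case 0
    then show ?thesis using insert.hyps insert.IH[of 0] s
      by (simp add: esym_insert)
  next
    case (Suc m')
    have "(\<Sum>a\<in>A. mu a * esym m mu (insert b (A - {a})))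
        = (\<Sum>a\<in>A. mu a * esym m mu (A - {a}) + mu b * (mu a * esym m' mu (A - {a})))"
      using insert.hyps by (intro sum.cong refl) (simp add: Suc esym_insert algebra_simps)
    also have "\<dots> = real (Suc m) * esym (Suc m) mu A + mu b * (real m * esym m mu A)"
      unfolding sum.distrib sum_distrib_left[symmetric] using insert.IH[of m] insert.IH[of m'] Suc by simp
    finally show ?thesis unfolding s using insert.hyps by (simp add: esym_insert algebra_simps)
  qed
qed

text \<open>The right side is the tangent plane at (a0, b0) of the parallel sum, which is concave
  and homogeneous of degree one; after clearing denominators the gap is a square. Positivity is
  asked of the sums because a single variable may be negative on the cone.\<close>

lemma parallel_sum_tangent:
  fixes a b a0 b0 :: real
  assumes "a + b > 0" "a0 + b0 > 0"
  shows "a * b / (a + b) \<le> (b0\<^sup>2 * a + a0\<^sup>2 * b) / (a0 + b0)\<^sup>2"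
proof -
  have "(b0\<^sup>2 * a + a0\<^sup>2 * b) * (a + b) - a * b * (a0 + b0)\<^sup>2 = (b0 * a - a0 * b)\<^sup>2"
    by (simp add: power2_eq_square algebra_simps)
  then have "a * b * (a0 + b0)\<^sup>2 \<le> (b0\<^sup>2 * a + a0\<^sup>2 * b) * (a + b)"
    by (smt (verit) zero_le_power2)
  then show ?thesis using assms by (simp add: frac_le_eq divide_le_eq pos_le_divide_eq mult.commute)
qed

text \<open>
  Concavity of \<open>\<sigma>\<^sub>j\<^sub>+\<^sub>1/\<sigma>\<^sub>j\<close>, in the form of a supporting linear functional. As in Marcus and Lopes,
  \<open>(j+1) \<sigma>\<^sub>j\<^sub>+\<^sub>1/\<sigma>\<^sub>j\<close> is the sum over \<open>i\<close> of the parallel sums \<open>x\<^sub>i b\<^sub>i / (x\<^sub>i + b\<^sub>i)\<close>, where \<open>b\<^sub>i\<close> is the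
  quotient of order one less in the other variables.
\<close>
lemma esym_quotient_support:
  assumes "finite A" "GammaK (Suc j) A x"
  shows "\<exists>c. (\<Sum>a\<in>A. c a * x a) = esym (Suc j) x A / esym j x A \<and>
    (\<forall>y. GammaK (Suc j) A y \<longrightarrow> esym (Suc j) y A / esym j y A \<le> (\<Sum>a\<in>A. c a * y a))"
  using assms
proof (induction j arbitrary: A)
  case 0
  have "esym (Suc 0) y A = (\<Sum>a\<in>A. y a)" for y :: "'a \<Rightarrow> real"
    using esym_euler[OF 0(1), of 0 y] 0 by simp
  then show ?case using 0 by (intro exI[of _ "\<lambda>_. 1"]) simp
next
  case (Suc j)
  note fin = Suc.prems(1)
  define b where "b y a = esym (Suc j) y (A - {a}) / esym j y (A - {a})" for y a
  have "\<forall>a\<in>A. \<exists>c. (\<Sum>i\<in>A - {a}. c i * x i) = b x a \<and>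
      (\<forall>y. GammaK (Suc j) (A - {a}) y \<longrightarrow> b y a \<le> (\<Sum>i\<in>A - {a}. c i * y i))"
    unfolding b_def using Suc.IH[of "A - {_}"] GammaK_remove[OF fin _ Suc.prems(2)] fin by auto
  then obtain c where cx: "\<And>a. a \<in> A \<Longrightarrow> (\<Sum>i\<in>A - {a}. c a i * x i) = b x a"
    and cy: "\<And>a y. a \<in> A \<Longrightarrow> GammaK (Suc j) (A - {a}) y \<Longrightarrow> b y a \<le> (\<Sum>i\<in>A - {a}. c a i * y i)"
    by metis
  \<comment> \<open>The sum is sigma_{j+1} over A divided by sigma_j without a, hence positive even
    where y a is negative.\<close>
  have pos: "y a + b y a > 0" and quot: "y a * esym (Suc j) y (A - {a}) / esym (Suc j) y A = y a * b y a / (y a + b y a)"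
    if "GammaK (Suc (Suc j)) A y" "a \<in> A" for y a
  proof -
    have 1: "esym (Suc j) y A > 0" using GammaK_pos[OF that(1) fin] by simp
    have 2: "esym j y (A - {a}) > 0"
      using GammaK_pos[OF GammaK_remove[OF fin that(2,1)]] fin by simp
    have e: "y a + b y a = esym (Suc j) y A / esym j y (A - {a})"
      using 2 by (simp add: b_def esym_remove[OF fin that(2)] field_simps)
    then show "y a + b y a > 0" using 1 2 by simp
    show "y a * esym (Suc j) y (A - {a}) / esym (Suc j) y A = y a * b y a / (y a + b y a)"
      unfolding e using 1 2 by (simp add: b_def)
  qed
  have q: "real (Suc (Suc j)) * (esym (Suc (Suc j)) y A / esym (Suc j) y A)
      = (\<Sum>a\<in>A. y a * b y a / (y a + b y a))" if "GammaK (Suc (Suc j)) A y" for y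
  proof -
    have "real (Suc (Suc j)) * (esym (Suc (Suc j)) y A / esym (Suc j) y A)
       = (\<Sum>a\<in>A. y a * esym (Suc j) y (A - {a}) / esym (Suc j) y A)"
      using esym_euler[OF fin, of "Suc j" y] by (simp add: sum_divide_distrib)
    then show ?thesis using quot[OF that] by simp
  qed
  define d where "d i = (\<Sum>a\<in>A. ((b x a)\<^sup>2 * (if i = a then 1 else 0) + (x a)\<^sup>2 * (if i = a then 0 else c a i))
      / (x a + b x a)\<^sup>2) / real (Suc (Suc j))" for i
  have d: "real (Suc (Suc j)) * (\<Sum>i\<in>A. d i * y i)
      = (\<Sum>a\<in>A. ((b x a)\<^sup>2 * y a + (x a)\<^sup>2 * (\<Sum>i\<in>A - {a}. c a i * y i)) / (x a + b x a)\<^sup>2)" for y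
  proof -
    have "real (Suc (Suc j)) * (\<Sum>i\<in>A. d i * y i)
      = (\<Sum>i\<in>A. \<Sum>a\<in>A. ((b x a)\<^sup>2 * (if i = a then y i else 0) + (x a)\<^sup>2 * (if i = a then 0 else c a i * y i))
        / (x a + b x a)\<^sup>2)"
      unfolding sum_distrib_left d_def sum_divide_distrib sum_distrib_right
      by (intro sum.cong refl) (auto simp del: of_nat_Suc)
    also have "\<dots> = (\<Sum>a\<in>A. \<Sum>i\<in>A. ((b x a)\<^sup>2 * (if i = a then y i else 0) + (x a)\<^sup>2 * (if i = a then 0 else c a i * y i))
        / (x a + b x a)\<^sup>2)"
      by (rule sum.swap)
    also have "\<dots> = (\<Sum>a\<in>A. ((b x a)\<^sup>2 * y a + (x a)\<^sup>2 * (\<Sum>i\<in>A - {a}. c a i * y i)) / (x a + b x a)\<^sup>2)"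
    proof (intro sum.cong refl)
      fix a assume a: "a \<in> A"
      have 1: "(\<Sum>i\<in>A. if i = a then 0 else c a i * y i) = (\<Sum>i\<in>A - {a}. c a i * y i)"
        using fin a by (simp add: sum.remove[of A a])
      have 2: "(\<Sum>i\<in>A. if i = a then y i else 0) = y a" using fin a by simp
      show "(\<Sum>i\<in>A. ((b x a)\<^sup>2 * (if i = a then y i else 0) + (x a)\<^sup>2 * (if i = a then 0 else c a i * y i))
        / (x a + b x a)\<^sup>2) = ((b x a)\<^sup>2 * y a + (x a)\<^sup>2 * (\<Sum>i\<in>A - {a}. c a i * y i)) / (x a + b x a)\<^sup>2"
        unfolding sum_divide_distrib[symmetric] sum.distrib sum_distrib_left[symmetric] 1 2 ..
    qed
    finally show ?thesis .
  qed
  show ?case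
  proof (intro exI[of _ d] conjI allI impI)
    have "((b x a)\<^sup>2 * x a + (x a)\<^sup>2 * b x a) / (x a + b x a)\<^sup>2 = x a * b x a / (x a + b x a)" if "a \<in> A" for a
    proof -
      have "(b x a)\<^sup>2 * x a + (x a)\<^sup>2 * b x a = x a * b x a * (x a + b x a)"
        by (simp add: power2_eq_square algebra_simps)
      then show ?thesis using pos[OF Suc.prems(2) that] by (simp add: power2_eq_square)
    qed
    then have "real (Suc (Suc j)) * (\<Sum>i\<in>A. d i * x i)
       = real (Suc (Suc j)) * (esym (Suc (Suc j)) x A / esym (Suc j) x A)"
      unfolding d q[OF Suc.prems(2)] using cx by (intro sum.cong) auto
    then show "(\<Sum>i\<in>A. d i * x i) = esym (Suc (Suc j)) x A / esym (Suc j) x A" 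
      by (simp only: mult_cancel_left) simp
  next
    fix y assume y: "GammaK (Suc (Suc j)) A y"
    have "real (Suc (Suc j)) * (esym (Suc (Suc j)) y A / esym (Suc j) y A)
       \<le> real (Suc (Suc j)) * (\<Sum>i\<in>A. d i * y i)"
      unfolding d q[OF y]
    proof (rule sum_mono)
      fix a assume a: "a \<in> A"
      have "y a * b y a / (y a + b y a) \<le> ((b x a)\<^sup>2 * y a + (x a)\<^sup>2 * b y a) / (x a + b x a)\<^sup>2"
        by (intro parallel_sum_tangent pos a y Suc.prems)
      \<comment> \<open>In the tangent plane b y a has a square as coefficient, so the bound of b y
        a by its supporting functional may be inserted.\<close>
      also have "\<dots> \<le> ((b x a)\<^sup>2 * y a + (x a)\<^sup>2 * (\<Sum>i\<in>A - {a}. c a i * y i)) / (x a + b x a)\<^sup>2"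
        using cy[OF a GammaK_remove[OF fin a y]]
        by (intro divide_right_mono add_left_mono mult_left_mono) auto
      finally show "y a * b y a / (y a + b y a) \<le> \<dots>" .
    qed
    then show "esym (Suc (Suc j)) y A / esym (Suc j) y A \<le> (\<Sum>i\<in>A. d i * y i)"
      by (rule mult_left_le_imp_le) simp
  qed
qed

text \<open>The logarithm telescopes over successive quotients sigma_{m+1}/sigma_m, so supporting
  functionals add up. Each step contributes d / q x, the derivative of ln q, and raises the value at
  x by 1, which is Euler's relation for degree k - l. Positivity on the cone holds because each d
  dominates a positive quotient.\<close>

lemma ln_esym_quotient_support:
  assumes "l \<le> k" "finite A" "GammaK k A x"
  shows "\<exists>c. (\<Sum>a\<in>A. c a * x a) = real k - real l \<and>
    (\<forall>y. GammaK k A y \<longrightarrow> (\<Sum>a\<in>A. c a * y a) \<ge> 0 \<and> (l < k \<longrightarrow> (\<Sum>a\<in>A. c a * y a) > 0) \<and>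
       ln (esym k y A / esym l y A) \<le> ln (esym k x A / esym l x A) + (\<Sum>a\<in>A. c a * y a) - (real k - real l))"
  using assms
proof (induction k rule: dec_induct)
  case base
  have "esym l y A / esym l y A = 1" if "GammaK l A y" for y
    using GammaK_pos[OF that base(1), of l] by simp
  then show ?case using base by (intro exI[of _ "\<lambda>_. 0"]) auto
next
  case (step k)
  note fin = step.prems(1) and x = step.prems(2)
  have xk: "GammaK k A x" using GammaK_mono[OF x] by simp
  obtain c where cx: "(\<Sum>a\<in>A. c a * x a) = real k - real l"
    and cy: "\<And>y. GammaK k A y \<Longrightarrow> (\<Sum>a\<in>A. c a * y a) \<ge> 0"
      "\<And>y. GammaK k A y \<Longrightarrow> ln (esym k y A / esym l y A) \<le> ln (esym k x A / esym l x A) + (\<Sum>a\<in>A. c a * y a) - (real k - real l)"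
    using step.IH[OF fin xk] by blast
  obtain d where dx: "(\<Sum>a\<in>A. d a * x a) = esym (Suc k) x A / esym k x A"
    and dy: "\<And>y. GammaK (Suc k) A y \<Longrightarrow> esym (Suc k) y A / esym k y A \<le> (\<Sum>a\<in>A. d a * y a)"
    using esym_quotient_support[OF fin x] by blast
  define q where "q y = esym (Suc k) y A / esym k y A" for y
  have qpos: "q y > 0" if "GammaK (Suc k) A y" for y
    using GammaK_pos[OF that fin] by (simp add: q_def)
  have split: "ln (esym (Suc k) y A / esym l y A) = ln (q y) + ln (esym k y A / esym l y A)"
    if "GammaK (Suc k) A y" for y
  proof -
    have p: "esym (Suc k) y A > 0" "esym k y A > 0" "esym l y A > 0"
      using GammaK_pos[OF that fin] step(1) by auto
    then have "esym (Suc k) y A / esym l y A = q y * (esym k y A / esym l y A)" by (simp add: q_def)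
    then show ?thesis using p qpos[OF that] ln_mult[of "q y" "esym k y A / esym l y A"] by simp
  qed
  have sum: "(\<Sum>a\<in>A. (c a + d a / q x) * y a) = (\<Sum>a\<in>A. c a * y a) + (\<Sum>a\<in>A. d a * y a) / q x" for y
    by (simp add: distrib_right sum.distrib sum_divide_distrib)
  show ?case
  proof (intro exI[of _ "\<lambda>a. c a + d a / q x"] conjI allI impI)
    show "(\<Sum>a\<in>A. (c a + d a / q x) * x a) = real (Suc k) - real l"
      unfolding sum cx dx q_def[symmetric] using qpos[OF x] by simp
    fix y assume y: "GammaK (Suc k) A y"
    have yk: "GammaK k A y" using GammaK_mono[OF y] by simp
    have "q y / q x \<le> (\<Sum>a\<in>A. d a * y a) / q x"
      using dy[OF y] qpos[OF x] by (intro divide_right_mono) (auto simp: q_def)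
    moreover have "q y / q x > 0" using qpos[OF x] qpos[OF y] by simp
    ultimately show "(\<Sum>a\<in>A. (c a + d a / q x) * y a) > 0" "(\<Sum>a\<in>A. (c a + d a / q x) * y a) \<ge> 0"
      unfolding sum using cy(1)[OF yk] by simp_all
    have "ln (q y / q x) \<le> q y / q x - 1" using \<open>q y / q x > 0\<close> by (rule ln_le_minus_one)
    then have "ln (q y) \<le> ln (q x) + q y / q x - 1"
      using qpos[OF x] qpos[OF y] by (simp add: ln_div)
    then show "ln (esym (Suc k) y A / esym l y A) \<le> ln (esym (Suc k) x A / esym l x A)
        + (\<Sum>a\<in>A. (c a + d a / q x) * y a) - (real (Suc k) - real l)"
      unfolding sum split[OF x] split[OF y] using cy(2)[OF yk] \<open>q y / q x \<le> _\<close> by simp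
  qed
qed

section \<open>Doubly stochastic averages\<close>

text \<open>A decreasing sequence majorises its doubly stochastic averages: the differences d have
  nonpositive partial sums and total 0. Summation by parts against the increasing weights c then
  gives the claim.\<close>

lemma sorted_doubly_stochastic_le:
  fixes c lam :: "nat \<Rightarrow> real"
  assumes c: "\<And>i j. i \<le> j \<Longrightarrow> j < n \<Longrightarrow> c i \<le> c j"
    and lam: "\<And>i j. i \<le> j \<Longrightarrow> j < n \<Longrightarrow> lam j \<le> lam i"
    and S: "\<And>i j. i < n \<Longrightarrow> j < n \<Longrightarrow> S i j \<ge> 0"
      "\<And>i. i < n \<Longrightarrow> (\<Sum>j<n. S i j) = 1" "\<And>j. j < n \<Longrightarrow> (\<Sum>i<n. S i j) = (1::real)"
  shows "(\<Sum>i<n. c i * lam i) \<le> (\<Sum>i<n. c i * (\<Sum>j<n. S i j * lam j))"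
proof (cases "n = 0")
  case False
  define d where "d i = (\<Sum>j<n. S i j * lam j) - lam i" for i
  have split_ind: "(\<Sum>j<n. (if j < m then 1 else 0) * f j) = (\<Sum>j<m. f j)" if "m \<le> n" for m and f :: "nat \<Rightarrow> real"
  proof -
    have "{..<n} \<inter> {..<m} = {..<m}" using that by auto
    then have "(\<Sum>j<m. f j) = (\<Sum>j<n. if j \<in> {..<m} then f j else 0)"
      using sum.inter_restrict[of "{..<n}" f "{..<m}"] by simp
    also have "\<dots> = (\<Sum>j<n. (if j < m then 1 else 0) * f j)" by (intro sum.cong) auto
    finally show ?thesis ..
  qed
  have D: "(\<Sum>i<m. d i) \<le> 0" and Dn: "m = n \<Longrightarrow> (\<Sum>i<m. d i) = 0" if "0 < m" "m \<le> n" for m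
  proof -
    define w where "w j = (\<Sum>i<m. S i j)" for j
    have w1: "(\<Sum>j<n. w j) = real m"
    proof -
      have "(\<Sum>j<n. w j) = (\<Sum>i<m. \<Sum>j<n. S i j)" unfolding w_def by (rule sum.swap)
      also have "\<dots> = (\<Sum>i<m. 1)" using that by (intro sum.cong) (auto intro: S(2))
      finally show ?thesis by simp
    qed
    have wS: "(\<Sum>i<m. \<Sum>j<n. S i j * lam j) = (\<Sum>j<n. w j * lam j)"
      unfolding w_def sum_distrib_right by (rule sum.swap)
    have w01: "w j \<ge> 0" "w j \<le> 1" if j: "j < n" for j
    proof -
      show "w j \<ge> 0" unfolding w_def using \<open>m \<le> n\<close> j by (intro sum_nonneg S) auto
      have "w j \<le> (\<Sum>i<n. S i j)" unfolding w_def using \<open>m \<le> n\<close> j by (intro sum_mono2 S) auto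
      then show "w j \<le> 1" using S(3)[OF j] by simp
    qed
    let ?e = "\<lambda>j. w j - (if j < m then 1 else 0)"
    have "(\<Sum>i<m. d i) = (\<Sum>j<n. ?e j * lam j)"
      unfolding d_def sum_subtractf wS left_diff_distrib split_ind[OF that(2)] ..
    \<comment> \<open>Subtracting lam (m - 1) is free because the weights \<open>?e\<close> have
      total 0, and it makes every summand nonpositive: both factors change sign between j < m and j
      >= m.\<close>
    also have "\<dots> = (\<Sum>j<n. ?e j * (lam j - lam (m - 1))) + lam (m - 1) * (\<Sum>j<n. ?e j)"
      by (simp add: sum_distrib_left sum.distrib[symmetric] algebra_simps)
    also have "(\<Sum>j<n. ?e j) = 0"
      unfolding sum_subtractf w1 using split_ind[OF that(2), of "\<lambda>_. 1"] by simp
    finally have e: "(\<Sum>i<m. d i) = (\<Sum>j<n. ?e j * (lam j - lam (m - 1)))" by simp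
    show "(\<Sum>i<m. d i) \<le> 0" unfolding e
    proof (rule sum_nonpos)
      fix j assume "j \<in> {..<n}"
      then have j: "j < n" by simp
      show "?e j * (lam j - lam (m - 1)) \<le> 0"
      proof (cases "j < m")
        case True
        then show ?thesis using w01[OF j] lam[of j "m - 1"] that by (intro mult_nonpos_nonneg) auto
      next
        case False
        then show ?thesis using w01[OF j] lam[of "m - 1" j] j that by (intro mult_nonneg_nonpos) auto
      qed
    qed
    assume "m = n"
    then have "w j = 1" if "j < n" for j using S(3)[OF that] by (simp add: w_def)
    then show "(\<Sum>i<m. d i) = 0" unfolding e using \<open>m = n\<close> by (intro sum.neutral) auto
  qed
  \<comment> \<open>Summation by parts as an induction: replacing c m by the larger c (Suc m) in
    front of a nonpositive partial sum only decreases the left side.\<close>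
  have "c m * (\<Sum>i<Suc m. d i) \<le> (\<Sum>i<Suc m. c i * d i)" if "m < n" for m
    using that
  proof (induction m)
    case 0
    then show ?case by simp
  next
    case (Suc m)
    have "c (Suc m) * (\<Sum>i<Suc m. d i) \<le> c m * (\<Sum>i<Suc m. d i)"
      using c[of m "Suc m"] D[of "Suc m"] Suc.prems by (intro mult_right_mono_neg) auto
    also have "\<dots> \<le> (\<Sum>i<Suc m. c i * d i)" using Suc by simp
    finally show ?case by (simp add: distrib_left)
  qed
  from this[of "n - 1"] have "0 \<le> (\<Sum>i<n. c i * d i)" using False Dn[of n] by simp
  then show ?thesis by (simp add: d_def right_diff_distrib sum_subtractf)
qed simp

lemma sorting_permutation:
  fixes c :: "nat \<Rightarrow> real"
  obtains \<rho> where "\<rho> permutes {..<n}" "\<And>i j. i \<le> j \<Longrightarrow> j < n \<Longrightarrow> c (\<rho> i) \<le> c (\<rho> j)"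
proof -
  define xs where "xs = sort_key c [0..<n]"
  have xs: "length xs = n" "distinct xs" "set xs = {..<n}" "sorted (map c xs)"
    by (auto simp: xs_def)
  define \<rho> where "\<rho> i = (if i < n then xs ! i else i)" for i
  have "bij_betw ((!) xs) {..<n} {..<n}" 
    by (rule bij_betw_nth) (simp_all add: xs)
  then have "bij_betw \<rho> {..<n} {..<n}"
    using bij_betw_cong[of "{..<n}" \<rho> "(!) xs" "{..<n}"] by (simp add: \<rho>_def)
  then have "\<rho> permutes {..<n}" by (rule bij_imp_permutes) (simp add: \<rho>_def)
  then show ?thesis
  proof (rule that)
    show "c (\<rho> i) \<le> c (\<rho> j)" if "i \<le> j" "j < n" for i j
      using sorted_nth_mono[OF xs(4), of i j] that xs(1) by (simp add: \<rho>_def)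
  qed
qed

text \<open>This is all that is needed of Birkhoff's theorem on doubly stochastic matrices.\<close>
lemma doubly_stochastic_ge_permutation:
  fixes c lam :: "nat \<Rightarrow> real"
  assumes S: "\<And>i j. i < n \<Longrightarrow> j < n \<Longrightarrow> S i j \<ge> 0"
      "\<And>i. i < n \<Longrightarrow> (\<Sum>j<n. S i j) = 1" "\<And>j. j < n \<Longrightarrow> (\<Sum>i<n. S i j) = (1::real)"
  obtains \<pi> where "\<pi> permutes {..<n}"
    "(\<Sum>i<n. c i * lam (\<pi> i)) \<le> (\<Sum>i<n. c i * (\<Sum>j<n. S i j * lam j))"
proof -
  obtain \<rho> where \<rho>: "\<rho> permutes {..<n}" "\<And>i j. i \<le> j \<Longrightarrow> j < n \<Longrightarrow> c (\<rho> i) \<le> c (\<rho> j)"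
    using sorting_permutation[of n c] by blast
  obtain \<tau> where \<tau>: "\<tau> permutes {..<n}" "\<And>i j. i \<le> j \<Longrightarrow> j < n \<Longrightarrow> - lam (\<tau> i) \<le> - lam (\<tau> j)"
    using sorting_permutation[of n "\<lambda>i. - lam i"] by blast
  have r: "\<rho> i < n \<longleftrightarrow> i < n" and t: "\<tau> i < n \<longleftrightarrow> i < n" for i
    using permutes_in_image[OF \<rho>(1)] permutes_in_image[OF \<tau>(1)] by auto
  have re: "(\<Sum>i<n. f (\<rho> i)) = (\<Sum>i<n. f i)" "(\<Sum>i<n. f (\<tau> i)) = (\<Sum>i<n. f i)" for f :: "nat \<Rightarrow> real"
    using sum.permute[OF \<rho>(1), of f] sum.permute[OF \<tau>(1), of f] by (simp_all add: o_def)
  have inv: "\<rho> (inv \<rho> i) = i" "inv \<rho> (\<rho> i) = i" for i using permutes_inverses[OF \<rho>(1)] by auto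
  \<comment> \<open>Permuting rows and columns of S by the two sorting permutations keeps it doubly
    stochastic, so the sorted case applies.\<close>
  have "(\<Sum>i<n. c (\<rho> i) * lam (\<tau> i)) \<le> (\<Sum>i<n. c (\<rho> i) * (\<Sum>j<n. S (\<rho> i) (\<tau> j) * lam (\<tau> j)))"
    using \<rho>(2) \<tau>(2) r t S re(1)[of "\<lambda>i. S i _"] re(2)[of "\<lambda>j. S _ j"]
    by (intro sorted_doubly_stochastic_le) auto
  also have "\<dots> = (\<Sum>i<n. c i * (\<Sum>j<n. S i j * lam j))"
    using re(2)[of "\<lambda>j. S _ j * lam j"] re(1)[of "\<lambda>i. c i * (\<Sum>j<n. S i j * lam j)"] by simp
  finally have "(\<Sum>i<n. c i * lam (\<tau> (inv \<rho> i))) \<le> \<dots>"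
    using re(1)[of "\<lambda>i. c i * lam (\<tau> (inv \<rho> i))"] by (simp add: inv)
  moreover have "\<tau> \<circ> inv \<rho> permutes {..<n}"
    using \<rho> \<tau> by (intro permutes_compose permutes_inv) auto
  ultimately show ?thesis using that[of "\<tau> \<circ> inv \<rho>"] by simp
qed

section \<open>Multi-indices and symmetric functions of their sums\<close>

lemma finite_multi_idx [simp]: "finite (multi_idx n P)"
  unfolding multi_idx_def by auto

lemma card_multi_idx_mem:
  assumes "i < n" "0 < P"
  shows "card {I \<in> multi_idx n P. i \<in> I} = (n - 1) choose (P - 1)"
proof -
  have "bij_betw (\<lambda>I. I - {i}) {I \<in> multi_idx n P. i \<in> I} {J. J \<subseteq> {..<n} - {i} \<and> card J = P - 1}"
  proof (rule bij_betwI[where g = "insert i"])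
    show "(\<lambda>I. I - {i}) \<in> {I \<in> multi_idx n P. i \<in> I} \<rightarrow> {J. J \<subseteq> {..<n} - {i} \<and> card J = P - 1}"
      by (auto simp: multi_idx_def)
    show "insert i \<in> {J. J \<subseteq> {..<n} - {i} \<and> card J = P - 1} \<rightarrow> {I \<in> multi_idx n P. i \<in> I}"
    proof (intro Pi_I)
      fix J assume J: "J \<in> {J. J \<subseteq> {..<n} - {i} \<and> card J = P - 1}"
      then have "finite J" "i \<notin> J" using finite_subset[of J "{..<n}"] by auto
      then show "insert i J \<in> {I \<in> multi_idx n P. i \<in> I}"
        using J assms by (auto simp: multi_idx_def)
    qed
  qed auto
  then have "card {I \<in> multi_idx n P. i \<in> I} = card {J. J \<subseteq> {..<n} - {i} \<and> card J = P - 1}"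
    by (rule bij_betw_same_card)
  also have "\<dots> = card ({..<n} - {i}) choose (P - 1)" by (rule n_subsets) simp
  finally show ?thesis using assms by simp
qed

lemma esym_pos_if_nonneg:
  assumes "finite A" "\<And>a. a \<in> A \<Longrightarrow> mu a \<ge> 0" "B \<subseteq> A" "\<And>b. b \<in> B \<Longrightarrow> mu b > 0" "j \<le> card B"
  shows "esym j mu A > 0"
proof -
  obtain J where J: "J \<subseteq> B" "card J = j" using assms(5) obtain_subset_with_card_n by metis
  then have "J \<subseteq> A" using assms by blast
  have fJ: "finite J" using \<open>J \<subseteq> A\<close> assms(1) finite_subset by blast
  have "0 < (\<Prod>i\<in>J. mu i)" using J assms(4) by (intro prod_pos) auto
  also have "\<dots> \<le> esym j mu A"
    unfolding esym_def using assms J \<open>J \<subseteq> A\<close>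
    by (intro member_le_sum[of J _ "\<lambda>J. \<Prod>i\<in>J. mu i"] prod_nonneg) auto
  finally show ?thesis .
qed

text \<open>A permutation of the indices acts injectively on multi-indices and on sets of
  multi-indices, hence bijectively, both being finite. Because of this the arbitrary order of the
  chosen eigenvalues does no harm.\<close>

lemma esym_LamP_permute:
  assumes "\<pi> permutes {..<n}"
  shows "esym m (LamP (lam \<circ> \<pi>)) (multi_idx n P) = esym m (LamP lam) (multi_idx n P)"
proof -
  have inj: "inj \<pi>" using assms permutes_inj by blast
  have im: "\<pi> ` {..<n} = {..<n}" using assms permutes_image by blast
  let ?f = "image \<pi>" and ?A = "multi_idx n P"
  have L: "LamP (lam \<circ> \<pi>) I = LamP lam (?f I)" for I
    unfolding LamP_def using inj by (simp add: sum.reindex inj_on_def)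
  have iif: "inj ?f" using inj by (simp add: inj_image_eq_iff inj_def)
  have "?f ` ?A \<subseteq> ?A"
    using im inj by (auto simp: multi_idx_def card_image inj_on_def subset_eq) 
  then have fA: "?f ` ?A = ?A"
    by (intro endo_inj_surj) (auto intro: inj_on_subset[OF iif])
  have "esym m (LamP (lam \<circ> \<pi>)) ?A = (\<Sum>J | J \<subseteq> ?A \<and> card J = m. \<Prod>I\<in>?f ` J. LamP lam I)"
    unfolding esym_def L by (intro sum.cong refl prod.reindex_cong[of ?f, symmetric])
      (auto intro: inj_on_subset[OF iif])
  also have "\<dots> = (\<Sum>J\<in>image ?f ` {J. J \<subseteq> ?A \<and> card J = m}. \<Prod>I\<in>J. LamP lam I)"
    by (subst sum.reindex) (auto simp: inj_on_def inj_image_eq_iff[OF iif])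
  also have "image ?f ` {J. J \<subseteq> ?A \<and> card J = m} = {J. J \<subseteq> ?A \<and> card J = m}"
  proof (rule endo_inj_surj)
    show "image ?f ` {J. J \<subseteq> ?A \<and> card J = m} \<subseteq> {J. J \<subseteq> ?A \<and> card J = m}"
      using fA iif by (auto simp: card_image inj_on_subset)
    show "inj_on (image ?f) {J. J \<subseteq> ?A \<and> card J = m}"
      by (auto simp: inj_on_def inj_image_eq_iff[OF iif])
  qed auto
  finally show ?thesis unfolding esym_def .
qed

section \<open>The operator as a function of the eigenvalues\<close>

definition quot_ln :: "nat \<Rightarrow> nat \<Rightarrow> nat \<Rightarrow> nat \<Rightarrow> (nat \<Rightarrow> real) \<Rightarrow> real" where
  "quot_ln n P k l lam =
     ln (esym k (LamP lam) (multi_idx n P) / esym l (LamP lam) (multi_idx n P))"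

definition hess_cone :: "nat \<Rightarrow> nat \<Rightarrow> nat \<Rightarrow> (nat \<Rightarrow> real) \<Rightarrow> bool" where
  "hess_cone n P k lam \<longleftrightarrow> GammaK k (multi_idx n P) (LamP lam)"

definition doubly_stochastic :: "nat \<Rightarrow> (nat \<Rightarrow> nat \<Rightarrow> real) \<Rightarrow> bool" where
  "doubly_stochastic n S \<longleftrightarrow> (\<forall>i<n. \<forall>j<n. S i j \<ge> 0) \<and> (\<forall>i<n. (\<Sum>j<n. S i j) = 1) \<and>
     (\<forall>j<n. (\<Sum>i<n. S i j) = 1)"

lemma esym_scale: "esym m (\<lambda>i. s * mu i) A = s ^ m * esym m mu A"
  unfolding esym_def sum_distrib_left
  by (intro sum.cong refl) (auto simp: prod.distrib)

lemma LamP_scale: "LamP (\<lambda>i. s * lam i) = (\<lambda>I. s * LamP lam I)"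
  by (auto simp: LamP_def sum_distrib_left)

lemma hess_cone_scale:
  assumes "s > 0" "hess_cone n P k lam"
  shows "hess_cone n P k (\<lambda>i. s * lam i)"
  using assms unfolding hess_cone_def GammaK_def LamP_scale esym_scale by simp

lemma quot_ln_scale:
  assumes "s > 0" "hess_cone n P k lam" "l \<le> k"
  shows "quot_ln n P k l (\<lambda>i. s * lam i) = quot_ln n P k l lam + (real k - real l) * ln s"
proof -
  let ?e = "\<lambda>m. esym m (LamP lam) (multi_idx n P)"
  have p: "?e k > 0" "?e l > 0"
    using GammaK_pos[of k "multi_idx n P" "LamP lam"] assms by (auto simp: hess_cone_def)
  have "ln (s ^ k * ?e k / (s ^ l * ?e l)) = ln (?e k / ?e l) + (real k - real l) * ln s"
    using p assms(1) by (simp add: ln_div ln_mult ln_realpow left_diff_distrib)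
  then show ?thesis unfolding quot_ln_def LamP_scale esym_scale .
qed

lemma sum_LamP:
  "(\<Sum>I\<in>multi_idx n P. d I * LamP lam I) = (\<Sum>i<n. (\<Sum>I | I \<in> multi_idx n P \<and> i \<in> I. d I) * lam i)"
proof -
  have "(\<Sum>I\<in>multi_idx n P. d I * LamP lam I)
      = (\<Sum>I\<in>multi_idx n P. \<Sum>i<n. if i \<in> I then d I * lam i else 0)"
  proof (intro sum.cong refl)
    fix I assume "I \<in> multi_idx n P"
    then have "{..<n} \<inter> I = I" by (auto simp: multi_idx_def)
    then show "d I * LamP lam I = (\<Sum>i<n. if i \<in> I then d I * lam i else 0)"
      unfolding LamP_def sum_distrib_left using sum.inter_restrict[of "{..<n}" "\<lambda>i. d I * lam i" I] by simp
  qed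
  also have "\<dots> = (\<Sum>i<n. \<Sum>I\<in>multi_idx n P. if i \<in> I then d I * lam i else 0)" by (rule sum.swap)
  also have "\<dots> = (\<Sum>i<n. (\<Sum>I | I \<in> multi_idx n P \<and> i \<in> I. d I) * lam i)"
    unfolding sum_distrib_right by (intro sum.cong refl sum.inter_filter[symmetric]) auto
  finally show ?thesis .
qed

context
  fixes n P k l :: nat
  assumes nP: "0 < n" "0 < P" and lk: "l < k" and kn: "k \<le> (n - 1) choose (P - 1)"
begin

lemma hess_cone_one: "hess_cone n P k (\<lambda>_. 1)"
  unfolding hess_cone_def GammaK_def
proof (intro allI impI)
  fix j assume "1 \<le> j \<and> j \<le> k"
  then have "j \<le> card {I \<in> multi_idx n P. 0 \<in> I}" using kn card_multi_idx_mem[OF nP] by simp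
  then show "esym j (LamP (\<lambda>_. 1)) (multi_idx n P) > 0"
    using nP by (intro esym_pos_if_nonneg[where B = "{I \<in> multi_idx n P. 0 \<in> I}"])
      (auto simp: LamP_def multi_idx_def)
qed

text \<open>The number of multi-indices containing a given \<open>i\<close> is at least \<open>k\<close>, so the cone is an open set
  around each coordinate axis; this is what makes the equation uniformly elliptic.\<close>
lemma hess_cone_axis:
  obtains \<epsilon> where "\<epsilon> > 0" "\<And>i. i < n \<Longrightarrow> hess_cone n P k (\<lambda>j. if j = i then 1 else - \<epsilon>)"
proof -
  \<comment> \<open>At \<epsilon> = 0 the vector is the axis itself: all sums are nonnegative, and
    those over the at least k multi-indices containing i are positive. Finitely many strict
    inequalities between continuous functions survive for small \<epsilon> > 0.\<close>
  have "\<forall>\<^sub>F \<epsilon> in at_right 0. \<forall>i\<in>{..<n}. \<forall>j\<in>{1..k}. esym j (LamP (\<lambda>j. if j = i then 1 else - \<epsilon>)) (multi_idx n P) > 0"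
  proof (intro eventually_ball_finite ballI)
    fix i j assume i: "i \<in> {..<n}" and j: "j \<in> {1..k}"
    have "((\<lambda>\<epsilon>::real. esym j (LamP (\<lambda>j. if j = i then 1 else - \<epsilon>)) (multi_idx n P))
       \<longlongrightarrow> esym j (LamP (\<lambda>j. if j = i then 1 else - 0)) (multi_idx n P)) (at_right 0)"
      unfolding esym_def LamP_def
      by (intro tendsto_sum tendsto_prod) (auto intro!: tendsto_eq_intros)
    moreover have "esym j (LamP (\<lambda>j. if j = i then 1 else - 0)) (multi_idx n P) > 0"
    proof (rule esym_pos_if_nonneg[where B = "{I \<in> multi_idx n P. i \<in> I}"])
      show "j \<le> card {I \<in> multi_idx n P. i \<in> I}" using i j kn nP card_multi_idx_mem[of i n P] by simp
      fix I assume "I \<in> {I \<in> multi_idx n P. i \<in> I}"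
      then have "finite I" "i \<in> I" by (auto simp: multi_idx_def dest: finite_subset)
      then show "LamP (\<lambda>j. if j = i then 1 else - 0) I > 0" by (simp add: LamP_def cong: if_cong)
    qed (auto simp: LamP_def intro!: sum_nonneg)
    ultimately show "\<forall>\<^sub>F \<epsilon> in at_right 0. esym j (LamP (\<lambda>j. if j = i then 1 else - \<epsilon>)) (multi_idx n P) > 0"
      by (rule order_tendstoD)
  qed auto
  then have "\<forall>\<^sub>F \<epsilon> in at_right 0. (\<forall>i\<in>{..<n}. \<forall>j\<in>{1..k}. esym j (LamP (\<lambda>j. if j = i then 1 else - \<epsilon>)) (multi_idx n P) > 0)
      \<and> \<epsilon> > (0::real)"
    by (intro eventually_conj) (auto simp: eventually_at_right_less)
  from eventually_happens[OF this] obtain \<epsilon> where "\<epsilon> > 0"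
    "\<forall>i\<in>{..<n}. \<forall>j\<in>{1..k}. esym j (LamP (\<lambda>j. if j = i then 1 else - \<epsilon>)) (multi_idx n P) > 0"
    by auto
  then show ?thesis by (intro that[of \<epsilon>]) (auto simp: hess_cone_def GammaK_def)
qed

text \<open>The functional d supporting on the level of the sums \<open>LamP\<close> is pulled back
  to c. It is positive on the cone; evaluated at the vector with 1 at i and - \<epsilon> elsewhere
  this says (1 + \<epsilon>) c i > \<epsilon> times the sum of c, so \<theta> = \<epsilon> / (1 +
  \<epsilon>). Averaging by S is allowed since some permutation does at least as badly and the
  operator is symmetric.\<close>

lemma quot_ln_support:
  obtains \<theta> where "\<theta> > 0" "\<And>lam0. hess_cone n P k lam0 \<Longrightarrow> \<exists>c.
      (\<Sum>i<n. c i * lam0 i) = real k - real l \<and> (\<Sum>i<n. c i) > 0 \<and>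
      (\<forall>i<n. c i \<ge> \<theta> * (\<Sum>i<n. c i)) \<and>
      (\<forall>lam S. hess_cone n P k lam \<and> doubly_stochastic n S \<longrightarrow>
         quot_ln n P k l lam \<le> quot_ln n P k l lam0 + (\<Sum>i<n. c i * (\<Sum>j<n. S i j * lam j)) - (real k - real l))"
proof -
  obtain \<epsilon> where \<epsilon>: "\<epsilon> > 0" "\<And>i. i < n \<Longrightarrow> hess_cone n P k (\<lambda>j. if j = i then 1 else - \<epsilon>)"
    using hess_cone_axis by blast
  show ?thesis
  proof (rule that[of "\<epsilon> / (1 + \<epsilon>)"])
    show "\<epsilon> / (1 + \<epsilon>) > 0" using \<epsilon> by simp
    fix lam0 assume lam0: "hess_cone n P k lam0"
    let ?A = "multi_idx n P"
    obtain d where d0: "(\<Sum>a\<in>?A. d a * LamP lam0 a) = real k - real l" and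
      d: "\<And>y. GammaK k ?A y \<Longrightarrow> (\<Sum>a\<in>?A. d a * y a) > 0 \<and> ln (esym k y ?A / esym l y ?A)
        \<le> ln (esym k (LamP lam0) ?A / esym l (LamP lam0) ?A) + (\<Sum>a\<in>?A. d a * y a) - (real k - real l)"
      using ln_esym_quotient_support[of l k ?A "LamP lam0"] lk lam0 unfolding hess_cone_def by auto
    define c where "c i = (\<Sum>I | I \<in> ?A \<and> i \<in> I. d I)" for i
    have cs: "(\<Sum>a\<in>?A. d a * LamP lam a) = (\<Sum>i<n. c i * lam i)" for lam
      unfolding sum_LamP c_def ..
    have cpos: "(\<Sum>i<n. c i * lam i) > 0"
      and csup: "quot_ln n P k l lam \<le> quot_ln n P k l lam0 + (\<Sum>i<n. c i * lam i) - (real k - real l)"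
      if "hess_cone n P k lam" for lam
      using d[of "LamP lam"] that unfolding hess_cone_def quot_ln_def cs by auto
    show "\<exists>c. (\<Sum>i<n. c i * lam0 i) = real k - real l \<and> (\<Sum>i<n. c i) > 0 \<and>
      (\<forall>i<n. c i \<ge> \<epsilon> / (1 + \<epsilon>) * (\<Sum>i<n. c i)) \<and>
      (\<forall>lam S. hess_cone n P k lam \<and> doubly_stochastic n S \<longrightarrow>
         quot_ln n P k l lam \<le> quot_ln n P k l lam0 + (\<Sum>i<n. c i * (\<Sum>j<n. S i j * lam j)) - (real k - real l))"
    proof (intro exI[of _ c] conjI allI impI)
      show "(\<Sum>i<n. c i * lam0 i) = real k - real l" using d0 cs by simp
      show "(\<Sum>i<n. c i) > 0" using cpos[OF hess_cone_one] by simp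
      fix i assume i: "i < n"
      have "(\<Sum>j<n. c j * (if j = i then 1 else - \<epsilon>)) = (\<Sum>j<n. (if j = i then (1 + \<epsilon>) * c j else 0) - \<epsilon> * c j)"
        by (intro sum.cong) (auto simp: algebra_simps)
      also have "\<dots> = (1 + \<epsilon>) * c i - \<epsilon> * (\<Sum>j<n. c j)"
        using i by (simp add: sum_subtractf sum_distrib_left)
      finally have "(1 + \<epsilon>) * c i > \<epsilon> * (\<Sum>j<n. c j)" using cpos[OF \<epsilon>(2)[OF i]] by simp
      then show "c i \<ge> \<epsilon> / (1 + \<epsilon>) * (\<Sum>i<n. c i)" using \<epsilon>(1) by (simp add: field_simps)
    next
      fix lam S assume a: "hess_cone n P k lam \<and> doubly_stochastic n S"
      then obtain \<pi> where \<pi>: "\<pi> permutes {..<n}"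
        "(\<Sum>i<n. c i * lam (\<pi> i)) \<le> (\<Sum>i<n. c i * (\<Sum>j<n. S i j * lam j))"
        using doubly_stochastic_ge_permutation[of n S c lam] unfolding doubly_stochastic_def by blast
      have "hess_cone n P k (lam \<circ> \<pi>)" "quot_ln n P k l (lam \<circ> \<pi>) = quot_ln n P k l lam"
        using a unfolding hess_cone_def GammaK_def quot_ln_def esym_LamP_permute[OF \<pi>(1)] by auto
      with csup[of "lam \<circ> \<pi>"] \<pi>(2)
      show "quot_ln n P k l lam \<le> quot_ln n P k l lam0 + (\<Sum>i<n. c i * (\<Sum>j<n. S i j * lam j)) - (real k - real l)"
        by simp
    qed
  qed
qed

text \<open>sigma_1 of the sums is a binomial coefficient times the trace, so the trace is positive,
  and no eigenvalue can be more negative than the others can compensate.\<close>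

lemma hess_cone_lower_bound:
  assumes "hess_cone n P k lam" "\<And>i. i < n \<Longrightarrow> lam i \<le> M"
  shows "M > 0" "i < n \<Longrightarrow> lam i \<ge> - (real n * M)"
proof -
  let ?N = "real ((n - 1) choose (P - 1))"
  have "0 < esym 1 (LamP lam) (multi_idx n P)"
    using assms(1) lk unfolding hess_cone_def GammaK_def by (auto dest: spec[of _ 1])
  also have "\<dots> = (\<Sum>I\<in>multi_idx n P. 1 * LamP lam I)"
    using esym_euler[of "multi_idx n P" 0 "LamP lam"] by simp
  also have "\<dots> = (\<Sum>j<n. ?N * lam j)"
    unfolding sum_LamP using card_multi_idx_mem[of _ n P] nP by (intro sum.cong) auto
  also have "\<dots> = ?N * (\<Sum>j<n. lam j)" by (simp add: sum_distrib_left)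
  finally have "?N * (\<Sum>j<n. lam j) > 0" .
  then have tr: "(\<Sum>j<n. lam j) > 0" by (auto simp: zero_less_mult_iff)
  have "(\<Sum>j<n. lam j) \<le> (\<Sum>j<n. M)" using assms by (intro sum_mono) auto
  then have "real n * M > 0" using tr by simp
  then show M: "M > 0" by (simp add: zero_less_mult_iff)
  assume i: "i < n"
  have "(\<Sum>j<n. lam j) = lam i + (\<Sum>j\<in>{..<n} - {i}. lam j)"
    using i by (simp add: sum.remove)
  also have "\<dots> \<le> lam i + (\<Sum>j\<in>{..<n} - {i}. M)" using assms by (intro add_left_mono sum_mono) auto
  also have "\<dots> \<le> lam i + real n * M" using M i by (simp add: mult_right_mono)
  finally show "lam i \<ge> - (real n * M)" using tr by simp
qed

end

section \<open>Calculus of directional derivatives\<close>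

definition dird :: "'a::euclidean_space \<Rightarrow> ('a \<Rightarrow> real) \<Rightarrow> 'a \<Rightarrow> real" where
  "dird v f x = frechet_derivative f (at x) v"

lemma dird_eq: "(f has_derivative f') (at x) \<Longrightarrow> dird v f x = f' v"
  unfolding dird_def using frechet_derivative_at by metis

lemma ehess_eq_dird: "ehess f x v w = dird w (dird v f) x"
  unfolding ehess_def dird_def ..

lemma dird_lincomb:
  assumes "f differentiable at x"
  shows "dird (a *\<^sub>R v + b *\<^sub>R w) f x = a * dird v f x + b * dird w f x"
  using linear_frechet_derivative[OF assms] by (simp add: dird_def linear_add linear_scale)

lemma dird_sum:
  assumes "f differentiable at x"
  shows "dird (\<Sum>i\<in>I. a i *\<^sub>R v i) f x = (\<Sum>i\<in>I. a i * dird (v i) f x)"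
  using linear_frechet_derivative[OF assms] by (simp add: dird_def linear_sum linear_scale)

lemma dird_cong:
  assumes "open U" "x \<in> U" "\<And>y. y \<in> U \<Longrightarrow> f y = g y" "f differentiable at x"
  shows "dird v f x = dird v g x"
  using frechet_derivative_transform_within_open[of f x U g] assms by (simp add: dird_def)

lemma Ck_on_Suc_open:
  "open U \<Longrightarrow> Ck_on (Suc k) U f \<longleftrightarrow> (\<forall>x\<in>U. f differentiable at x) \<and> (\<forall>v. Ck_on k U (dird v f))"
  by (simp add: dird_def[abs_def] differentiable_on_eq_differentiable_at)

lemma Ck_on_SucI:
  "open U \<Longrightarrow> (\<And>x. x \<in> U \<Longrightarrow> f differentiable at x) \<Longrightarrow> (\<And>v. Ck_on k U (dird v f)) \<Longrightarrow> Ck_on (Suc k) U f"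
  using Ck_on_Suc_open by blast

lemma Ck_on_Suc_differentiable: "open U \<Longrightarrow> Ck_on (Suc k) U f \<Longrightarrow> x \<in> U \<Longrightarrow> f differentiable at x"
  using Ck_on_Suc_open by blast

lemma Ck_on_Suc_dird: "open U \<Longrightarrow> Ck_on (Suc k) U f \<Longrightarrow> Ck_on k U (dird v f)"
  using Ck_on_Suc_open by blast

lemma Ck_on_cong:
  assumes "open U" "\<And>x. x \<in> U \<Longrightarrow> f x = g x" "Ck_on k U f"
  shows "Ck_on k U g"
  using assms(2,3)
proof (induction k arbitrary: f g)
  case 0
  then show ?case using continuous_on_eq by auto
next
  case (Suc k)
  note d = Ck_on_Suc_differentiable[OF assms(1) Suc(3)]
  have "g differentiable at x" if "x \<in> U" for x
    using d[OF that] has_derivative_transform_within_open[of f _ x UNIV U g] assms(1) that Suc(2)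
    unfolding differentiable_def by metis
  moreover have "Ck_on k U (dird v g)" for v
  proof (rule Suc.IH[of "dird v f"])
    show "dird v f x = dird v g x" if "x \<in> U" for x by (rule dird_cong[OF assms(1) that Suc(2) d[OF that]])
    show "Ck_on k U (dird v f)" by (rule Ck_on_Suc_dird[OF assms(1) Suc(3)])
  qed
  ultimately show ?case by (intro Ck_on_SucI assms(1))
qed

lemma Ck_on_SucD:
  assumes "open U" "Ck_on (Suc k) U f" shows "Ck_on k U f"
  using assms(2)
proof (induction k arbitrary: f)
  case 0
  then show ?case by (simp add: differentiable_imp_continuous_on)
next
  case (Suc k)
  show ?case
    using Ck_on_Suc_differentiable[OF assms(1) Suc.prems] Suc.IH[OF Ck_on_Suc_dird[OF assms(1) Suc.prems]]
    by (intro Ck_on_SucI assms(1))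
qed

lemma Ck_on_le: "open U \<Longrightarrow> Ck_on k U f \<Longrightarrow> j \<le> k \<Longrightarrow> Ck_on j U f"
  by (induction k) (auto simp: le_Suc_eq intro: Ck_on_SucD simp del: Ck_on.simps)

lemma Ck_on_const: "open U \<Longrightarrow> Ck_on k U (\<lambda>_. c)"
proof (induction k arbitrary: c)
  case (Suc k)
  have "dird v (\<lambda>_. c) = (\<lambda>_. 0)" for v :: 'a
    by (rule ext) (rule dird_eq, rule has_derivative_const)
  then show ?case using Suc by (intro Ck_on_SucI) (auto simp del: Ck_on.simps)
qed simp

lemma Ck_on_add:
  assumes "open U"
  shows "Ck_on k U f \<Longrightarrow> Ck_on k U g \<Longrightarrow> Ck_on k U (\<lambda>x. f x + g x)"
proof (induction k arbitrary: f g)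
  case 0
  then show ?case by (auto intro: continuous_intros)
next
  case (Suc k)
  have d: "f differentiable at x" "g differentiable at x" if "x \<in> U" for x
    using Suc(2,3) that assms(1) Ck_on_Suc_differentiable by blast+
  have "Ck_on k U (dird v (\<lambda>x. f x + g x))" for v
  proof (rule Ck_on_cong[OF assms])
    show "Ck_on k U (\<lambda>x. dird v f x + dird v g x)"
      by (intro Suc.IH Ck_on_Suc_dird[OF assms] Suc.prems)
    fix x assume "x \<in> U"
    from d[OF this] have "(f has_derivative frechet_derivative f (at x)) (at x)"
      "(g has_derivative frechet_derivative g (at x)) (at x)"
      by (simp_all add: frechet_derivative_works)
    from dird_eq[OF has_derivative_add[OF this]]
    show "dird v f x + dird v g x = dird v (\<lambda>x. f x + g x) x" by (simp add: dird_def)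
  qed
  then show ?case using assms d by (intro Ck_on_SucI differentiable_add)
qed

lemma Ck_on_mult:
  assumes "open U"
  shows "Ck_on k U f \<Longrightarrow> Ck_on k U g \<Longrightarrow> Ck_on k U (\<lambda>x. f x * g x)"
proof (induction k arbitrary: f g)
  case 0
  then show ?case by (auto intro: continuous_intros)
next
  case (Suc k)
  have d: "f differentiable at x" "g differentiable at x" if "x \<in> U" for x
    using Suc(2,3) that assms(1) Ck_on_Suc_differentiable by blast+
  have fg: "Ck_on k U f" "Ck_on k U g" using Suc assms Ck_on_SucD by blast+
  have "Ck_on k U (dird v (\<lambda>x. f x * g x))" for v
  proof (rule Ck_on_cong[OF assms])
    show "Ck_on k U (\<lambda>x. f x * dird v g x + dird v f x * g x)"
      by (intro Ck_on_add Suc.IH fg assms Ck_on_Suc_dird[OF assms] Suc.prems)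
    fix x assume "x \<in> U"
    from d[OF this] have "(f has_derivative frechet_derivative f (at x)) (at x)"
      "(g has_derivative frechet_derivative g (at x)) (at x)"
      by (simp_all add: frechet_derivative_works)
    from dird_eq[OF has_derivative_mult[OF this]]
    show "f x * dird v g x + dird v f x * g x = dird v (\<lambda>x. f x * g x) x" by (simp add: dird_def)
  qed
  then show ?case using assms d by (intro Ck_on_SucI differentiable_mult)
qed

lemma Ck_on_sum:
  assumes "open U" "\<And>i. i \<in> I \<Longrightarrow> Ck_on k U (f i)"
  shows "Ck_on k U (\<lambda>x. \<Sum>i\<in>I. f i x)"
  using assms(2) by (induction I rule: infinite_finite_induct) (simp_all add: Ck_on_const Ck_on_add assms(1))

lemma dird_inner: "dird v (\<lambda>x. x \<bullet> b) x = v \<bullet> b"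
  by (rule dird_eq) (auto intro!: derivative_eq_intros)

lemma Ck_on_inner: "open U \<Longrightarrow> Ck_on k U (\<lambda>x. x \<bullet> b)"
proof (cases k)
  case (Suc k')
  assume "open U"
  moreover have "dird v (\<lambda>x. x \<bullet> b) = (\<lambda>_. v \<bullet> b)" for v by (rule ext) (rule dird_inner)
  moreover have "(\<lambda>x. x \<bullet> b) differentiable at x" for x
    using has_derivative_inner_left[OF has_derivative_ident] by (rule differentiableI)
  ultimately show ?thesis unfolding Suc by (intro Ck_on_SucI) (simp_all add: Ck_on_const)
qed (auto intro: continuous_intros)

text \<open>\<open>Ck_on\<close> speaks of real functions, so smoothness of g is expressed by its
  coordinates. By the chain rule a derivative of the composite is a sum of products of functions of
  one order less.\<close>

lemma Ck_on_compose:
  fixes g :: "'a::euclidean_space \<Rightarrow> 'b::euclidean_space"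
  assumes U: "open U" and W: "open W" and gW: "g ` W \<subseteq> U"
  shows "Ck_on k U f \<Longrightarrow> (\<And>b. b \<in> Basis \<Longrightarrow> Ck_on k W (\<lambda>x. g x \<bullet> b)) \<Longrightarrow> Ck_on k W (\<lambda>x. f (g x))"
proof (induction k arbitrary: f)
  case 0
  have "continuous_on W g" using 0(2) continuous_on_componentwise[of W g] by simp
  then show ?case using 0(1) gW by (auto intro: continuous_on_compose2)
next
  case (Suc k)
  have df: "f differentiable at y" if "y \<in> U" for y
    using Ck_on_Suc_differentiable[OF U Suc.prems(1) that] .
  have dgb: "(\<lambda>x. g x \<bullet> b) differentiable at x" if "x \<in> W" "b \<in> Basis" for x b
    using Ck_on_Suc_differentiable[OF W Suc.prems(2)[OF that(2)] that(1)] .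
  have dg: "g differentiable at x" if "x \<in> W" for x
    using dgb[OF that] differentiable_componentwise_within[of g x UNIV] by simp
  have gk: "Ck_on k W (\<lambda>x. g x \<bullet> b)" if "b \<in> Basis" for b using Suc.prems(2)[OF that] W Ck_on_SucD by blast
  have comp: "((\<lambda>x. f (g x)) has_derivative (\<lambda>v. frechet_derivative f (at (g x)) (frechet_derivative g (at x) v))) (at x)"
    if "x \<in> W" for x
    using diff_chain_at[of g "frechet_derivative g (at x)" x f "frechet_derivative f (at (g x))"]
      dg[OF that] df[of "g x"] gW that
    by (auto simp: frechet_derivative_works o_def)
  have "Ck_on k W (dird v (\<lambda>x. f (g x)))" for v
  proof (rule Ck_on_cong[OF W])
    show "Ck_on k W (\<lambda>x. \<Sum>b\<in>Basis. dird v (\<lambda>x. g x \<bullet> b) x * dird b f (g x))"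
    proof (rule Ck_on_sum[OF W], rule Ck_on_mult[OF W])
      fix b :: 'b assume b: "b \<in> Basis"
      show "Ck_on k W (dird v (\<lambda>x. g x \<bullet> b))" by (rule Ck_on_Suc_dird[OF W Suc.prems(2)[OF b]])
      show "Ck_on k W (\<lambda>x. dird b f (g x))"
        by (rule Suc.IH[OF Ck_on_Suc_dird[OF U Suc.prems(1)] gk])
    qed
    fix x assume x: "x \<in> W"
    let ?g' = "frechet_derivative g (at x) v"
    have gb: "dird v (\<lambda>x. g x \<bullet> b) x = ?g' \<bullet> b" for b
      using dg[OF x] by (intro dird_eq has_derivative_inner_left) (simp add: frechet_derivative_works)
    have "dird v (\<lambda>x. f (g x)) x = dird ?g' f (g x)"
      using dird_eq[OF comp[OF x]] by (simp add: dird_def)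
    also have "\<dots> = dird (\<Sum>b\<in>Basis. (?g' \<bullet> b) *\<^sub>R b) f (g x)" by (simp add: euclidean_representation)
    also have "\<dots> = (\<Sum>b\<in>Basis. (?g' \<bullet> b) * dird b f (g x))"
      using df[of "g x"] gW x by (intro dird_sum) auto
    finally show "(\<Sum>b\<in>Basis. dird v (\<lambda>x. g x \<bullet> b) x * dird b f (g x)) = dird v (\<lambda>x. f (g x)) x"
      by (simp add: gb)
  qed
  then show ?case using comp W by (intro Ck_on_SucI) (auto simp: differentiable_def)
qed

lemma dird_line:
  assumes "f differentiable at (p + s *\<^sub>R v)"
  shows "((\<lambda>s. f (p + s *\<^sub>R v)) has_real_derivative dird v f (p + s *\<^sub>R v)) (at s)"
proof -
  have "((\<lambda>s. p + s *\<^sub>R v) has_derivative (\<lambda>h. h *\<^sub>R v)) (at s)"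
    by (auto intro!: derivative_eq_intros)
  from diff_chain_at[OF this] assms
  have "((\<lambda>s. f (p + s *\<^sub>R v)) has_derivative (\<lambda>h. frechet_derivative f (at (p + s *\<^sub>R v)) (h *\<^sub>R v))) (at s)"
    by (auto simp: frechet_derivative_works o_def)
  moreover have "frechet_derivative f (at (p + s *\<^sub>R v)) (h *\<^sub>R v) = dird v f (p + s *\<^sub>R v) * h" for h
    using linear_frechet_derivative[OF assms] by (simp add: dird_def linear_scale)
  ultimately show ?thesis by (simp add: has_field_derivative_def)
qed

lemma second_difference_mean_value:
  fixes f :: "'a::euclidean_space \<Rightarrow> real"
  assumes U: "open U" and C: "Ck_on 2 U f" and h: "h > 0"
    and sub: "\<And>s t. 0 \<le> s \<Longrightarrow> s \<le> h \<Longrightarrow> 0 \<le> t \<Longrightarrow> t \<le> h \<Longrightarrow> x + s *\<^sub>R v + t *\<^sub>R w \<in> U"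
  obtains s t where "0 \<le> s" "s \<le> h" "0 \<le> t" "t \<le> h"
    "f (x + h *\<^sub>R v + h *\<^sub>R w) - f (x + h *\<^sub>R v) - f (x + h *\<^sub>R w) + f x
      = h * h * dird w (dird v f) (x + s *\<^sub>R v + t *\<^sub>R w)"
proof -
  have C': "Ck_on (Suc (Suc 0)) U f" using C by (simp add: numeral_2_eq_2)
  have d1: "f differentiable at y" if "y \<in> U" for y
    using Ck_on_Suc_differentiable[OF U C' that] .
  have d2: "dird v f differentiable at y" if "y \<in> U" for y
    using Ck_on_Suc_differentiable[OF U Ck_on_Suc_dird[OF U C'] that] .
  let ?\<phi> = "\<lambda>s. f ((x + h *\<^sub>R w) + s *\<^sub>R v) - f (x + s *\<^sub>R v)"
  have "(?\<phi> has_real_derivative dird v f ((x + h *\<^sub>R w) + s *\<^sub>R v) - dird v f (x + s *\<^sub>R v)) (at s)"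
    if "0 \<le> s" "s \<le> h" for s
    using sub[of s h] sub[of s 0] that h
    by (intro DERIV_diff dird_line d1) (simp_all add: algebra_simps)
  from MVT2[OF h this] obtain s where s: "0 < s" "s < h"
    "?\<phi> h - ?\<phi> 0 = (h - 0) * (dird v f ((x + h *\<^sub>R w) + s *\<^sub>R v) - dird v f (x + s *\<^sub>R v))" by blast
  have "((\<lambda>t. dird v f ((x + s *\<^sub>R v) + t *\<^sub>R w)) has_real_derivative dird w (dird v f) ((x + s *\<^sub>R v) + t *\<^sub>R w)) (at t)"
    if "0 \<le> t" "t \<le> h" for t
    using sub[of s t] that s by (intro dird_line d2) simp
  from MVT2[OF h this] obtain t where t: "0 < t" "t < h"
    "dird v f ((x + s *\<^sub>R v) + h *\<^sub>R w) - dird v f ((x + s *\<^sub>R v) + 0 *\<^sub>R w)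
       = (h - 0) * dird w (dird v f) ((x + s *\<^sub>R v) + t *\<^sub>R w)" by blast
  show ?thesis
    using that[of s t] s t by (simp add: algebra_simps)
qed

text \<open>The mixed second difference is symmetric in v and w. Divided by h^2 it is a value of
  either mixed derivative at some point of the parallelogram, and both derivatives are continuous at
  x.\<close>

lemma dird_commute:
  fixes f :: "'a::euclidean_space \<Rightarrow> real"
  assumes U: "open U" and C: "Ck_on 2 U f" and x: "x \<in> U"
  shows "dird w (dird v f) x = dird v (dird w f) x"
proof -
  have C': "Ck_on (Suc (Suc 0)) U f" using C by (simp add: numeral_2_eq_2)
  have cont: "continuous (at x) (dird a (dird b f))" for a b
    using Ck_on_Suc_dird[OF U Ck_on_Suc_dird[OF U C']] U x by (simp add: continuous_on_eq_continuous_at)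
  have "dist (dird w (dird v f) x) (dird v (dird w f) x) < e" if e: "e > 0" for e
  proof -
    have ev: "\<forall>\<^sub>F y in nhds x. dist (dird a (dird b f) y) (dird a (dird b f) x) < e / 2" for a b
      using cont[of a b] e unfolding continuous_at tendsto_at_iff_tendsto_nhds
      by (intro tendstoD) auto
    have "\<forall>\<^sub>F y in nhds x. y \<in> U \<and> dist (dird w (dird v f) y) (dird w (dird v f) x) < e / 2 \<and>
        dist (dird v (dird w f) y) (dird v (dird w f) x) < e / 2"
      using U x by (intro eventually_conj ev) (simp add: eventually_nhds_in_open)
    then obtain r where r: "r > 0" "\<And>y. dist y x < r \<Longrightarrow> y \<in> U \<and> dist (dird w (dird v f) y) (dird w (dird v f) x) < e / 2 \<and>
        dist (dird v (dird w f) y) (dird v (dird w f) x) < e / 2"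
      unfolding eventually_nhds_metric by blast
    \<comment> \<open>The 1 keeps X positive when v = w = 0; with h = r / (2 X) the parallelogram
      stays within r / 2 of x.\<close>
    define X where "X = norm v + norm w + 1"
    have X: "X > 0" unfolding X_def by (intro add_nonneg_pos) auto
    define h where "h = r / (2 * X)"
    have h: "h > 0" unfolding h_def using r(1) X by simp
    have near: "dist (x + s *\<^sub>R v + t *\<^sub>R w) x < r" if "0 \<le> s" "s \<le> h" "0 \<le> t" "t \<le> h" for s t
    proof -
      have "dist (x + s *\<^sub>R v + t *\<^sub>R w) x = norm (s *\<^sub>R v + t *\<^sub>R w)" by (simp add: dist_norm)
      also have "\<dots> \<le> s * norm v + t * norm w" using that norm_triangle_ineq[of "s *\<^sub>R v" "t *\<^sub>R w"] by simp
      also have "\<dots> \<le> h * norm v + h * norm w" using that by (intro add_mono mult_right_mono) auto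
      also have "\<dots> \<le> h * X" using h by (simp add: X_def algebra_simps)
      also have "\<dots> = r / 2" using X by (simp add: h_def)
      finally show ?thesis using r(1) by simp
    qed
    let ?D = "f (x + h *\<^sub>R v + h *\<^sub>R w) - f (x + h *\<^sub>R v) - f (x + h *\<^sub>R w) + f x"
    obtain s t where st: "0 \<le> s" "s \<le> h" "0 \<le> t" "t \<le> h" "?D = h * h * dird w (dird v f) (x + s *\<^sub>R v + t *\<^sub>R w)"
      using second_difference_mean_value[OF U C h, of x v w] near r(2) by blast
    have near': "dist (x + t *\<^sub>R w + s *\<^sub>R v) x < r" if "0 \<le> s" "s \<le> h" "0 \<le> t" "t \<le> h" for s t
      using near[OF that] by (simp add: add_ac)
    have "f (x + h *\<^sub>R w + h *\<^sub>R v) - f (x + h *\<^sub>R w) - f (x + h *\<^sub>R v) + f x = ?D" by (simp add: add_ac)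
    then obtain s' t' where st': "0 \<le> s'" "s' \<le> h" "0 \<le> t'" "t' \<le> h" "?D = h * h * dird v (dird w f) (x + s' *\<^sub>R w + t' *\<^sub>R v)"
      using second_difference_mean_value[OF U C h, of x w v] near' r(2) by metis
    have eq: "dird w (dird v f) (x + s *\<^sub>R v + t *\<^sub>R w) = dird v (dird w f) (x + s' *\<^sub>R w + t' *\<^sub>R v)"
      using st(5) st'(5) h by simp
    have "dist (dird w (dird v f) (x + s *\<^sub>R v + t *\<^sub>R w)) (dird w (dird v f) x) < e / 2"
      "dist (dird v (dird w f) (x + s' *\<^sub>R w + t' *\<^sub>R v)) (dird v (dird w f) x) < e / 2"
      using r(2) near[OF st(1-4)] near'[OF st'(3,4,1,2)] by auto
    then show ?thesis unfolding eq dist_real_def by linarith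
  qed
  then show ?thesis by (metis dist_eq_0_iff dist_pos_lt less_irrefl)
qed

section \<open>The one-homogeneous extension\<close>

lemma has_derivative_dird:
  "f differentiable at x \<Longrightarrow> (f has_derivative (\<lambda>v. dird v f x)) (at x)"
  unfolding dird_def frechet_derivative_works .

lemma dird_mult:
  assumes "f differentiable at x" "g differentiable at x"
  shows "dird v (\<lambda>x. f x * g x) x = f x * dird v g x + dird v f x * g x"
  by (rule dird_eq[OF has_derivative_mult[OF assms[THEN has_derivative_dird]]])

lemma dird_add:
  assumes "f differentiable at x" "g differentiable at x"
  shows "dird v (\<lambda>x. f x + g x) x = dird v f x + dird v g x"
  by (rule dird_eq[OF has_derivative_add[OF assms[THEN has_derivative_dird]]])

lemma has_derivative_norm_sgn: "x \<noteq> 0 \<Longrightarrow> (norm has_derivative (\<lambda>h. sgn x \<bullet> h)) (at (x::'a::euclidean_space))"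
  using has_derivative_norm[of x] by (simp add: inner_commute)

text \<open>The derivative in direction v is - (x . v) / |x|^3, again a product of powers of 1/|x|
  and a linear function, so the induction closes. For the norm itself it would not.\<close>

lemma Ck_on_inverse_norm: "Ck_on k (- {0::'a::euclidean_space}) (\<lambda>x. inverse (norm x))"
proof (induction k)
  case 0
  then show ?case by (auto intro!: continuous_intros)
next
  case (Suc k)
  have d: "((\<lambda>x::'a. inverse (norm x)) has_derivative (\<lambda>h. - (inverse (norm x) * (sgn x \<bullet> h) * inverse (norm x)))) (at x)"
    if "x \<noteq> 0" for x
    using that by (intro Deriv.has_derivative_inverse has_derivative_norm_sgn) auto
  have o: "open (- {0::'a})" by auto
  show ?case
  proof (rule Ck_on_SucI[OF o])
    show "(\<lambda>x. inverse (norm x)) differentiable at x" if "x \<in> - {0::'a}" for x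
      using d[of x] that by (auto intro: differentiableI)
    fix v :: 'a
    show "Ck_on k (- {0}) (dird v (\<lambda>x. inverse (norm x)))"
    proof (rule Ck_on_cong[OF o])
      show "Ck_on k (- {0}) (\<lambda>x. (-1) * (inverse (norm x) * (inverse (norm x) * (inverse (norm x) * (x \<bullet> v)))))"
        by (intro Ck_on_mult Ck_on_const Ck_on_inner o Suc)
      fix x assume "x \<in> - {0::'a}"
      then have "dird v (\<lambda>x. inverse (norm x)) x = - (inverse (norm x) * (sgn x \<bullet> v) * inverse (norm x))"
        by (intro dird_eq d) auto
      then show "(-1) * (inverse (norm x) * (inverse (norm x) * (inverse (norm x) * (x \<bullet> v)))) = dird v (\<lambda>x. inverse (norm x)) x"
        by (simp add: sgn_div_norm)
    qed
  qed
qed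

definition hext :: "('a::euclidean_space \<Rightarrow> real) \<Rightarrow> 'a \<Rightarrow> real" where
  "hext u x = norm x * u (sgn x)"

lemma sgn_in_sphere: "x \<noteq> 0 \<Longrightarrow> sgn x \<in> sphere (0::'a::euclidean_space) 1"
  by (simp add: norm_sgn)

lemma Ck_on_compose_sgn:
  assumes "open U" "sphere 0 1 \<subseteq> U" "Ck_on k U f"
  shows "Ck_on k (- {0}) (\<lambda>x. f (sgn x))"
proof (rule Ck_on_compose[OF assms(1) _ _ assms(3)])
  show "sgn ` (- {0}) \<subseteq> U" using sgn_in_sphere assms(2) by blast
  have o: "open (- {0::'a})" by auto
  show "Ck_on k (- {0}) (\<lambda>x. sgn x \<bullet> b)" for b :: 'a
    using Ck_on_mult[OF o Ck_on_inverse_norm Ck_on_inner[OF o], of k b] by (simp add: sgn_div_norm)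
qed auto

lemma Ck_on_hext:
  assumes "open U" "sphere 0 1 \<subseteq> U" "Ck_on k U u"
  shows "Ck_on k (- {0}) (hext u)"
proof -
  have o: "open (- {0::'a})" by auto
  \<comment> \<open>The norm is obtained as |x|^2 times 1/|x|.\<close>
  have "Ck_on k (- {0}) (\<lambda>x::'a. (\<Sum>b\<in>Basis. (x \<bullet> b) * (x \<bullet> b)) * inverse (norm x))"
    by (intro Ck_on_mult Ck_on_sum Ck_on_inner Ck_on_inverse_norm o)
  then have "Ck_on k (- {0}) (norm :: 'a \<Rightarrow> real)"
  proof (rule Ck_on_cong[OF o, rotated])
    fix x assume "x \<in> - {0::'a}"
    then show "(\<Sum>b\<in>Basis. (x \<bullet> b) * (x \<bullet> b)) * inverse (norm x) = norm x"
      by (simp add: euclidean_inner[symmetric] dot_square_norm power2_eq_square)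
  qed
  then have "Ck_on k (- {0}) (\<lambda>x. norm x * u (sgn x))"
    by (intro Ck_on_mult o Ck_on_compose_sgn[OF assms])
  then show ?thesis by (simp add: hext_def[abs_def])
qed

lemma has_derivative_sgn:
  fixes x :: "'a::euclidean_space"
  assumes "x \<noteq> 0"
  shows "(sgn has_derivative (\<lambda>h. inverse (norm x) *\<^sub>R (h - (sgn x \<bullet> h) *\<^sub>R sgn x))) (at x)"
proof -
  have "((\<lambda>x::'a. inverse (norm x)) has_derivative (\<lambda>h. - (inverse (norm x) * (sgn x \<bullet> h) * inverse (norm x)))) (at x)"
    using assms by (intro Deriv.has_derivative_inverse has_derivative_norm_sgn) auto
  from has_derivative_scaleR[OF this has_derivative_ident]
  have "((\<lambda>x. inverse (norm x) *\<^sub>R x) has_derivative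
     (\<lambda>h. inverse (norm x) *\<^sub>R h + (- (inverse (norm x) * (sgn x \<bullet> h) * inverse (norm x))) *\<^sub>R x)) (at x)" .
  moreover have "(\<lambda>x::'a. inverse (norm x) *\<^sub>R x) = sgn" by (rule ext) (simp add: sgn_div_norm)
  ultimately show ?thesis by (simp add: algebra_simps sgn_div_norm)
qed

lemma dird_compose_sgn:
  assumes "x \<noteq> 0" "f differentiable at (sgn x)"
  shows "(\<lambda>x. f (sgn x)) differentiable at x"
    "dird v (\<lambda>x. f (sgn x)) x = inverse (norm x) * (dird v f (sgn x) - (sgn x \<bullet> v) * dird (sgn x) f (sgn x))"
proof -
  have D: "((\<lambda>x. f (sgn x)) has_derivative (\<lambda>h. dird (inverse (norm x) *\<^sub>R (h - (sgn x \<bullet> h) *\<^sub>R sgn x)) f (sgn x))) (at x)"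
    using diff_chain_at[OF has_derivative_sgn[OF assms(1)] has_derivative_dird[OF assms(2)]] by (simp add: o_def)
  then show "(\<lambda>x. f (sgn x)) differentiable at x" by (rule differentiableI)
  show "dird v (\<lambda>x. f (sgn x)) x = inverse (norm x) * (dird v f (sgn x) - (sgn x \<bullet> v) * dird (sgn x) f (sgn x))"
    unfolding dird_eq[OF D]
    using dird_lincomb[OF assms(2), of "inverse (norm x)" v "- inverse (norm x) * (sgn x \<bullet> v)" "sgn x"]
    by (simp add: algebra_simps)
qed

lemma dird_hext:
  assumes "x \<noteq> 0" "u differentiable at (sgn x)"
  shows "dird v (hext u) x = dird v u (sgn x) + (sgn x \<bullet> v) * (u (sgn x) - dird (sgn x) u (sgn x))"
proof -
  have n: "norm differentiable at x" "dird v norm x = sgn x \<bullet> v"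
    using has_derivative_norm_sgn[OF assms(1)] by (auto intro: differentiableI dird_eq)
  show ?thesis
    unfolding hext_def[abs_def] dird_mult[OF n(1) dird_compose_sgn(1)[OF assms]] n dird_compose_sgn(2)[OF assms]
    using assms(1) by (simp add: field_simps)
qed

lemma egrad_inner:
  assumes "f differentiable at x"
  shows "egrad f x \<bullet> v = dird v f x"
proof -
  have "dird v f x = dird (\<Sum>b\<in>Basis. (v \<bullet> b) *\<^sub>R b) f x" by (simp add: euclidean_representation)
  also have "\<dots> = (\<Sum>b\<in>Basis. (v \<bullet> b) * dird b f x)" by (rule dird_sum[OF assms])
  finally show ?thesis
    by (simp add: egrad_def inner_sum_right dird_def inner_commute[of _ v] mult.commute)
qed

lemma dird_hext_sphere:
  assumes "norm x = 1" "u differentiable at x"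
  shows "dird v (hext u) x = (sgrad u x + u x *\<^sub>R x) \<bullet> v"
proof -
  have "sgn x = x" "x \<noteq> 0" using assms by (auto simp: sgn_div_norm)
  then show ?thesis using dird_hext[of x u v] assms egrad_inner[OF assms(2)]
    by (simp add: sgrad_def algebra_simps inner_add_left inner_diff_left)
qed

lemma norm_hext_gradient:
  assumes "norm x = 1" "u differentiable at x"
  shows "(\<Sum>b\<in>Basis. (dird b (hext u) x)\<^sup>2) = (u x)\<^sup>2 + (norm (sgrad u x))\<^sup>2"
proof -
  have xx: "x \<bullet> x = 1" using assms(1) by (simp add: dot_square_norm)
  let ?g = "sgrad u x + u x *\<^sub>R x"
  have "sgrad u x \<bullet> x = 0" using xx by (simp add: sgrad_def inner_diff_left)
  then have "?g \<bullet> ?g = (u x)\<^sup>2 + sgrad u x \<bullet> sgrad u x"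
    using xx by (simp add: inner_add_left inner_add_right inner_commute power2_eq_square)
  moreover have "sgrad u x \<bullet> sgrad u x = (norm (sgrad u x))\<^sup>2" by (simp add: dot_square_norm)
  moreover have "?g \<bullet> ?g = (\<Sum>b\<in>Basis. (?g \<bullet> b)\<^sup>2)"
    by (subst euclidean_inner) (simp add: power2_eq_square)
  ultimately show ?thesis using dird_hext_sphere[OF assms] by simp
qed

text \<open>In the formula for Dh the factor sgn y . v vanishes at x, so only its derivative v . w
  survives, multiplied by u minus the radial derivative of u. That radial derivative is exactly the
  correction in \<open>shess\<close>.\<close>

lemma ehess_hext:
  assumes U: "open U" "sphere 0 1 \<subseteq> U" "Ck_on 2 U u" and x: "norm x = 1" "v \<bullet> x = 0" "w \<bullet> x = 0"
  shows "dird w (dird v (hext u)) x = shess u x v w + u x * (v \<bullet> w)"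
proof -
  have C': "Ck_on (Suc (Suc 0)) U u" using U by (simp add: numeral_2_eq_2)
  have du: "u differentiable at y" if "y \<in> U" for y using Ck_on_Suc_differentiable[OF U(1) C' that] .
  have ddu: "dird b u differentiable at y" if "y \<in> U" for y b
    using Ck_on_Suc_differentiable[OF U(1) Ck_on_Suc_dird[OF U(1) C'] that] .
  have s: "sgn x = x" and x0: "x \<noteq> 0" and xU: "x \<in> U" using x U by (auto simp: sgn_div_norm)
  have sU: "sgn y \<in> U" if "y \<noteq> 0" for y using sgn_in_sphere[OF that] U(2) by blast
  \<comment> \<open>The radial derivative is expanded in coordinates because its direction sgn y
    varies with y.\<close>
  let ?F = "\<lambda>y. dird v u (sgn y) + (sgn y \<bullet> v) * (u (sgn y) + (-1) * (\<Sum>b\<in>Basis. (sgn y \<bullet> b) * dird b u (sgn y)))"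
  have F: "dird v (hext u) y = ?F y" if "y \<noteq> 0" for y
  proof -
    have "dird (sgn y) u (sgn y) = dird (\<Sum>b\<in>Basis. (sgn y \<bullet> b) *\<^sub>R b) u (sgn y)" by (simp add: euclidean_representation)
    also have "\<dots> = (\<Sum>b\<in>Basis. (sgn y \<bullet> b) * dird b u (sgn y))" by (rule dird_sum[OF du[OF sU[OF that]]])
    finally show ?thesis using dird_hext[OF that du[OF sU[OF that]]] by simp
  qed
  have i: "(\<lambda>y. y \<bullet> b) differentiable at y" for b y :: 'a
    using has_derivative_inner_left[OF has_derivative_ident] by (rule differentiableI)
  have d1: "(\<lambda>y. dird b u (sgn y)) differentiable at x" for b
    using dird_compose_sgn(1)[OF x0] ddu xU s by simp
  have d2: "(\<lambda>y. sgn y \<bullet> b) differentiable at x" for b using dird_compose_sgn(1)[OF x0 i] by simp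
  have d3: "(\<lambda>y. u (sgn y)) differentiable at x" using dird_compose_sgn(1)[OF x0] du xU s by simp
  have d4: "(\<lambda>y. u (sgn y) + (-1) * (\<Sum>b\<in>Basis. (sgn y \<bullet> b) * dird b u (sgn y))) differentiable at x"
    by (auto intro!: differentiable_diff differentiable_mult d3 differentiable_sum d2 d1)
  have FD: "?F differentiable at x" by (intro differentiable_add differentiable_mult d4 d1 d2)
  have "dird w (dird v (hext u)) x = dird w ?F x"
    by (rule dird_cong[symmetric, of "- {0}"]) (use x0 F FD in auto)
  also have "\<dots> = dird w (\<lambda>y. dird v u (sgn y)) x + (dird w (\<lambda>y. sgn y \<bullet> v) x) * (u x + (-1) * (\<Sum>b\<in>Basis. (x \<bullet> b) * dird b u x))"
    using dird_add[OF d1[of v] differentiable_mult[OF d2[of v] d4], of w] dird_mult[OF d2[of v] d4, of w] x s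
    by (simp add: inner_commute)
  also have "dird w (\<lambda>y. dird v u (sgn y)) x = dird w (dird v u) x"
    using dird_compose_sgn(2)[OF x0, of "dird v u" w] ddu xU s x by (simp add: inner_commute)
  also have "dird w (\<lambda>y. sgn y \<bullet> v) x = v \<bullet> w"
    using dird_compose_sgn(2)[OF x0 i, of w v] s x by (simp add: inner_commute dird_inner)
  also have "(\<Sum>b\<in>Basis. (x \<bullet> b) * dird b u x) = egrad u x \<bullet> x"
    unfolding egrad_inner[OF du[OF xU]] dird_sum[OF du[OF xU], symmetric] by (simp add: euclidean_representation)
  finally show ?thesis by (simp add: shess_def ehess_eq_dird algebra_simps)
qed

section \<open>Homogeneous functions and Euler's relation\<close>

definition homogeneous :: "real \<Rightarrow> ('a::euclidean_space \<Rightarrow> real) \<Rightarrow> bool" where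
  "homogeneous r f \<longleftrightarrow> (\<forall>s>0. \<forall>x. x \<noteq> 0 \<longrightarrow> f (s *\<^sub>R x) = s powr r * f x)"

lemma homogeneous_hext: "homogeneous 1 (hext u)"
  by (auto simp: homogeneous_def hext_def sgn_scaleR)

lemma homogeneous_dird:
  assumes "homogeneous r f" "\<And>x. x \<noteq> 0 \<Longrightarrow> f differentiable at x"
  shows "homogeneous (r - 1) (dird v f)"
  unfolding homogeneous_def
proof (intro allI impI)
  fix s :: real and x :: 'a assume s: "s > 0" and x: "x \<noteq> 0"
  have "((\<lambda>x. s *\<^sub>R x) has_derivative (\<lambda>h. s *\<^sub>R h)) (at x)" by (auto intro!: derivative_eq_intros)
  from diff_chain_at[OF this has_derivative_dird[OF assms(2)[of "s *\<^sub>R x"]]] s x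
  have D: "((\<lambda>x. f (s *\<^sub>R x)) has_derivative (\<lambda>h. dird (s *\<^sub>R h) f (s *\<^sub>R x))) (at x)" by (simp add: o_def)
  have "dird v (\<lambda>x. f (s *\<^sub>R x)) x = dird v (\<lambda>x. s powr r * f x) x"
    by (rule dird_cong[of "- {0}"]) (use assms(1) s x D in \<open>auto simp: homogeneous_def intro: differentiableI\<close>)
  also have "\<dots> = s powr r * dird v f x"
    by (rule dird_eq) (intro has_derivative_mult_right has_derivative_dird assms x)
  also have "dird v (\<lambda>x. f (s *\<^sub>R x)) x = s * dird v f (s *\<^sub>R x)"
    unfolding dird_eq[OF D] using dird_lincomb[OF assms(2), of "s *\<^sub>R x" s v 0 0] s x by simp
  finally show "dird v f (s *\<^sub>R x) = s powr (r - 1) * dird v f x"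
    using s by (simp add: powr_diff field_simps)
qed

lemma homogeneous_euler:
  assumes "homogeneous r f" "f differentiable at x" "x \<noteq> 0"
  shows "dird x f x = r * f x"
proof -
  have 1: "((\<lambda>s. f (x + s *\<^sub>R x)) has_real_derivative dird x f x) (at 0)"
    using dird_line[of f x 0 x] assms(2) by simp
  have "((\<lambda>s. (1 + s) powr r * f x) has_real_derivative r * f x) (at 0)"
    by (auto intro!: derivative_eq_intros)
  then have 2: "((\<lambda>s. f (x + s *\<^sub>R x)) has_real_derivative r * f x) (at 0)"
  proof (rule has_field_derivative_transform_within_open[of _ _ _ "{-1<..}"])
    fix s :: real assume "s \<in> {-1<..}"
    moreover have "x + s *\<^sub>R x = (1 + s) *\<^sub>R x" by (simp add: scaleR_add_left)
    ultimately show "(1 + s) powr r * f x = f (x + s *\<^sub>R x)"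
      using assms(1,3) by (simp add: homogeneous_def)
  qed auto
  show ?thesis using DERIV_unique[OF 1 2] .
qed

section \<open>Second-order jets along great circles\<close>

text \<open>The entries are value, first and second derivative at 0. As a relation it allows jets to
  be computed by rules without naming derivative functions; f' exists everywhere but is
  differentiated only at 0.\<close>

definition jet2 :: "(real \<Rightarrow> real) \<Rightarrow> real \<Rightarrow> real \<Rightarrow> real \<Rightarrow> bool" where
  "jet2 f a b c \<longleftrightarrow> f 0 = a \<and> (\<exists>f'. (\<forall>t. (f has_real_derivative f' t) (at t)) \<and> f' 0 = b \<and>
     (f' has_real_derivative c) (at 0))"

lemma jet2I:
  assumes "f 0 = a" "\<And>t. (f has_real_derivative f' t) (at t)" "f' 0 = b" "(f' has_real_derivative c) (at 0)"
  shows "jet2 f a b c"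
  using assms unfolding jet2_def by blast

lemma jet2E:
  assumes "jet2 f a b c"
  obtains f' where "f 0 = a" "\<And>t. (f has_real_derivative f' t) (at t)" "f' 0 = b" "(f' has_real_derivative c) (at 0)"
  using assms unfolding jet2_def by blast

lemma jet2_const: "jet2 (\<lambda>_. a) a 0 0"
  by (rule jet2I[of _ _ "\<lambda>_. 0"]) auto

lemma jet2_cos: "jet2 cos 1 0 (-1)"
  by (rule jet2I[of _ _ "\<lambda>t. - sin t"]) (auto intro!: derivative_eq_intros)

lemma jet2_sin: "jet2 sin 0 1 0"
  by (rule jet2I[of _ _ cos]) (auto intro!: derivative_eq_intros)

lemma jet2_add:
  assumes "jet2 f a b c" "jet2 g a' b' c'"
  shows "jet2 (\<lambda>t. f t + g t) (a + a') (b + b') (c + c')"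
proof -
  obtain f' where f: "f 0 = a" "\<And>t. (f has_real_derivative f' t) (at t)" "f' 0 = b" "(f' has_real_derivative c) (at 0)"
    using assms(1) by (rule jet2E) blast
  obtain g' where g: "g 0 = a'" "\<And>t. (g has_real_derivative g' t) (at t)" "g' 0 = b'" "(g' has_real_derivative c') (at 0)"
    using assms(2) by (rule jet2E) blast
  show ?thesis
    by (rule jet2I[of _ _ "\<lambda>t. f' t + g' t"]) (auto simp: f(1,3) g(1,3) intro: DERIV_add f g)
qed

lemma jet2_mult:
  assumes "jet2 f a b c" "jet2 g a' b' c'"
  shows "jet2 (\<lambda>t. f t * g t) (a * a') (a * b' + b * a') (a * c' + 2 * b * b' + c * a')"
proof -
  obtain f' where f: "f 0 = a" "\<And>t. (f has_real_derivative f' t) (at t)" "f' 0 = b" "(f' has_real_derivative c) (at 0)"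
    using assms(1) by (rule jet2E) blast
  obtain g' where g: "g 0 = a'" "\<And>t. (g has_real_derivative g' t) (at t)" "g' 0 = b'" "(g' has_real_derivative c') (at 0)"
    using assms(2) by (rule jet2E) blast
  show ?thesis
  proof (rule jet2I[of _ _ "\<lambda>t. f' t * g t + g' t * f t"])
    show "((\<lambda>t. f t * g t) has_real_derivative f' t * g t + g' t * f t) (at t)" for t
      by (rule DERIV_mult[OF f(2) g(2)])
    have "((\<lambda>t. f' t * g t + g' t * f t) has_real_derivative (c * g 0 + g' 0 * f' 0) + (c' * f 0 + f' 0 * g' 0)) (at 0)"
      by (intro DERIV_add DERIV_mult f g)
    then show "((\<lambda>t. f' t * g t + g' t * f t) has_real_derivative a * c' + 2 * b * b' + c * a') (at 0)"
      by (simp add: f(1,3) g(1,3) algebra_simps)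
  qed (simp_all add: f(1,3) g(1,3) algebra_simps)
qed

lemma jet2_cmult: "jet2 f a b c \<Longrightarrow> jet2 (\<lambda>t. r * f t) (r * a) (r * b) (r * c)"
  using jet2_mult[OF jet2_const[of r], of f a b c] by simp

lemma jet2_sum:
  assumes "\<And>i. i \<in> I \<Longrightarrow> jet2 (f i) (a i) (b i) (c i)"
  shows "jet2 (\<lambda>t. \<Sum>i\<in>I. f i t) (\<Sum>i\<in>I. a i) (\<Sum>i\<in>I. b i) (\<Sum>i\<in>I. c i)"
  using assms by (induction I rule: infinite_finite_induct) (simp_all add: jet2_const jet2_add)

lemma jet2_ln:
  assumes "jet2 f a b c" "\<And>t. f t > 0"
  shows "jet2 (\<lambda>t. ln (f t)) (ln a) (b / a) (c / a - (b / a)\<^sup>2)"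
proof -
  obtain f' where f: "f 0 = a" "\<And>t. (f has_real_derivative f' t) (at t)" "f' 0 = b" "(f' has_real_derivative c) (at 0)"
    using assms(1) by (rule jet2E) blast
  have a: "a > 0" using f(1) assms(2)[of 0] by simp
  show ?thesis
  proof (rule jet2I[of _ _ "\<lambda>t. f' t / f t"])
    show "((\<lambda>t. ln (f t)) has_real_derivative f' t / f t) (at t)" for t
      using assms(2)[of t] by (auto intro!: derivative_eq_intros f(2) simp: field_simps)
    have "((\<lambda>t. f' t / f t) has_real_derivative (c * f 0 - f' 0 * f' 0) / (f 0 * f 0)) (at 0)"
      using assms(2)[of 0] by (intro DERIV_divide f) simp
    moreover have "(c * f 0 - f' 0 * f' 0) / (f 0 * f 0) = c / a - (b / a)\<^sup>2"
      using a f by (simp add: field_simps power2_eq_square)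
    ultimately show "((\<lambda>t. f' t / f t) has_real_derivative c / a - (b / a)\<^sup>2) (at 0)" by simp
  qed (simp_all add: f)
qed

text \<open>If c were negative, f' would be negative just to the right of 0, and the mean value
  theorem would give a value below a.\<close>

lemma jet2_min:
  assumes "jet2 f a b c" "\<And>t. f t \<ge> a"
  shows "b = 0" "c \<ge> 0"
proof -
  obtain f' where f: "f 0 = a" "\<And>t. (f has_real_derivative f' t) (at t)" "f' 0 = b" "(f' has_real_derivative c) (at 0)"
    using assms(1) by (rule jet2E) blast
  show b: "b = 0"
    using DERIV_local_min[OF f(2)[of 0], of 1] assms(2) f(1,3) by simp
  show "c \<ge> 0"
  proof (rule ccontr)
    assume "\<not> c \<ge> 0"
    then obtain d where d: "d > 0" "\<And>h. h > 0 \<Longrightarrow> h < d \<Longrightarrow> f' (0 + h) < f' 0"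
      using DERIV_neg_dec_right[OF f(4)] by auto
    obtain z where z: "0 < z" "z < d / 2" "f (d / 2) - f 0 = (d / 2 - 0) * f' z"
      using MVT2[of 0 "d / 2" f f'] d(1) f(2) by auto
    have "f' z < 0" using d(2)[of z] z b f(3) by simp
    then have "(d / 2) * f' z < 0" using d(1) by (intro mult_pos_neg) auto
    then have "f (d / 2) < a" using z(3) f(1) by simp
    then show False using assms(2)[of "d / 2"] by simp
  qed
qed

lemma jet2_max:
  assumes "jet2 f a b c" "\<And>t. f t \<le> a"
  shows "b = 0" "c \<le> 0"
  using jet2_min[OF jet2_cmult[OF assms(1), of "-1"]] assms(2) by auto

definition circ :: "'a::euclidean_space \<Rightarrow> 'a \<Rightarrow> real \<Rightarrow> 'a" where
  "circ x e t = cos t *\<^sub>R x + sin t *\<^sub>R e"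

lemma circ_0 [simp]: "circ x e 0 = x"
  by (simp add: circ_def)

lemma inner_circ:
  "circ x e t \<bullet> circ x e t = (cos t)\<^sup>2 * (x \<bullet> x) + 2 * cos t * sin t * (x \<bullet> e) + (sin t)\<^sup>2 * (e \<bullet> e)"
  by (simp add: circ_def inner_add_left inner_add_right inner_commute power2_eq_square algebra_simps)

lemma norm_circ:
  assumes "norm x = 1" "norm e = 1" "x \<bullet> e = 0"
  shows "norm (circ x e t) = 1"
proof -
  have "circ x e t \<bullet> circ x e t = 1"
    unfolding inner_circ using assms by (simp add: dot_square_norm)
  then show ?thesis by (simp add: norm_eq_sqrt_inner)
qed

text \<open>The circle has velocity e and acceleration - x at 0; the acceleration produces the
  radial derivative, which Euler's relation evaluates later.\<close>

lemma jet2_circ: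
  assumes U: "open U" "\<And>t. circ x e t \<in> U" "Ck_on 2 U f"
  shows "jet2 (\<lambda>t. f (circ x e t)) (f x) (dird e f x) (dird e (dird e f) x - dird x f x)"
proof -
  have C: "Ck_on (Suc (Suc 0)) U f" using U(3) by (simp add: numeral_2_eq_2)
  have d: "g differentiable at (circ x e t)" if "Ck_on (Suc k) U g" for g t k
    using Ck_on_Suc_differentiable[OF U(1) that U(2)] .
  have circ': "(circ x e has_derivative (\<lambda>h. h *\<^sub>R ((- sin t) *\<^sub>R x + cos t *\<^sub>R e))) (at t)" for t
    unfolding circ_def[abs_def]
    by (auto intro!: derivative_eq_intros simp: algebra_simps)
  have D: "((\<lambda>t. g (circ x e t)) has_real_derivative - sin t * dird x g (circ x e t) + cos t * dird e g (circ x e t)) (at t)"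
    if g: "Ck_on (Suc k) U g" for g t k
  proof -
    have "((\<lambda>t. g (circ x e t)) has_derivative (\<lambda>h. dird (h *\<^sub>R ((- sin t) *\<^sub>R x + cos t *\<^sub>R e)) g (circ x e t))) (at t)"
      using diff_chain_at[OF circ' has_derivative_dird[OF d[OF g]]] by (simp add: o_def)
    moreover have "dird (h *\<^sub>R ((- sin t) *\<^sub>R x + cos t *\<^sub>R e)) g (circ x e t)
        = (- sin t * dird x g (circ x e t) + cos t * dird e g (circ x e t)) * h" for h
      using dird_lincomb[OF d[OF g], of "- h * sin t" x "h * cos t" e t] by (simp add: algebra_simps)
    ultimately show ?thesis by (simp add: has_field_derivative_def)
  qed
  let ?f' = "\<lambda>t. - sin t * dird x f (circ x e t) + cos t * dird e f (circ x e t)"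
  have 2: "(?f' has_real_derivative
      (- cos 0 * dird x f (circ x e 0) + (- sin 0 * dird x (dird x f) (circ x e 0) + cos 0 * dird e (dird x f) (circ x e 0)) * - sin 0)
      + (- sin 0 * dird e f (circ x e 0) + (- sin 0 * dird x (dird e f) (circ x e 0) + cos 0 * dird e (dird e f) (circ x e 0)) * cos 0)) (at 0)"
    by (intro DERIV_add DERIV_mult D[OF Ck_on_Suc_dird[OF U(1) C]] DERIV_minus DERIV_sin DERIV_cos)
  show ?thesis
    by (rule jet2I[of _ _ ?f']) (use D[OF C] 2 in \<open>simp_all add: algebra_simps\<close>)
qed

section \<open>Frames and diagonalisation\<close>

text \<open>First variation of the quadratic form at its maximiser v, in the direction w.\<close>

lemma maximal_direction_orthogonal:
  fixes B :: "'a::euclidean_space \<Rightarrow> 'a \<Rightarrow> real"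
  assumes B: "bilinear B" and sym: "\<And>v w. B v w = B w v"
    and max: "\<And>z. z \<in> S \<Longrightarrow> B z z \<le> B v v * (z \<bullet> z)" and S: "subspace S" "v \<in> S" "w \<in> S"
    and v: "v \<bullet> v = 1" "v \<bullet> w = 0"
  shows "B v w = 0"
proof -
  define c where "c = B v v * (w \<bullet> w) - B w w"
  have *: "2 * t * B v w \<le> t\<^sup>2 * c" for t
  proof -
    have "v + t *\<^sub>R w \<in> S" using S by (simp add: subspace_add subspace_scale)
    from max[OF this] have "B v v + 2 * t * B v w + t\<^sup>2 * B w w \<le> B v v * (1 + t\<^sup>2 * (w \<bullet> w))"
      using v sym[of w v]
      by (simp add: bilinear_ladd[OF B] bilinear_radd[OF B] bilinear_lmul[OF B] bilinear_rmul[OF B]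
          inner_add_left inner_add_right inner_commute power2_eq_square algebra_simps)
    then show ?thesis by (simp add: c_def algebra_simps)
  qed
  show ?thesis
  proof (rule ccontr)
    assume b: "B v w \<noteq> 0"
    \<comment> \<open>This size of t makes t^2 times (|c| + 1) equal to t times B v w, half of the
      left side; hence t times B v w would be nonpositive, although it has the sign of a
      square.\<close>
    define t where "t = B v w / (\<bar>c\<bar> + 1)"
    have "2 * t * B v w \<le> t\<^sup>2 * (\<bar>c\<bar> + 1)" using *[of t] by (smt (verit) mult_left_mono zero_le_power2)
    also have "\<dots> = t * B v w" unfolding t_def by (simp add: power2_eq_square)
    finally have "t * B v w \<le> 0" by simp
    moreover have "t * B v w > 0" unfolding t_def using b
      by (simp add: zero_less_divide_iff zero_less_mult_iff linorder_neq_iff) (auto simp: not_less add_nonneg_pos)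
    ultimately show False by simp
  qed
qed

text \<open>Maximise the form on the unit sphere of S, split off the maximiser and continue on its
  orthogonal complement in S. The version for subspaces both feeds the induction and applies to
  tangent spaces.\<close>

lemma symmetric_bilinear_diagonalizable:
  fixes B :: "'a::euclidean_space \<Rightarrow> 'a \<Rightarrow> real"
  assumes B: "bilinear B" and sym: "\<And>v w. B v w = B w v" and S: "subspace S"
  shows "\<exists>e :: nat \<Rightarrow> 'a. (\<forall>i < dim S. e i \<in> S) \<and>
    (\<forall>i < dim S. \<forall>j < dim S. e i \<bullet> e j = (if i = j then 1 else 0)) \<and>
    (\<forall>i < dim S. \<forall>j < dim S. i \<noteq> j \<longrightarrow> B (e i) (e j) = 0)"
  using S
proof (induction "dim S" arbitrary: S)
  case 0
  show ?case unfolding 0(1)[symmetric] by simp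
next
  case (Suc d)
  have "S \<noteq> {0}" using Suc(2) by auto
  then obtain y where y: "y \<in> S" "y \<noteq> 0" using subspace_0[OF Suc(3)] by auto
  let ?K = "S \<inter> sphere 0 1"
  have "compact ?K" using closed_subspace[OF Suc(3)] by (intro closed_Int_compact) auto
  moreover have "?K \<noteq> {}"
  proof -
    have "sgn y \<in> ?K" using y Suc(3) sgn_in_sphere[of y] by (simp add: sgn_div_norm subspace_scale)
    then show ?thesis by blast
  qed
  moreover have "continuous_on ?K (\<lambda>v. B v v)"
    using B by (intro bounded_bilinear.continuous_on[OF _ continuous_on_id continuous_on_id])
      (simp add: bilinear_conv_bounded_bilinear)
  ultimately obtain v where v: "v \<in> ?K" "\<And>z. z \<in> ?K \<Longrightarrow> B z z \<le> B v v"
    using continuous_attains_sup by meson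
  have vv: "v \<bullet> v = 1" using v(1) by (simp add: dot_square_norm)
  have max: "B z z \<le> B v v * (z \<bullet> z)" if "z \<in> S" for z
  proof (cases "z = 0")
    case True
    then show ?thesis by (simp add: bilinear_lzero[OF B])
  next
    case False
    have "sgn z \<in> ?K" using that False Suc(3) sgn_in_sphere[of z] by (simp add: sgn_div_norm subspace_scale)
    from v(2)[OF this] have "inverse (norm z) * (inverse (norm z) * B z z) \<le> B v v"
      by (simp add: sgn_div_norm bilinear_lmul[OF B] bilinear_rmul[OF B])
    then show ?thesis using False by (simp add: dot_square_norm power2_eq_square field_simps)
  qed
  define S' where "S' = {w \<in> S. \<forall>x \<in> span {v}. orthogonal x w}"
  have S'_iff: "w \<in> S' \<longleftrightarrow> w \<in> S \<and> v \<bullet> w = 0" for w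
    by (auto simp: S'_def span_singleton orthogonal_def)
  have "v \<noteq> 0" using vv by auto
  have "dim S' + dim (span {v}) = dim S"
    unfolding S'_def using v(1) Suc(3)
    by (intro dim_subspace_orthogonal_to_vectors) (auto simp: span_minimal)
  then have dS': "d = dim S'" using Suc(2) \<open>v \<noteq> 0\<close> by (simp add: dim_span)
  have sS': "subspace S'"
    using Suc(3) by (auto simp: subspace_def S'_iff inner_add_right)
  obtain e where E: "(\<forall>i < d. e i \<in> S') \<and> (\<forall>i < d. \<forall>j < d. e i \<bullet> e j = (if i = j then 1 else 0)) \<and>
      (\<forall>i < d. \<forall>j < d. i \<noteq> j \<longrightarrow> B (e i) (e j) = 0)"
    using Suc(1)[OF dS' sS', folded dS'] by (rule exE)
  note e = E[THEN conjunct1] E[THEN conjunct2, THEN conjunct1] E[THEN conjunct2, THEN conjunct2]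
  have ve: "v \<bullet> e i = 0" "e i \<bullet> v = 0" "B v (e i) = 0" "B (e i) v = 0" if "i < d" for i
  proof -
    have eS: "e i \<in> S" and ve: "v \<bullet> e i = 0" using e(1) that by (auto simp: S'_iff)
    show "v \<bullet> e i = 0" "e i \<bullet> v = 0" using ve by (simp_all add: inner_commute)
    show "B v (e i) = 0"
      by (rule maximal_direction_orthogonal[OF B sym max Suc(3) _ eS vv ve]) (use v(1) in auto)
    then show "B (e i) v = 0" using sym[of v "e i"] by simp
  qed
  let ?e = "\<lambda>i. case i of 0 \<Rightarrow> v | Suc j \<Rightarrow> e j"
  show ?case unfolding Suc(2)[symmetric]
  proof (intro exI[of _ ?e] conjI allI impI)
    fix i assume i: "i < Suc d"
    show "?e i \<in> S" using i e(1) v(1) by (auto simp: S'_iff split: nat.split)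
    fix j assume j: "j < Suc d"
    show "?e i \<bullet> ?e j = (if i = j then 1 else 0)" using i j ve e(2) vv by (auto split: nat.split)
    show "i \<noteq> j \<Longrightarrow> B (?e i) (?e j) = 0" using i j ve e(3) by (auto split: nat.split)
  qed
qed

definition tangent_frame :: "'a::euclidean_space \<Rightarrow> (nat \<Rightarrow> 'a) \<Rightarrow> bool" where
  "tangent_frame x e \<longleftrightarrow> norm x = 1 \<and> (\<forall>i < DIM('a) - 1. e i \<bullet> x = 0) \<and>
     (\<forall>i < DIM('a) - 1. \<forall>j < DIM('a) - 1. e i \<bullet> e j = (if i = j then 1 else 0))"

text \<open>The frame and x are DIM('a) orthonormal vectors and so span the space; the remainder is
  orthogonal to all of them, hence to itself.\<close>

lemma tangent_frame_expansion:
  fixes x :: "'a::euclidean_space"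
  assumes "tangent_frame x e"
  shows "v = (\<Sum>i<DIM('a) - 1. (v \<bullet> e i) *\<^sub>R e i) + (v \<bullet> x) *\<^sub>R x"
proof -
  let ?n = "DIM('a) - 1"
  have e: "\<And>i. i < ?n \<Longrightarrow> e i \<bullet> x = 0" "\<And>i j. i < ?n \<Longrightarrow> j < ?n \<Longrightarrow> e i \<bullet> e j = (if i = j then 1 else 0)"
    and xx: "x \<bullet> x = 1" using assms by (auto simp: tangent_frame_def dot_square_norm)
  have xe: "x \<bullet> e i = 0" if "i < ?n" for i using e(1)[OF that] by (simp add: inner_commute)
  define E where "E = insert x (e ` {..<?n})"
  have inj: "inj_on e {..<?n}" using e(2) by (intro inj_onI) (metis lessThan_iff zero_neq_one)
  have xn: "x \<notin> e ` {..<?n}" using e(1) xx by force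
  have "card E = DIM('a)" unfolding E_def using xn inj DIM_positive[where 'a='a] by (simp add: card_image)
  moreover have "independent E"
  proof (rule pairwise_orthogonal_independent)
    show "pairwise orthogonal E" unfolding E_def pairwise_def orthogonal_def
      using e xe by auto
    show "0 \<notin> E" unfolding E_def using xx e(2) by force
  qed
  ultimately have span: "span E = UNIV" using card_ge_dim_independent[of E UNIV] by auto
  define z where "z = v - ((\<Sum>i<?n. (v \<bullet> e i) *\<^sub>R e i) + (v \<bullet> x) *\<^sub>R x)"
  have "z \<bullet> x = 0" unfolding z_def using e xx by (simp add: inner_diff_left inner_add_left inner_sum_left)
  moreover have "z \<bullet> e j = 0" if "j < ?n" for j
  proof -
    have "(\<Sum>i<?n. (v \<bullet> e i) * (e i \<bullet> e j)) = (\<Sum>i<?n. if i = j then v \<bullet> e j else 0)"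
      using that e(2) by (intro sum.cong) auto
    then show ?thesis unfolding z_def using that e(1)[OF that]
      by (simp add: inner_diff_left inner_add_left inner_sum_left xe)
  qed
  ultimately have "orthogonal z y" if "y \<in> E" for y using that unfolding E_def orthogonal_def by auto
  then have "orthogonal z z" using orthogonal_to_span[of z E z] span by simp
  then show ?thesis unfolding z_def by (simp add: orthogonal_self)
qed

lemma tangent_frame_parseval:
  fixes x :: "'a::euclidean_space"
  assumes "tangent_frame x e"
  shows "v \<bullet> w = (\<Sum>i<DIM('a) - 1. (v \<bullet> e i) * (w \<bullet> e i)) + (v \<bullet> x) * (w \<bullet> x)"
proof -
  have "v \<bullet> w = w \<bullet> ((\<Sum>i<DIM('a) - 1. (v \<bullet> e i) *\<^sub>R e i) + (v \<bullet> x) *\<^sub>R x)"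
    using tangent_frame_expansion[OF assms, of v] by (simp add: inner_commute)
  then show ?thesis by (simp add: inner_add_right inner_sum_right)
qed

text \<open>If e diagonalises the Hessian, these weights express its diagonal entries in the frame f
  through the eigenvalues. Rows sum to 1 by Parseval, columns by exchanging the frames.\<close>

lemma tangent_frame_doubly_stochastic:
  fixes x :: "'a::euclidean_space"
  assumes "tangent_frame x e" "tangent_frame x f"
  shows "doubly_stochastic (DIM('a) - 1) (\<lambda>i j. (f i \<bullet> e j)\<^sup>2)"
proof -
  have row: "(\<Sum>j<DIM('a) - 1. (f i \<bullet> e j)\<^sup>2) = 1"
    if "tangent_frame x e" "tangent_frame x f" "i < DIM('a) - 1" for e f i
    using tangent_frame_parseval[OF that(1), of "f i" "f i"] that(2,3)
    by (simp add: tangent_frame_def power2_eq_square)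
  show ?thesis unfolding doubly_stochastic_def
    using row[OF assms] row[OF assms(2,1)] by (auto simp: inner_commute)
qed

lemma bilinear_frame_diag:
  fixes x :: "'a::euclidean_space"
  assumes B: "bilinear B" and e: "tangent_frame x e"
    and Bx: "\<And>v. B v x = 0" "\<And>v. B x v = 0"
    and diag: "\<And>i j. i < DIM('a) - 1 \<Longrightarrow> j < DIM('a) - 1 \<Longrightarrow> B (e i) (e j) = (if i = j then lam i else (0::real))"
  shows "B v w = (\<Sum>i<DIM('a) - 1. (v \<bullet> e i) * (w \<bullet> e i) * lam i)"
proof -
  let ?n = "DIM('a) - 1"
  have lin: "linear (\<lambda>v. B v w)" "linear (B v)" for v w using B unfolding bilinear_def by auto
  have 1: "B (e i) w = (w \<bullet> e i) * lam i" if "i < ?n" for i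
  proof -
    have "B (e i) w = B (e i) ((\<Sum>j<?n. (w \<bullet> e j) *\<^sub>R e j) + (w \<bullet> x) *\<^sub>R x)"
      using tangent_frame_expansion[OF e, of w] by simp
    also have "\<dots> = (\<Sum>j<?n. (w \<bullet> e j) * B (e i) (e j))"
      using Bx by (simp add: linear_add[OF lin(2)] linear_sum[OF lin(2)] linear_scale[OF lin(2)])
    also have "\<dots> = (\<Sum>j<?n. if i = j then (w \<bullet> e i) * lam i else 0)"
      using that diag by (intro sum.cong) auto
    finally show ?thesis using that by simp
  qed
  have "B v w = B ((\<Sum>j<?n. (v \<bullet> e j) *\<^sub>R e j) + (v \<bullet> x) *\<^sub>R x) w"
    using tangent_frame_expansion[OF e, of v] by simp
  also have "\<dots> = (\<Sum>j<?n. (v \<bullet> e j) * B (e j) w)"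
    using Bx by (simp add: linear_add[OF lin(1)] linear_sum[OF lin(1)] linear_scale[OF lin(1)])
  also have "\<dots> = (\<Sum>i<?n. (v \<bullet> e i) * (w \<bullet> e i) * lam i)"
    using 1 by (intro sum.cong) auto
  finally show ?thesis .
qed

section \<open>The equation for the extension\<close>

locale hessian_quotient_solution =
  fixes u \<phi> :: "'a::euclidean_space \<Rightarrow> real" and U V :: "'a set" and P k l :: nat and p q :: real
  assumes U: "open U" "sphere 0 1 \<subseteq> U" "Ck_on 4 U u"
    and V: "open V" "sphere 0 1 \<subseteq> V" "Ck_on 2 V \<phi>"
    and \<phi>_pos: "\<And>x. x \<in> sphere 0 1 \<Longrightarrow> \<phi> x > 0"
    and u_pos: "\<And>x. x \<in> sphere 0 1 \<Longrightarrow> u x > 0"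
    and adm: "admissible P k u"
    and pde: "\<And>x. x \<in> sphere 0 1 \<Longrightarrow>
        esym k (LamP (eigvals u x)) (multi_idx (DIM('a) - 1) P)
          / esym l (LamP (eigvals u x)) (multi_idx (DIM('a) - 1) P)
        = u x powr (p - 1) * ((u x)\<^sup>2 + (norm (sgrad u x))\<^sup>2) powr ((real k + 1 - q) / 2) * \<phi> x"
    and dims: "DIM('a) \<ge> 2" "0 < P" "l < k" "k \<le> ((DIM('a) - 1) - 1) choose (P - 1)"
begin

abbreviation "h \<equiv> hext u"

definition H :: "'a \<Rightarrow> 'a \<Rightarrow> 'a \<Rightarrow> real" where
  "H v w = dird w (dird v h)"

text \<open>\<open>R\<close> is \<open>u\<^sup>2 + |\<nabla>u|\<^sup>2\<close> on the sphere, and \<open>\<psi>\<close> the logarithm of the right-hand side.\<close>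
definition R :: "'a \<Rightarrow> real" where
  "R x = (\<Sum>b\<in>Basis. (dird b h x)\<^sup>2)"

definition \<psi> :: "'a \<Rightarrow> real" where
  "\<psi> x = (p - 1) * ln (h x) + (real k + 1 - q) / 2 * ln (R x) + ln (\<phi> x)"

lemma open_W: "open (- {0::'a})" by auto

lemma Ck_h: "Ck_on 4 (- {0}) h" using Ck_on_hext[OF U] .

lemma Ck_dh: "Ck_on 3 (- {0}) (dird v h)"
  using Ck_on_Suc_dird[OF open_W, of 3 h] Ck_h by (simp add: eval_nat_numeral)

lemma Ck_H: "Ck_on 2 (- {0}) (H v w)"
  unfolding H_def using Ck_on_Suc_dird[OF open_W, of 2 "dird v h"] Ck_dh by (simp add: eval_nat_numeral)

lemma Ck_dH: "Ck_on 1 (- {0}) (dird z (H v w))"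
  using Ck_on_Suc_dird[OF open_W, of 1 "H v w"] Ck_H by (simp add: eval_nat_numeral)

lemma Ck_lower: "Ck_on 2 (- {0}) h" "Ck_on 2 (- {0}) (dird v h)"
  using Ck_on_le[OF open_W Ck_h] Ck_on_le[OF open_W Ck_dh] by auto

lemma Ck_imp_differentiable: "Ck_on (Suc j) (- {0::'a}) f \<Longrightarrow> x \<noteq> 0 \<Longrightarrow> f differentiable at x"
  using Ck_on_Suc_differentiable[OF open_W] by auto

lemma diffs:
  assumes "x \<noteq> 0"
  shows "h differentiable at x" "dird v h differentiable at x" "H v w differentiable at x"
    "dird z (H v w) differentiable at x"
  using Ck_imp_differentiable[of 3 h] Ck_imp_differentiable[of 2 "dird v h"]
    Ck_imp_differentiable[of 1 "H v w"] Ck_imp_differentiable[of 0 "dird z (H v w)"]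
    Ck_h Ck_dh Ck_H Ck_dH assms
  by (simp_all add: eval_nat_numeral del: Ck_on.simps)

lemma H_sym: "x \<noteq> 0 \<Longrightarrow> H v w x = H w v x"
  unfolding H_def using dird_commute[OF open_W Ck_lower(1)] by auto

lemma dird_H_swap:
  assumes "x \<noteq> 0" shows "dird z (H v w) x = dird v (H w z) x"
proof -
  have "dird z (H v w) x = dird w (dird z (dird v h)) x"
    unfolding H_def using dird_commute[OF open_W Ck_lower(2)] assms by auto
  also have "\<dots> = dird w (dird v (dird z h)) x"
    by (rule dird_cong[OF open_W]) (use assms H_sym diffs in \<open>auto simp: H_def\<close>)
  also have "\<dots> = dird v (dird w (dird z h)) x"
    using dird_commute[OF open_W Ck_lower(2)] assms by auto
  also have "\<dots> = dird v (H w z) x"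
    by (rule dird_cong[OF open_W]) (use assms H_sym[unfolded H_def] diffs in \<open>auto simp: H_def\<close>)
  finally show ?thesis .
qed

text \<open>Links the second-order condition at the maximum, where one Hessian entry is
  differentiated in all directions, to the equation differentiated twice in one direction. Here u is
  differentiated four times.\<close>

lemma dird_dird_H_swap:
  assumes "x \<noteq> 0" shows "dird v (dird v (H w w)) x = dird w (dird w (H v v)) x"
proof -
  have "dird v (dird v (H w w)) x = dird v (dird w (H w v)) x"
    by (rule dird_cong[OF open_W]) (use assms dird_H_swap[of _ v w w] diffs in auto)
  also have "\<dots> = dird w (dird v (H w v)) x"
    using dird_commute[OF open_W Ck_H] assms by auto
  also have "\<dots> = dird w (dird w (H v v)) x"
    by (rule dird_cong[OF open_W]) (use assms dird_H_swap[of _ v w v] diffs in auto)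
  finally show ?thesis .
qed

lemma homs: "homogeneous 1 h" "homogeneous 0 (dird v h)" "homogeneous (-1) (H v w)"
proof -
  show 1: "homogeneous 1 h" by (rule homogeneous_hext)
  show 0: "homogeneous 0 (dird v h)" for v using homogeneous_dird[OF 1] diffs by simp
  show "homogeneous (-1) (H v w)" unfolding H_def using homogeneous_dird[OF 0, of v w] diffs by simp
qed

text \<open>The degrees 1, 0 and -1 fix the radial derivative of each quantity, which is the
  acceleration term in \<open>jet2_circ\<close>.\<close>

lemma euler:
  assumes "x \<noteq> 0"
  shows "dird x h x = h x" "H v x x = 0" "H x v x = 0" "dird x (H v w) x = - H v w x"
proof -
  show "dird x h x = h x" using homogeneous_euler[OF homs(1) diffs(1)] assms by simp
  show "H v x x = 0" unfolding H_def using homogeneous_euler[OF homs(2) diffs(2)] assms by simp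
  then show "H x v x = 0" using H_sym assms by simp
  show "dird x (H v w) x = - H v w x" using homogeneous_euler[OF homs(3) diffs(3)] assms by simp
qed

lemma bilinear_H: "x \<noteq> 0 \<Longrightarrow> bilinear (\<lambda>v w. H v w x)"
proof -
  assume x: "x \<noteq> 0"
  have lin: "linear (\<lambda>w. H v w x)" for v
    using linear_frechet_derivative[OF diffs(2)[OF x, of v]] by (simp add: H_def dird_def)
  then have "linear (\<lambda>v. H v w x)" for w using H_sym[OF x, of _ w] by simp
  then show ?thesis using lin by (simp add: bilinear_def)
qed

lemma h_sphere: "norm x = 1 \<Longrightarrow> h x = u x"
  by (simp add: hext_def sgn_div_norm)

lemma H_tangent: "norm x = 1 \<Longrightarrow> v \<bullet> x = 0 \<Longrightarrow> w \<bullet> x = 0 \<Longrightarrow> H v w x = shess u x v w + u x * (v \<bullet> w)"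
  unfolding H_def using ehess_hext[OF U(1,2) Ck_on_le[OF U(1,3)]] by simp

lemma u_differentiable: "norm x = 1 \<Longrightarrow> u differentiable at x"
  using Ck_on_Suc_differentiable[OF U(1), of 3 u x] U by (auto simp: eval_nat_numeral simp del: Ck_on.simps)

lemma R_sphere: "norm x = 1 \<Longrightarrow> R x = (u x)\<^sup>2 + (norm (sgrad u x))\<^sup>2"
  unfolding R_def by (intro norm_hext_gradient u_differentiable)

definition adapted :: "'a \<Rightarrow> (nat \<Rightarrow> 'a) \<Rightarrow> bool" where
  "adapted x e \<longleftrightarrow> tangent_frame x e \<and>
     (\<forall>i<DIM('a) - 1. \<forall>j<DIM('a) - 1. H (e i) (e j) x = (if i = j then eigvals u x i else 0))"

text \<open>Diagonalisation shows that some list satisfies \<open>is_eigvals\<close>, so the chosen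
  \<open>eigvals\<close> does too. The frame returned belongs to the chosen list, not to the
  diagonalisation that proved existence.\<close>

lemma adapted_frame_exists:
  assumes x: "norm x = 1"
  obtains e where "adapted x e"
proof -
  have x0: "x \<noteq> 0" using x by auto
  let ?S = "{y. x \<bullet> y = 0}"
  have dS: "dim ?S = (DIM('a) - 1)" using dim_hyperplane[OF x0] by simp
  have sS: "subspace ?S" by (rule subspace_hyperplane)
  have ex: "\<exists>e :: nat \<Rightarrow> 'a. (\<forall>i < DIM('a) - 1. e i \<in> ?S) \<and>
    (\<forall>i < DIM('a) - 1. \<forall>j < DIM('a) - 1. e i \<bullet> e j = (if i = j then 1 else 0)) \<and>
    (\<forall>i < DIM('a) - 1. \<forall>j < DIM('a) - 1. i \<noteq> j \<longrightarrow> H (e i) (e j) x = 0)"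
    using symmetric_bilinear_diagonalizable[OF bilinear_H[OF x0] H_sym[OF x0] sS] unfolding dS .
  have iff: "is_eigvals u x lam \<longleftrightarrow> (\<exists>e. tangent_frame x e \<and>
      (\<forall>i<DIM('a) - 1. \<forall>j<DIM('a) - 1. H (e i) (e j) x = (if i = j then lam i else 0)))" for lam
    unfolding is_eigvals_def tangent_frame_def 
    using x by (intro iff_exI) (auto simp: H_tangent[OF x])
  obtain e where e: "(\<forall>i < DIM('a) - 1. e i \<in> ?S) \<and>
    (\<forall>i < DIM('a) - 1. \<forall>j < DIM('a) - 1. e i \<bullet> e j = (if i = j then 1 else 0)) \<and>
    (\<forall>i < DIM('a) - 1. \<forall>j < DIM('a) - 1. i \<noteq> j \<longrightarrow> H (e i) (e j) x = 0)" using ex by (rule exE)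
  have "is_eigvals u x (\<lambda>i. H (e i) (e i) x)"
    unfolding iff tangent_frame_def using e x by (intro exI[of _ e]) (auto simp: inner_commute)
  then have "is_eigvals u x (eigvals u x)" unfolding eigvals_def by (rule someI[of "is_eigvals u x"])
  then show ?thesis using that unfolding iff adapted_def by blast
qed

lemma eigvals_cone: "norm x = 1 \<Longrightarrow> hess_cone (DIM('a) - 1) P k (eigvals u x)"
  using adm by (simp add: admissible_def hess_cone_def)

lemma R_pos: "norm x = 1 \<Longrightarrow> R x > 0"
  using R_sphere[of x] u_pos[of x] by (simp add: add_pos_nonneg)

lemma quot_ln_eq:
  assumes "norm x = 1" shows "quot_ln (DIM('a) - 1) P k l (eigvals u x) = \<psi> x"
proof -
  have u: "u x > 0" "\<phi> x > 0" using u_pos \<phi>_pos assms by auto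
  show ?thesis
    unfolding quot_ln_def \<psi>_def h_sphere[OF assms]
    using pde[of x] assms u R_pos[OF assms] unfolding R_sphere[OF assms, symmetric]
    by (simp add: ln_mult ln_powr)
qed

lemma H_diag:
  assumes "adapted x e"
  shows "H v w x = (\<Sum>i<DIM('a) - 1. (v \<bullet> e i) * (w \<bullet> e i) * eigvals u x i)"
proof -
  have x: "x \<noteq> 0" and e: "tangent_frame x e" using assms by (auto simp: adapted_def tangent_frame_def)
  show ?thesis
    by (rule bilinear_frame_diag[OF bilinear_H[OF x] e euler(2,3)[OF x]])
      (use assms in \<open>simp add: adapted_def\<close>)
qed

lemma adapted_props:
  assumes "adapted x e"
  shows "norm x = 1" "x \<noteq> 0" "x \<bullet> x = 1" "tangent_frame x e"
    "\<And>i. i < DIM('a) - 1 \<Longrightarrow> norm (e i) = 1" "\<And>i. i < DIM('a) - 1 \<Longrightarrow> e i \<bullet> x = 0" "\<And>i. i < DIM('a) - 1 \<Longrightarrow> x \<bullet> e i = 0"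
    "\<And>i j. i < DIM('a) - 1 \<Longrightarrow> j < DIM('a) - 1 \<Longrightarrow> e i \<bullet> e j = (if i = j then 1 else 0)"
    "\<And>i j. i < DIM('a) - 1 \<Longrightarrow> j < DIM('a) - 1 \<Longrightarrow> H (e i) (e j) x = (if i = j then eigvals u x i else 0)"
    "\<And>i t. i < DIM('a) - 1 \<Longrightarrow> norm (circ x (e i) t) = 1" "\<And>i t. i < DIM('a) - 1 \<Longrightarrow> circ x (e i) t \<in> - {0}"
proof -
  show 1: "norm x = 1" and 2: "tangent_frame x e"
    and 3: "\<And>i. i < DIM('a) - 1 \<Longrightarrow> e i \<bullet> x = 0" and 4: "\<And>i j. i < DIM('a) - 1 \<Longrightarrow> j < DIM('a) - 1 \<Longrightarrow> e i \<bullet> e j = (if i = j then 1 else 0)"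
    and "\<And>i j. i < DIM('a) - 1 \<Longrightarrow> j < DIM('a) - 1 \<Longrightarrow> H (e i) (e j) x = (if i = j then eigvals u x i else 0)"
    using assms unfolding adapted_def tangent_frame_def by simp_all
  show "x \<noteq> 0" "x \<bullet> x = 1" using 1 by (auto simp: dot_square_norm)
  show 5: "\<And>i. i < DIM('a) - 1 \<Longrightarrow> norm (e i) = 1" using 4 by (simp add: norm_eq_1)
  show 6: "\<And>i. i < DIM('a) - 1 \<Longrightarrow> x \<bullet> e i = 0" using 3 by (simp add: inner_commute)
  show 7: "\<And>i t. i < DIM('a) - 1 \<Longrightarrow> norm (circ x (e i) t) = 1" using norm_circ[OF 1 5 6] .
  show "circ x (e i) t \<in> - {0}" if "i < DIM('a) - 1" for i t using 7[OF that, of t] by auto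
qed

text \<open>A supergradient of the log quotient at the eigenvalues of x, normalised by Euler's
  relation. S allows it to be tested on diagonal entries in frames that do not diagonalise.\<close>

definition supports :: "'a \<Rightarrow> (nat \<Rightarrow> real) \<Rightarrow> bool" where
  "supports x c \<longleftrightarrow> (\<Sum>i<DIM('a) - 1. c i * eigvals u x i) = real k - real l \<and>
     (\<forall>lam S. hess_cone (DIM('a) - 1) P k lam \<and> doubly_stochastic (DIM('a) - 1) S \<longrightarrow>
       quot_ln (DIM('a) - 1) P k l lam \<le> quot_ln (DIM('a) - 1) P k l (eigvals u x) + (\<Sum>i<DIM('a) - 1. c i * (\<Sum>j<DIM('a) - 1. S i j * lam j)) - (real k - real l))"

text \<open>The circle's own velocity is inserted in both slots. In the second derivative the
  acceleration gives lam, the factor cos^2 gives - 2 lam, and the mixed term with H x (e j), whose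
  derivative is - lam, gives + 4 lam; together 3 lam.\<close>

lemma jet2_rotated_hessian:
  assumes e: "adapted x e" and j: "j < DIM('a) - 1"
  shows "jet2 (\<lambda>t. H ((- sin t) *\<^sub>R x + cos t *\<^sub>R e j) ((- sin t) *\<^sub>R x + cos t *\<^sub>R e j) (circ x (e j) t))
     (eigvals u x j) (dird (e j) (H (e j) (e j)) x) (dird (e j) (dird (e j) (H (e j) (e j))) x + 3 * eigvals u x j)"
proof -
  note E = adapted_props[OF e]
  let ?g = "circ x (e j)"
  note g0 = E(11)[OF j]
  have B: "bilinear (\<lambda>v w. H v w (?g t))" for t using bilinear_H g0[of t] by auto
  have eq: "H ((- sin t) *\<^sub>R x + cos t *\<^sub>R e j) ((- sin t) *\<^sub>R x + cos t *\<^sub>R e j) (?g t)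
     = (cos t * cos t) * H (e j) (e j) (?g t) + (-2) * ((sin t * cos t) * H x (e j) (?g t))
       + (sin t * sin t) * H x x (?g t)" for t
    using H_sym[of "?g t" "e j" x] g0[of t]
    by (simp add: bilinear_ladd[OF B] bilinear_radd[OF B] bilinear_lmul[OF B] bilinear_rmul[OF B]
        bilinear_lsub[OF B] bilinear_rsub[OF B] bilinear_lneg[OF B] bilinear_rneg[OF B] algebra_simps)
  have "dird (e j) (H x (e j)) x = dird x (H (e j) (e j)) x" using dird_H_swap[OF E(2)] by metis
  then have b1: "dird (e j) (H x (e j)) x = - eigvals u x j"
    using euler(4)[OF E(2)] E(9)[OF j j] by simp
  have jA: "jet2 (\<lambda>t. H (e j) (e j) (?g t)) (eigvals u x j) (dird (e j) (H (e j) (e j)) x)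
      (dird (e j) (dird (e j) (H (e j) (e j))) x + eigvals u x j)"
    using jet2_circ[OF open_W g0 Ck_H, of "e j" "e j"] euler(4)[OF E(2)] E(9)[OF j j] by simp
  have jB: "jet2 (\<lambda>t. H x (e j) (?g t)) 0 (- eigvals u x j) (dird (e j) (dird (e j) (H x (e j))) x)"
    using jet2_circ[OF open_W g0 Ck_H, of x "e j"] euler(3,4)[OF E(2)] b1 by simp
  obtain b c where jC: "jet2 (\<lambda>t. H x x (?g t)) 0 b c"
    using jet2_circ[OF open_W g0 Ck_H, of x x] euler(3)[OF E(2)] by simp
  show ?thesis unfolding eq
    using jet2_add[OF jet2_add[OF jet2_mult[OF jet2_mult[OF jet2_cos jet2_cos] jA]
      jet2_cmult[OF jet2_mult[OF jet2_mult[OF jet2_sin jet2_cos] jB], of "-2"]]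
      jet2_mult[OF jet2_mult[OF jet2_sin jet2_sin] jC]]
    by (simp add: algebra_simps)
qed

text \<open>Rotation in the plane of x and e j, which is parallel transport of the frame along the
  great circle.\<close>

lemma rotated_frame:
  assumes e: "adapted x e" and j: "j < DIM('a) - 1"
  shows "tangent_frame (circ x (e j) t) (\<lambda>i. if i = j then (- sin t) *\<^sub>R x + cos t *\<^sub>R e j else e i)"
proof -
  note E = adapted_props[OF e]
  have sc: "sin t * sin t + cos t * cos t = 1"
    using sin_cos_squared_add[of t] by (simp add: power2_eq_square)
  show ?thesis unfolding tangent_frame_def using E(3,6,7,8) E(10)[OF j] j sc
    by (auto simp: circ_def inner_add_left inner_add_right inner_diff_left inner_diff_right algebra_simps)
qed

text \<open>
  By concavity, the linearised operator in the rotated frame minus \<open>\<psi>\<close> has a minimum at \<open>x\<close>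
  along the great circle; its first and second derivatives there give the two claims.
\<close>
lemma pde_derivatives:
  assumes e: "adapted x e" and c: "supports x c" and j: "j < DIM('a) - 1"
    and jet: "jet2 (\<lambda>t. \<psi> (circ x (e j) t)) (\<psi> x) b d"
  shows "(\<Sum>i<DIM('a) - 1. c i * dird (e j) (H (e i) (e i)) x) = b"
    "d \<le> (\<Sum>i<DIM('a) - 1. c i * dird (e j) (dird (e j) (H (e i) (e i))) x) + (real k - real l) + 2 * c j * eigvals u x j"
proof -
  note E = adapted_props[OF e]
  let ?g = "circ x (e j)"
  note g0 = E(11)[OF j]
  let ?f = "\<lambda>t i. if i = j then (- sin t) *\<^sub>R x + cos t *\<^sub>R e j else e i"
  let ?D3 = "\<lambda>i. dird (e j) (H (e i) (e i)) x"
  let ?D4 = "\<lambda>i. dird (e j) (dird (e j) (H (e i) (e i))) x"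
  \<comment> \<open>A fixed frame vector picks up one eigenvalue from the acceleration; the rotating
    one picks up three, hence the extra 2 \<open>eigvals u x j\<close>.\<close>
  have ji: "jet2 (\<lambda>t. H (?f t i) (?f t i) (?g t)) (eigvals u x i) (?D3 i)
      (?D4 i + eigvals u x i + (if i = j then 2 * eigvals u x j else 0))" if i: "i < DIM('a) - 1" for i
  proof (cases "i = j")
    case True
    then show ?thesis using jet2_rotated_hessian[OF e j] by (simp add: add.commute)
  next
    case False
    then show ?thesis
      using jet2_circ[OF open_W g0 Ck_H, of "e i" "e i"] euler(4)[OF E(2)] E(9)[OF i i] by simp
  qed
  have "jet2 (\<lambda>t. (\<Sum>i<DIM('a) - 1. c i * H (?f t i) (?f t i) (?g t)) + (-1) * \<psi> (?g t))
     ((\<Sum>i<DIM('a) - 1. c i * eigvals u x i) + (-1) * \<psi> x) ((\<Sum>i<DIM('a) - 1. c i * ?D3 i) + (-1) * b)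
     ((\<Sum>i<DIM('a) - 1. c i * (?D4 i + eigvals u x i + (if i = j then 2 * eigvals u x j else 0))) + (-1) * d)"
    by (intro jet2_add jet2_sum jet2_cmult jet ji) auto
  note J = this
  have min: "(\<Sum>i<DIM('a) - 1. c i * H (?f t i) (?f t i) (?g t)) + (-1) * \<psi> (?g t)
      \<ge> (\<Sum>i<DIM('a) - 1. c i * eigvals u x i) + (-1) * \<psi> x" for t
  proof -
    obtain e' where e': "adapted (?g t) e'" using adapted_frame_exists[OF E(10)[OF j]] by blast
    \<comment> \<open>The frame e' that diagonalises at the new point is unrelated to the rotated
      one; the diagonal entries in the rotated frame are averages of the new eigenvalues with these
      weights.\<close>
    note ds = tangent_frame_doubly_stochastic[OF adapted_props(4)[OF e'] rotated_frame[OF e j, of t]]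
    have "quot_ln (DIM('a) - 1) P k l (eigvals u (?g t)) \<le> quot_ln (DIM('a) - 1) P k l (eigvals u x)
       + (\<Sum>i<DIM('a) - 1. c i * (\<Sum>m<DIM('a) - 1. (?f t i \<bullet> e' m)\<^sup>2 * eigvals u (?g t) m)) - (real k - real l)"
      using c eigvals_cone[OF E(10)[OF j], of t] ds unfolding supports_def by blast
    moreover have "(\<Sum>m<DIM('a) - 1. (?f t i \<bullet> e' m)\<^sup>2 * eigvals u (?g t) m) = H (?f t i) (?f t i) (?g t)" for i
      unfolding H_diag[OF e'] by (simp add: power2_eq_square)
    ultimately have "\<psi> (?g t) \<le> \<psi> x + (\<Sum>i<DIM('a) - 1. c i * H (?f t i) (?f t i) (?g t)) - (real k - real l)"
      unfolding quot_ln_eq[OF E(1)] quot_ln_eq[OF E(10)[OF j]] by simp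
    then show ?thesis using c unfolding supports_def by simp
  qed
  show "(\<Sum>i<DIM('a) - 1. c i * ?D3 i) = b" using jet2_min(1)[OF J min] by simp
  have "(\<Sum>i<DIM('a) - 1. c i * (?D4 i + eigvals u x i + (if i = j then 2 * eigvals u x j else 0)))
    = (\<Sum>i<DIM('a) - 1. c i * ?D4 i) + (\<Sum>i<DIM('a) - 1. c i * eigvals u x i) + (\<Sum>i<DIM('a) - 1. if i = j then 2 * c j * eigvals u x j else 0)"
    unfolding sum.distrib[symmetric] by (intro sum.cong) (auto simp: algebra_simps)
  also have "\<dots> = (\<Sum>i<DIM('a) - 1. c i * ?D4 i) + (real k - real l) + 2 * c j * eigvals u x j"
    using c j unfolding supports_def by simp
  finally show "d \<le> (\<Sum>i<DIM('a) - 1. c i * ?D4 i) + (real k - real l) + 2 * c j * eigvals u x j"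
    using jet2_min(2)[OF J min] by simp
qed

lemma jet2_h:
  assumes e: "adapted x e" and j: "j < DIM('a) - 1"
  shows "jet2 (\<lambda>t. h (circ x (e j) t)) (u x) (dird (e j) h x) (eigvals u x j - u x)"
  using jet2_circ[OF open_W adapted_props(11)[OF e j] Ck_lower(1)] euler(1)[of x] adapted_props(1,2)[OF e]
    adapted_props(9)[OF e j j] h_sphere[of x] by (simp add: H_def)

text \<open>By symmetry of third derivatives the left side is the derivative of H (e j) (e j) along
  the gradient of h. Its tangential part gives the sum, its radial part u x times - lam j.\<close>

lemma sum_dird_h_third:
  assumes e: "adapted x e" and j: "j < DIM('a) - 1"
  shows "(\<Sum>b\<in>Basis. dird b h x * dird (e j) (dird (e j) (dird b h)) x)
     = (\<Sum>i<DIM('a) - 1. dird (e i) h x * dird (e i) (H (e j) (e j)) x) - u x * eigvals u x j"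
proof -
  note E = adapted_props[OF e]
  let ?g = "\<Sum>b\<in>Basis. dird b h x *\<^sub>R b"
  have g: "?g \<bullet> v = dird v h x" for v
    using egrad_inner[OF diffs(1)[OF E(2)], of v] by (simp add: egrad_def dird_def)
  have "(\<Sum>b\<in>Basis. dird b h x * dird (e j) (dird (e j) (dird b h)) x)
     = (\<Sum>b\<in>Basis. dird b h x * dird b (H (e j) (e j)) x)"
    using dird_H_swap[OF E(2), of "e j" _ "e j"] by (intro sum.cong) (auto simp: H_def)
  also have "\<dots> = dird ?g (H (e j) (e j)) x" by (rule dird_sum[OF diffs(3)[OF E(2)], symmetric])
  also have "?g = (\<Sum>i<DIM('a) - 1. dird (e i) h x *\<^sub>R e i) + dird x h x *\<^sub>R x"
    using tangent_frame_expansion[OF E(4), of ?g] unfolding g .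
  also have "dird \<dots> (H (e j) (e j)) x
      = dird (\<Sum>i<DIM('a) - 1. dird (e i) h x *\<^sub>R e i) (H (e j) (e j)) x + dird x h x * dird x (H (e j) (e j)) x"
    using dird_lincomb[OF diffs(3)[OF E(2)], of 1 "\<Sum>i<DIM('a) - 1. dird (e i) h x *\<^sub>R e i" "dird x h x" x] by simp
  also have "dird (\<Sum>i<DIM('a) - 1. dird (e i) h x *\<^sub>R e i) (H (e j) (e j)) x = (\<Sum>i<DIM('a) - 1. dird (e i) h x * dird (e i) (H (e j) (e j)) x)"
    by (rule dird_sum[OF diffs(3)[OF E(2)]])
  finally show ?thesis using euler(1,4)[OF E(2)] E(9)[OF j j] h_sphere[OF E(1)] by simp
qed

text \<open>\<open>dird b h\<close> has degree 0, so the acceleration adds nothing to it. Since e j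
  is an eigenvector, the derivative of \<open>dird b h\<close> is lam j times a coordinate of e j,
  and the squares sum to lam j^2.\<close>

lemma jet2_R:
  assumes e: "adapted x e" and j: "j < DIM('a) - 1"
  shows "jet2 (\<lambda>t. R (circ x (e j) t)) (R x) (2 * eigvals u x j * dird (e j) h x)
     (2 * (eigvals u x j)\<^sup>2 + 2 * ((\<Sum>i<DIM('a) - 1. dird (e i) h x * dird (e i) (H (e j) (e j)) x) - u x * eigvals u x j))"
proof -
  note E = adapted_props[OF e]
  note g0 = E(11)[OF j]
  let ?lam = "eigvals u x j"
  have hb: "dird (e j) (dird b h) x = ?lam * (b \<bullet> e j)" for b
  proof -
    have "H b (e j) x = (\<Sum>i<DIM('a) - 1. if i = j then (b \<bullet> e j) * ?lam else 0)"
      unfolding H_diag[OF e] using E(8) j by (intro sum.cong) auto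
    then show ?thesis using j by (simp add: H_def)
  qed
  let ?T = "\<lambda>b. dird (e j) (dird (e j) (dird b h)) x"
  have jb: "jet2 (\<lambda>t. dird b h (circ x (e j) t)) (dird b h x) (?lam * (b \<bullet> e j)) (?T b)" for b
    using jet2_circ[OF open_W g0 Ck_lower(2)[of b]] euler(2)[OF E(2), of b] by (simp add: H_def hb)
  have J: "jet2 (\<lambda>t. R (circ x (e j) t)) (\<Sum>b\<in>Basis. dird b h x * dird b h x)
     (\<Sum>b\<in>Basis. dird b h x * (?lam * (b \<bullet> e j)) + ?lam * (b \<bullet> e j) * dird b h x)
     (\<Sum>b\<in>Basis. dird b h x * ?T b + 2 * (?lam * (b \<bullet> e j)) * (?lam * (b \<bullet> e j)) + ?T b * dird b h x)"
    unfolding R_def power2_eq_square by (intro jet2_sum jet2_mult jb)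
  have 1: "(\<Sum>b\<in>Basis. dird b h x * (?lam * (b \<bullet> e j)) + ?lam * (b \<bullet> e j) * dird b h x) = 2 * ?lam * dird (e j) h x"
  proof -
    have "dird (e j) h x = egrad h x \<bullet> e j" using egrad_inner[OF diffs(1)[OF E(2)]] by simp
    then have "dird (e j) h x = (\<Sum>b\<in>Basis. dird b h x * (b \<bullet> e j))"
      by (simp add: egrad_def dird_def inner_sum_left)
    then show ?thesis by (simp add: sum_distrib_left) (intro sum.cong refl; simp)
  qed
  have 2: "(\<Sum>b\<in>Basis. dird b h x * ?T b + 2 * (?lam * (b \<bullet> e j)) * (?lam * (b \<bullet> e j)) + ?T b * dird b h x)
     = 2 * ?lam\<^sup>2 + 2 * (\<Sum>b\<in>Basis. dird b h x * ?T b)"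
  proof -
    have "(\<Sum>b\<in>Basis. (e j \<bullet> b) * (e j \<bullet> b)) = 1" using E(8)[OF j j] euclidean_inner[of "e j" "e j"] by simp
    then have "(\<Sum>b\<in>Basis. 2 * ?lam\<^sup>2 * ((e j \<bullet> b) * (e j \<bullet> b))) = 2 * ?lam\<^sup>2"
      unfolding sum_distrib_left[symmetric] by simp
    moreover have "(\<Sum>b\<in>Basis. dird b h x * ?T b + 2 * (?lam * (b \<bullet> e j)) * (?lam * (b \<bullet> e j)) + ?T b * dird b h x)
      = (\<Sum>b\<in>Basis. 2 * ?lam\<^sup>2 * ((e j \<bullet> b) * (e j \<bullet> b))) + (\<Sum>b\<in>Basis. 2 * (dird b h x * ?T b))"
      unfolding sum.distrib[symmetric]
      by (intro sum.cong refl) (simp add: power2_eq_square inner_commute)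
    ultimately show ?thesis by (simp add: sum_distrib_left)
  qed
  have "R x = (\<Sum>b\<in>Basis. dird b h x * dird b h x)" by (simp add: R_def power2_eq_square)
  then show ?thesis using J unfolding 1 2 sum_dird_h_third[OF e j] by simp
qed

lemma shess_\<phi>:
  assumes "norm x = 1" "norm v = 1"
  shows "ehess \<phi> x v v - dird x \<phi> x = shess \<phi> x v v"
proof -
  have "\<phi> differentiable at x"
    using Ck_on_Suc_differentiable[OF V(1), of 1 \<phi> x] V assms by (auto simp: eval_nat_numeral simp del: Ck_on.simps)
  then show ?thesis using assms by (simp add: shess_def egrad_inner dot_square_norm)
qed

lemma jet2_\<psi>:
  assumes e: "adapted x e" and j: "j < DIM('a) - 1"
  defines "g \<equiv> dird (e j) h x" and "lam \<equiv> eigvals u x j" and "f \<equiv> sgrad \<phi> x \<bullet> e j"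
  shows "jet2 (\<lambda>t. \<psi> (circ x (e j) t)) (\<psi> x)
    ((p - 1) * (g / u x) + (real k + 1 - q) / 2 * (2 * lam * g / R x) + f / \<phi> x)
    ((p - 1) * ((lam - u x) / u x - (g / u x)\<^sup>2)
     + (real k + 1 - q) / 2 * ((2 * lam\<^sup>2 + 2 * ((\<Sum>i<DIM('a) - 1. dird (e i) h x * dird (e i) (H (e j) (e j)) x) - u x * lam)) / R x
         - (2 * lam * g / R x)\<^sup>2)
     + (shess \<phi> x (e j) (e j) / \<phi> x - (f / \<phi> x)\<^sup>2))"
proof -
  note E = adapted_props[OF e]
  have d: "\<phi> differentiable at x"
    using Ck_on_Suc_differentiable[OF V(1), of 1 \<phi> x] V E(1) by (auto simp: eval_nat_numeral simp del: Ck_on.simps)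
  have f: "f = dird (e j) \<phi> x"
    using egrad_inner[OF d] E(7)[OF j] by (simp add: f_def sgrad_def inner_diff_left)
  have cV: "circ x (e j) t \<in> V" for t using E(10)[OF j, of t] V(2) by auto
  have jphi: "jet2 (\<lambda>t. \<phi> (circ x (e j) t)) (\<phi> x) f (shess \<phi> x (e j) (e j))"
    using jet2_circ[OF V(1) cV V(3)] shess_\<phi>[OF E(1) E(5)[OF j]] by (simp add: f ehess_eq_dird)
  show ?thesis unfolding \<psi>_def h_sphere[OF E(1)] g_def lam_def
    by (intro jet2_add jet2_cmult jet2_ln jet2_h[OF e j] jet2_R[OF e j] jphi)
      (use E(10)[OF j] u_pos h_sphere R_pos \<phi>_pos in auto)
qed

end

section \<open>The maximum principle\<close>

context hessian_quotient_solution
begin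

text \<open>The second-order conditions at the maximum are weighted by c j and added. The fourth
  derivatives become those of the equation differentiated twice along e a, bounded below by
  concavity. Third derivatives of the entry a are eliminated by the first-order condition, those
  weighted by c by the equation differentiated once.\<close>

lemma key_inequality:
  assumes e: "adapted x e" and c: "supports x c" "\<And>j. j < DIM('a) - 1 \<Longrightarrow> c j \<ge> 0" and a: "a < DIM('a) - 1"
    and max: "\<And>y. norm y = 1 \<Longrightarrow> H (e a) (e a) y + A / 2 * R y \<le> eigvals u x a + A / 2 * R x"
  defines "lam \<equiv> eigvals u x" and "g \<equiv> \<lambda>i. dird (e i) h x" and "f \<equiv> \<lambda>i. sgrad \<phi> x \<bullet> e i"
    and "\<beta> \<equiv> (real k + 1 - q) / 2"
  shows "((p - 1) * ((lam a - u x) / u x - (g a / u x)\<^sup>2)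
     + \<beta> * ((2 * (lam a)\<^sup>2 + 2 * (- (A * (\<Sum>i<DIM('a) - 1. lam i * (g i)\<^sup>2)) - u x * lam a)) / R x - (2 * lam a * g a / R x)\<^sup>2)
     + (shess \<phi> x (e a) (e a) / \<phi> x - (f a / \<phi> x)\<^sup>2))
     - (real k - real l) - 2 * c a * lam a + (\<Sum>j<DIM('a) - 1. c j) * lam a + A * (\<Sum>j<DIM('a) - 1. c j * (lam j)\<^sup>2)
     + A * ((\<Sum>i<DIM('a) - 1. g i * ((p - 1) * (g i / u x) + \<beta> * (2 * lam i * g i / R x) + f i / \<phi> x)) - u x * (real k - real l)) \<le> 0"
    (is "?c2 - _ - _ + _ + _ + A * ((\<Sum>i<DIM('a) - 1. g i * ?b2 i) - _) \<le> 0")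
proof -
  note E = adapted_props[OF e]
  let ?D3 = "\<lambda>i j. dird (e j) (H (e i) (e i)) x"
  let ?D4 = "\<lambda>i j. dird (e j) (dird (e j) (H (e i) (e i))) x"
  have J: "jet2 (\<lambda>t. H (e a) (e a) (circ x (e j) t) + A / 2 * R (circ x (e j) t)) (lam a + A / 2 * R x)
     (?D3 a j + A / 2 * (2 * lam j * g j))
     ((?D4 a j + lam a) + A / 2 * (2 * (lam j)\<^sup>2 + 2 * ((\<Sum>i<DIM('a) - 1. g i * ?D3 j i) - u x * lam j)))" if j: "j < DIM('a) - 1" for j
  proof -
    have "jet2 (\<lambda>t. H (e a) (e a) (circ x (e j) t)) (lam a) (?D3 a j) (?D4 a j + lam a)"
      using jet2_circ[OF open_W E(11)[OF j] Ck_H, of "e a" "e a"] euler(4)[OF E(2)] E(9)[OF a a]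
      by (simp add: lam_def)
    from jet2_add[OF this jet2_cmult[OF jet2_R[OF e j], of "A / 2"]] show ?thesis
      unfolding lam_def g_def .
  qed
  have le: "H (e a) (e a) (circ x (e j) t) + A / 2 * R (circ x (e j) t) \<le> lam a + A / 2 * R x" if "j < DIM('a) - 1" for j t
    using max[OF E(10)[OF that]] by (simp add: lam_def)
  have first: "?D3 a j = - (A * (lam j * g j))" if "j < DIM('a) - 1" for j
    using jet2_max(1)[OF J[OF that] le[OF that]] by (simp add: algebra_simps)
  have second: "?D4 a j + lam a + A * (lam j)\<^sup>2 + A * ((\<Sum>i<DIM('a) - 1. g i * ?D3 j i) - u x * lam j) \<le> 0" if "j < DIM('a) - 1" for j
    using jet2_max(2)[OF J[OF that] le[OF that]] by (simp add: algebra_simps)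
  have "(\<Sum>j<DIM('a) - 1. c j * (?D4 a j + lam a + A * (lam j)\<^sup>2 + A * ((\<Sum>i<DIM('a) - 1. g i * ?D3 j i) - u x * lam j))) \<le> 0"
    using second c(2) by (intro sum_nonpos mult_nonneg_nonpos) auto
  also have "(\<Sum>j<DIM('a) - 1. c j * (?D4 a j + lam a + A * (lam j)\<^sup>2 + A * ((\<Sum>i<DIM('a) - 1. g i * ?D3 j i) - u x * lam j)))
    = (\<Sum>j<DIM('a) - 1. c j * ?D4 a j) + (\<Sum>j<DIM('a) - 1. c j) * lam a + A * (\<Sum>j<DIM('a) - 1. c j * (lam j)\<^sup>2)
      + A * ((\<Sum>j<DIM('a) - 1. c j * (\<Sum>i<DIM('a) - 1. g i * ?D3 j i)) - u x * (\<Sum>j<DIM('a) - 1. c j * lam j))"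
    by (simp add: sum.distrib sum_subtractf sum_distrib_left sum_distrib_right algebra_simps)
  also have "(\<Sum>j<DIM('a) - 1. c j * lam j) = real k - real l" using c(1) by (simp add: supports_def lam_def)
  also have "(\<Sum>j<DIM('a) - 1. c j * (\<Sum>i<DIM('a) - 1. g i * ?D3 j i)) = (\<Sum>i<DIM('a) - 1. g i * (\<Sum>j<DIM('a) - 1. c j * ?D3 j i))"
    unfolding sum_distrib_left by (subst sum.swap) (simp add: mult.left_commute)
  also have "\<dots> = (\<Sum>i<DIM('a) - 1. g i * ?b2 i)"
    using pde_derivatives(1)[OF e c(1) _ jet2_\<psi>[OF e]] unfolding lam_def g_def f_def \<beta>_def
    by (intro sum.cong) auto
  finally have 1: "(\<Sum>j<DIM('a) - 1. c j * ?D4 a j) + (\<Sum>j<DIM('a) - 1. c j) * lam a + A * (\<Sum>j<DIM('a) - 1. c j * (lam j)\<^sup>2)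
      + A * ((\<Sum>i<DIM('a) - 1. g i * ?b2 i) - u x * (real k - real l)) \<le> 0" .
  have T: "(\<Sum>i<DIM('a) - 1. g i * ?D3 a i) = - (A * (\<Sum>i<DIM('a) - 1. lam i * (g i)\<^sup>2))"
    unfolding sum_distrib_left sum_negf[symmetric] using first
    by (intro sum.cong refl) (auto simp: power2_eq_square)
  have D4: "(\<Sum>j<DIM('a) - 1. c j * ?D4 a j) = (\<Sum>j<DIM('a) - 1. c j * ?D4 j a)"
    using dird_dird_H_swap[OF E(2)] by (intro sum.cong refl arg_cong2[of _ _ _ _ "(*)"]) blast
  have "?c2 \<le> (\<Sum>j<DIM('a) - 1. c j * ?D4 j a) + (real k - real l) + 2 * c a * lam a"
    using pde_derivatives(2)[OF e c(1) a jet2_\<psi>[OF e a]] T unfolding lam_def g_def f_def \<beta>_def by simp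
  then show ?thesis using 1 unfolding D4 by linarith
qed

text \<open>Concavity tested at s (1, ..., 1) with S the identity. A fixed s gives a lower bound for
  the sum of c; s = u x serves at a minimum of u.\<close>

lemma supports_const:
  assumes "supports x c" "norm x = 1" "s > 0"
  shows "quot_ln (DIM('a) - 1) P k l (\<lambda>_. 1) + (real k - real l) * ln s \<le> \<psi> x + s * (\<Sum>i<DIM('a) - 1. c i) - (real k - real l)"
proof -
  have one: "hess_cone (DIM('a) - 1) P k (\<lambda>_. 1)" using hess_cone_one[of "(DIM('a) - 1)" P l k] dims by simp
  let ?S = "\<lambda>i j::nat. if i = j then 1 else (0::real)"
  have "doubly_stochastic (DIM('a) - 1) ?S" by (auto simp: doubly_stochastic_def)
  moreover have "hess_cone (DIM('a) - 1) P k (\<lambda>i. s * 1)" using hess_cone_scale[OF assms(3) one] by simp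
  ultimately have "quot_ln (DIM('a) - 1) P k l (\<lambda>i. s * 1)
     \<le> quot_ln (DIM('a) - 1) P k l (eigvals u x) + (\<Sum>i<DIM('a) - 1. c i * (\<Sum>j<DIM('a) - 1. ?S i j * (s * 1))) - (real k - real l)"
    using assms(1) unfolding supports_def by blast
  moreover have "(\<Sum>i<DIM('a) - 1. c i * (\<Sum>j<DIM('a) - 1. ?S i j * (s * 1))) = s * (\<Sum>i<DIM('a) - 1. c i)"
  proof -
    have "(\<Sum>j<DIM('a) - 1. ?S i j * (s * 1)) = s" if "i < DIM('a) - 1" for i
      using that by (simp add: if_distrib[of "\<lambda>y. y * s"] cong: if_cong)
    then have "(\<Sum>i<DIM('a) - 1. c i * (\<Sum>j<DIM('a) - 1. ?S i j * (s * 1))) = (\<Sum>i<DIM('a) - 1. c i * s)" by (intro sum.cong) auto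
    then show ?thesis by (simp add: sum_distrib_left mult.commute)
  qed
  moreover have "quot_ln (DIM('a) - 1) P k l (\<lambda>i. s * 1) = quot_ln (DIM('a) - 1) P k l (\<lambda>_. 1) + (real k - real l) * ln s"
    using quot_ln_scale[OF assms(3) one] dims by simp
  ultimately show ?thesis unfolding quot_ln_eq[OF assms(2)] by simp
qed

text \<open>At the minimum the gradient vanishes and all eigenvalues are at least u, so R = u^2 and
  u times the sum of c is at most k - l. With s = u x in \<open>supports_const\<close> the powers of
  u combine to the exponent p - q + l.\<close>

lemma min_lower_bound:
  assumes x: "norm x = 1" and min: "\<And>y. norm y = 1 \<Longrightarrow> u x \<le> u y"
    and c: "supports x c" "\<And>i. i < DIM('a) - 1 \<Longrightarrow> c i \<ge> 0"
  shows "(p - q + real l) * ln (u x) \<ge> quot_ln (DIM('a) - 1) P k l (\<lambda>_. 1) - ln (\<phi> x)"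
proof -
  obtain e where e: "adapted x e" using adapted_frame_exists[OF x] by blast
  note E = adapted_props[OF e]
  have ux: "u x > 0" using u_pos x by simp
  have J: "dird (e j) h x = 0" "eigvals u x j \<ge> u x" if "j < DIM('a) - 1" for j
    using jet2_min[OF jet2_h[OF e that]] min[OF E(10)[OF that]] h_sphere[OF E(10)[OF that]] by auto
  have "R x = egrad h x \<bullet> egrad h x"
    by (subst euclidean_inner) (simp add: R_def egrad_inner[OF diffs(1)[OF E(2)]] power2_eq_square)
  also have "\<dots> = (\<Sum>i<DIM('a) - 1. (dird (e i) h x) * (dird (e i) h x)) + dird x h x * dird x h x"
    using tangent_frame_parseval[OF E(4), of "egrad h x" "egrad h x"] by (simp add: egrad_inner[OF diffs(1)[OF E(2)]])
  also have "\<dots> = u x * u x" using J euler(1)[OF E(2)] h_sphere[OF x] by simp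
  finally have R: "ln (R x) = 2 * ln (u x)" using ux by (simp add: ln_mult)
  have "u x * (\<Sum>i<DIM('a) - 1. c i) = (\<Sum>i<DIM('a) - 1. c i * u x)" by (simp add: sum_distrib_left mult.commute)
  also have "\<dots> \<le> (\<Sum>i<DIM('a) - 1. c i * eigvals u x i)" using J c(2) by (intro sum_mono mult_left_mono) auto
  also have "\<dots> = real k - real l" using c(1) by (simp add: supports_def)
  finally have "quot_ln (DIM('a) - 1) P k l (\<lambda>_. 1) + (real k - real l) * ln (u x) \<le> \<psi> x"
    using supports_const[OF c(1) x ux] by simp
  moreover have "\<psi> x = (p - 1) * ln (u x) + (real k + 1 - q) * ln (u x) + ln (\<phi> x)"
    unfolding \<psi>_def h_sphere[OF x] R by simp
  ultimately show ?thesis by (simp add: algebra_simps)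
qed

text \<open>All unit vectors of the ambient space compete, not only tangent ones, so the fixed
  vector e a remains a competitor at other points of the sphere, where it need not be
  tangent.\<close>

lemma max_point:
  obtains x e a where "adapted x e" "a < DIM('a) - 1" "eigvals u x a > 0" "\<And>i. i < DIM('a) - 1 \<Longrightarrow> eigvals u x i \<le> eigvals u x a"
    "\<And>y v. norm y = 1 \<Longrightarrow> norm v = 1 \<Longrightarrow> H v v y + A / 2 * R y \<le> eigvals u x a + A / 2 * R x"
proof -
  let ?K = "sphere (0::'a) 1 \<times> sphere (0::'a) 1"
  let ?G = "\<lambda>z. (\<Sum>b\<in>Basis. \<Sum>c\<in>Basis. (snd z \<bullet> b) * (snd z \<bullet> c) * H b c (fst z)) + A / 2 * (\<Sum>b\<in>Basis. (dird b h (fst z))\<^sup>2)"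
  have cont0: "continuous_on (- {0::'a}) (H b c)" "continuous_on (- {0::'a}) (dird b h)" for b c
    using Ck_on_le[OF open_W Ck_H, of 0 b c] Ck_on_le[OF open_W Ck_dh, of 0 b] by simp_all
  have sub: "fst ` ?K \<subseteq> - {0}" by auto
  have cont: "continuous_on ?K (\<lambda>z. H b c (fst z))" "continuous_on ?K (\<lambda>z. dird b h (fst z))" for b c
    by (rule continuous_on_compose2[OF cont0(1) continuous_on_fst[OF continuous_on_id] sub],
        rule continuous_on_compose2[OF cont0(2) continuous_on_fst[OF continuous_on_id] sub])
  have "continuous_on ?K ?G" by (intro continuous_intros cont)
  moreover have "compact ?K" by (intro compact_Times) auto
  moreover have "?K \<noteq> {}"
    using vector_choose_size[of 1] by auto
  ultimately obtain z where z: "z \<in> ?K" "\<And>w. w \<in> ?K \<Longrightarrow> ?G w \<le> ?G z"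
    using continuous_attains_sup[of ?K ?G] by blast
  have G: "?G (y, v) = H v v y + A / 2 * R y" if "norm y = 1" for y v
  proof -
    have B: "bilinear (\<lambda>v w. H v w y)" using that by (intro bilinear_H) auto
    then have lin: "linear (\<lambda>v. H v w y)" "linear (\<lambda>w. H v w y)" for v w by (auto simp: bilinear_def)
    have "H v v y = H (\<Sum>b\<in>Basis. (v \<bullet> b) *\<^sub>R b) (\<Sum>b\<in>Basis. (v \<bullet> b) *\<^sub>R b) y"
      by (simp add: euclidean_representation)
    also have "\<dots> = (\<Sum>b\<in>Basis. \<Sum>c\<in>Basis. (v \<bullet> b) * (v \<bullet> c) * H b c y)"
      by (simp add: linear_sum[OF lin(1)] linear_scale[OF lin(1)] linear_sum[OF lin(2)] linear_scale[OF lin(2)]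
          sum_distrib_left mult.assoc del: euclidean_representation_sum euclidean_representation)
        (subst sum.swap, simp add: mult.left_commute)
    finally show ?thesis by (simp add: R_def)
  qed
  obtain x v0 where xz: "z = (x, v0)" by (cases z)
  have x: "norm x = 1" "norm v0 = 1" using z(1) xz by auto
  obtain e where e: "adapted x e" using adapted_frame_exists[OF x(1)] by blast
  note E = adapted_props[OF e]
  have n0: "0 < DIM('a) - 1" using dims by simp
  define M where "M = Max (eigvals u x ` {..<DIM('a) - 1})"
  have "M \<in> eigvals u x ` {..<DIM('a) - 1}" unfolding M_def using n0 by (intro Max_in) (auto simp: lessThan_empty_iff)
  then obtain a where a: "a < DIM('a) - 1" "M = eigvals u x a" by auto
  have le: "eigvals u x i \<le> eigvals u x a" if "i < DIM('a) - 1" for i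
    unfolding a(2)[symmetric] M_def using that by (intro Max_ge) auto
  \<comment> \<open>The maximiser v0 may have a radial part, which H annihilates, so its tangential
    weights sum to at most 1; positivity lets the top eigenvalue still dominate.\<close>
  have pos: "eigvals u x a > 0"
    using hess_cone_lower_bound(1)[of "(DIM('a) - 1)" P l k "eigvals u x"] dims eigvals_cone[OF x(1)] le by simp
  have v0: "H v0 v0 x \<le> eigvals u x a"
  proof -
    have "H v0 v0 x = (\<Sum>i<DIM('a) - 1. (v0 \<bullet> e i)\<^sup>2 * eigvals u x i)" unfolding H_diag[OF e] by (simp add: power2_eq_square)
    also have "\<dots> \<le> (\<Sum>i<DIM('a) - 1. (v0 \<bullet> e i)\<^sup>2 * eigvals u x a)" using le by (intro sum_mono mult_left_mono) auto
    also have "\<dots> = (\<Sum>i<DIM('a) - 1. (v0 \<bullet> e i)\<^sup>2) * eigvals u x a" by (simp add: sum_distrib_right)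
    finally have 1: "H v0 v0 x \<le> (\<Sum>i<DIM('a) - 1. (v0 \<bullet> e i)\<^sup>2) * eigvals u x a" .
    have "(\<Sum>i<DIM('a) - 1. (v0 \<bullet> e i)\<^sup>2) + (v0 \<bullet> x)\<^sup>2 = 1"
      using tangent_frame_parseval[OF E(4), of v0 v0] x(2) by (simp add: dot_square_norm power2_eq_square)
    then have "(\<Sum>i<DIM('a) - 1. (v0 \<bullet> e i)\<^sup>2) * eigvals u x a \<le> 1 * eigvals u x a"
      using pos zero_le_power2[of "v0 \<bullet> x"] by (intro mult_right_mono) linarith+
    then show ?thesis using 1 by simp
  qed
  show ?thesis
  proof (rule that[OF e a(1) pos le])
    fix y v :: 'a assume yv: "norm y = 1" "norm v = 1"
    have "?G (y, v) \<le> ?G (x, v0)" using z(2)[of "(y, v)"] yv xz by simp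
    then show "H v v y + A / 2 * R y \<le> eigvals u x a + A / 2 * R x"
      unfolding G[OF yv(1)] G[OF x(1)] using v0 by simp
  qed auto
qed

end

section \<open>Elementary estimates\<close>

lemma abs_mult_le: "\<bar>a\<bar> \<le> A \<Longrightarrow> \<bar>b\<bar> \<le> B \<Longrightarrow> \<bar>a * b\<bar> \<le> A * (B::real)"
  unfolding abs_mult by (intro mult_mono) auto

lemma abs_square_le: "\<bar>a\<bar> \<le> A \<Longrightarrow> \<bar>a\<^sup>2\<bar> \<le> A * (A::real)"
  unfolding power2_eq_square by (rule abs_mult_le)

lemma power_mult_mono:
  fixes M L :: real
  assumes "1 \<le> M" "1 \<le> L" "a \<le> b" "c \<le> d"
  shows "M ^ a * L ^ c \<le> M ^ b * L ^ d"
  using assms by (intro mult_mono power_increasing) auto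

text \<open>\<open>iu\<close>, \<open>iR\<close> and \<open>i\<phi>\<close> stand for reciprocals.
  One bound M >= 1 for all data lets every product be raised to the highest power that occurs; the
  coefficients are 1 + 2 + 1 = 4.\<close>

lemma log_rhs_gradient_bound:
  fixes M L pp \<beta> g iu iR lam f i\<phi> :: real
  assumes M: "1 \<le> M" "1 \<le> L" and "\<bar>pp\<bar> \<le> M" "\<bar>\<beta>\<bar> \<le> M" "\<bar>g\<bar> \<le> M" "\<bar>iu\<bar> \<le> M" "\<bar>iR\<bar> \<le> M"
    "\<bar>lam\<bar> \<le> M * L" "\<bar>f\<bar> \<le> M" "\<bar>i\<phi>\<bar> \<le> M"
  shows "\<bar>pp * (g * iu) + \<beta> * (2 * lam * g * iR) + f * i\<phi>\<bar> \<le> 4 * M ^ 4 * L"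
proof -
  have 1: "\<bar>pp * (g * iu)\<bar> \<le> M * (M * M)" by (intro abs_mult_le assms)
  have 2: "\<bar>\<beta> * (2 * lam * g * iR)\<bar> \<le> M * (2 * (M * L) * M * M)" by (intro abs_mult_le assms) simp
  have 3: "\<bar>f * i\<phi>\<bar> \<le> M * M" by (intro abs_mult_le assms)
  have "M ^ 3 \<le> M ^ 4 * L" "M ^ 2 \<le> M ^ 4 * L"
    using power_mult_mono[OF M, of 3 4 0 1] power_mult_mono[OF M, of 2 4 0 1] by simp_all
  then show ?thesis using 1 2 3 by (simp add: power_numeral_reduce abs_le_iff algebra_simps)
qed

lemma log_rhs_hessian_bound:
  fixes M L A pp \<beta> g u iu iR f i\<phi> s S :: real
  assumes M: "1 \<le> M" "1 \<le> L" and "\<bar>pp\<bar> \<le> M" "\<bar>\<beta>\<bar> \<le> M" "\<bar>g\<bar> \<le> M" "\<bar>iu\<bar> \<le> M" "\<bar>iR\<bar> \<le> M"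
    "\<bar>f\<bar> \<le> M" "\<bar>i\<phi>\<bar> \<le> M" "\<bar>s\<bar> \<le> M" "\<bar>u\<bar> \<le> M" "u * iu = 1" "\<bar>S\<bar> \<le> M ^ 4 * L" "0 \<le> A"
  shows "\<bar>pp * ((L - u) * iu - (g * iu)\<^sup>2)
     + \<beta> * ((2 * L\<^sup>2 + 2 * (- (A * S) - u * L)) * iR - (2 * L * g * iR)\<^sup>2)
     + (s * i\<phi> - (f * i\<phi>)\<^sup>2)\<bar> \<le> 13 * M ^ 5 * L\<^sup>2 + 2 * A * M ^ 6 * L"
proof -
  have L: "\<bar>L\<bar> \<le> L" using M by simp
  have A: "\<bar>A\<bar> \<le> A" using assms by simp
  have "\<bar>L * iu\<bar> \<le> L * M" by (intro abs_mult_le L assms)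
  moreover have "\<bar>(g * iu)\<^sup>2\<bar> \<le> (M * M) * (M * M)" by (intro abs_square_le abs_mult_le assms)
  moreover have "(L - u) * iu = L * iu - 1" using assms(12) by (simp add: algebra_simps)
  ultimately have "\<bar>(L - u) * iu - (g * iu)\<^sup>2\<bar> \<le> L * M + 1 + (M * M) * (M * M)" by linarith
  then have 1: "\<bar>pp * ((L - u) * iu - (g * iu)\<^sup>2)\<bar> \<le> M * (L * M + 1 + (M * M) * (M * M))"
    by (intro abs_mult_le assms)
  have "\<bar>A * S\<bar> \<le> A * (M ^ 4 * L)" "\<bar>u * L\<bar> \<le> M * L" by (intro abs_mult_le L A assms)+
  moreover have "\<bar>2 * Q + 2 * (- x - y)\<bar> \<le> 2 * Q + 2 * (X + Y)"
    if "\<bar>x\<bar> \<le> X" "\<bar>y\<bar> \<le> Y" "0 \<le> Q" for x y X Y Q :: real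
    using that by (intro abs_leI) (auto simp: abs_le_iff)
  ultimately have "\<bar>2 * L\<^sup>2 + 2 * (- (A * S) - u * L)\<bar> \<le> 2 * L\<^sup>2 + 2 * (A * (M ^ 4 * L) + M * L)"
    by simp
  then have "\<bar>(2 * L\<^sup>2 + 2 * (- (A * S) - u * L)) * iR\<bar> \<le> (2 * L\<^sup>2 + 2 * (A * (M ^ 4 * L) + M * L)) * M"
    by (intro abs_mult_le assms)
  moreover have "\<bar>(2 * L * g * iR)\<^sup>2\<bar> \<le> (2 * L * M * M) * (2 * L * M * M)"
    by (intro abs_square_le abs_mult_le L assms) simp
  ultimately have "\<bar>(2 * L\<^sup>2 + 2 * (- (A * S) - u * L)) * iR - (2 * L * g * iR)\<^sup>2\<bar>
      \<le> (2 * L\<^sup>2 + 2 * (A * (M ^ 4 * L) + M * L)) * M + (2 * L * M * M) * (2 * L * M * M)" by linarith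
  then have 2: "\<bar>\<beta> * ((2 * L\<^sup>2 + 2 * (- (A * S) - u * L)) * iR - (2 * L * g * iR)\<^sup>2)\<bar>
      \<le> M * ((2 * L\<^sup>2 + 2 * (A * (M ^ 4 * L) + M * L)) * M + (2 * L * M * M) * (2 * L * M * M))"
    by (intro abs_mult_le assms)
  have "\<bar>s * i\<phi>\<bar> \<le> M * M" "\<bar>(f * i\<phi>)\<^sup>2\<bar> \<le> (M * M) * (M * M)"
    by (intro abs_square_le abs_mult_le assms)+
  then have 3: "\<bar>s * i\<phi> - (f * i\<phi>)\<^sup>2\<bar> \<le> M * M + (M * M) * (M * M)" by linarith
  \<comment> \<open>Every term without A is raised to M^5 L^2; the coefficients are 3 from the first
    group, 2 + 2 + 4 from the second and 2 from the third, 13 in all.\<close>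
  have "M ^ 2 * L \<le> M ^ 5 * L ^ 2" "M \<le> M ^ 5 * L ^ 2" "M ^ 5 \<le> M ^ 5 * L ^ 2" "M ^ 2 * L ^ 2 \<le> M ^ 5 * L ^ 2"
    "M ^ 3 * L \<le> M ^ 5 * L ^ 2" "M ^ 2 \<le> M ^ 5 * L ^ 2" "M ^ 4 \<le> M ^ 5 * L ^ 2"
    using power_mult_mono[OF M, of 2 5 1 2] power_mult_mono[OF M, of 1 5 0 2] power_mult_mono[OF M, of 5 5 0 2]
      power_mult_mono[OF M, of 2 5 2 2] power_mult_mono[OF M, of 3 5 1 2] power_mult_mono[OF M, of 2 5 0 2]
      power_mult_mono[OF M, of 4 5 0 2] by simp_all
  moreover have
    "M * (L * M + 1 + (M * M) * (M * M)) = M ^ 2 * L + M + M ^ 5"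
    "M * ((2 * L\<^sup>2 + 2 * (A * (M ^ 4 * L) + M * L)) * M + (2 * L * M * M) * (2 * L * M * M))
      = 2 * (M ^ 2 * L ^ 2) + 2 * A * M ^ 6 * L + 2 * (M ^ 3 * L) + 4 * (M ^ 5 * L ^ 2)"
    "M * M + (M * M) * (M * M) = M ^ 2 + M ^ 4"
    by (simp_all add: power_numeral_reduce algebra_simps)
  ultimately show ?thesis using 1 2 3 by linarith
qed

text \<open>A is chosen so that 14 M^5 = A \<theta> \<tau> / 2: half of the good term absorbs the
  quadratic term. Dividing by T keeps the bound independent of T, since T occurs in T L as well and
  is otherwise at least \<tau>.\<close>

lemma largest_eigenvalue_bound:
  fixes M L T A \<theta> \<tau> :: real
  assumes M: "1 \<le> M" "1 \<le> L" and \<theta>: "0 < \<theta>" "0 < \<tau>" "\<tau> \<le> T" and A: "A = 28 * M ^ 5 / (\<theta> * \<tau>)"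
    and ineq: "A * (\<theta> * T * L\<^sup>2) \<le> 14 * M ^ 5 * L\<^sup>2 + 7 * A * M ^ 6 * L + T * L"
  shows "L \<le> 14 * M ^ 6 / (\<theta> * \<tau>) + 2 / (A * \<theta>)"
proof -
  have A0: "A > 0" unfolding A using M \<theta> by simp
  have T: "T > 0" using \<theta> by simp
  have "L * (A * \<theta> * T * L) \<le> L * (14 * M ^ 5 * L + 7 * A * M ^ 6 + T)"
    using ineq by (simp add: power2_eq_square algebra_simps)
  then have 1: "A * \<theta> * T * L \<le> 14 * M ^ 5 * L + 7 * A * M ^ 6 + T"
    using M by (simp add: mult_le_cancel_left_pos)
  have "14 * M ^ 5 = A * \<theta> * \<tau> / 2" unfolding A using \<theta> by simp
  also have "\<dots> \<le> A * \<theta> * T / 2" using A0 \<theta> by (intro divide_right_mono mult_left_mono) auto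
  finally have "14 * M ^ 5 * L \<le> A * \<theta> * T / 2 * L" using M by (intro mult_right_mono) auto
  then have "A * \<theta> * T / 2 * L \<le> 7 * A * M ^ 6 + T" using 1 by simp
  then have "L \<le> (7 * A * M ^ 6 + T) / (A * \<theta> * T / 2)"
    using A0 \<theta> T by (subst pos_le_divide_eq) (auto simp: mult.commute)
  also have "\<dots> = 14 * M ^ 6 / (\<theta> * T) + 2 / (A * \<theta>)"
    using A0 \<theta> T by (simp add: field_simps)
  also have "\<dots> \<le> 14 * M ^ 6 / (\<theta> * \<tau>) + 2 / (A * \<theta>)"
    using M \<theta> by (intro add_right_mono divide_left_mono mult_left_mono mult_pos_pos) auto
  finally show ?thesis .
qed

section \<open>The second-order bound\<close>

context hessian_quotient_solution
begin

text \<open>At the maximum point L is at most B. Comparing the test function there with its value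
  elsewhere costs A M / 2 for the gradient term, so every eigenvalue is at most B + A M / 2; the
  cone bounds them below at the cost of a factor n <= M. The last summand M pays for u I.\<close>

lemma hessian_bound:
  fixes M \<theta> \<tau> :: real
  assumes M: "1 \<le> M" "real (DIM('a) - 1) \<le> M" "\<bar>p - 1\<bar> \<le> M" "\<bar>(real k + 1 - q) / 2\<bar> \<le> M" "real k - real l \<le> M"
    and ub: "\<And>x. norm x = 1 \<Longrightarrow> 1 / u x \<le> M" "\<And>x. norm x = 1 \<Longrightarrow> u x \<le> M"
      "\<And>x. norm x = 1 \<Longrightarrow> norm (sgrad u x) \<le> M" "\<And>x. norm x = 1 \<Longrightarrow> R x \<le> M" "\<And>x. norm x = 1 \<Longrightarrow> 1 / R x \<le> M"
    and \<phi>b: "\<And>x. norm x = 1 \<Longrightarrow> 1 / \<phi> x \<le> M" "\<And>x. norm x = 1 \<Longrightarrow> norm (sgrad \<phi> x) \<le> M"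
      "\<And>x v. norm x = 1 \<Longrightarrow> tangent_unit x v \<Longrightarrow> \<bar>shess \<phi> x v v\<bar> \<le> M"
    and \<theta>: "0 < \<theta>" "0 < \<tau>"
    and sup: "\<And>x. norm x = 1 \<Longrightarrow> \<exists>c. supports x c \<and> (\<forall>i<DIM('a) - 1. c i \<ge> \<theta> * (\<Sum>i<DIM('a) - 1. c i)) \<and> (\<Sum>i<DIM('a) - 1. c i) \<ge> \<tau>"
    and A: "A = 28 * M ^ 5 / (\<theta> * \<tau>)" and B: "B = max 1 (14 * M ^ 6 / (\<theta> * \<tau>) + 2 / (A * \<theta>))"
    and x: "norm x = 1" and vw: "tangent_unit x v" "tangent_unit x w"
  shows "\<bar>shess u x v w\<bar> \<le> M * (M * (B + A * M / 2)) + M"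
proof -
  have A0: "A > 0" unfolding A using M \<theta> by simp
  obtain x0 e a where e: "adapted x0 e" and a: "a < DIM('a) - 1" "eigvals u x0 a > 0"
    and le: "\<And>i. i < DIM('a) - 1 \<Longrightarrow> eigvals u x0 i \<le> eigvals u x0 a"
    and max: "\<And>y v. norm y = 1 \<Longrightarrow> norm v = 1 \<Longrightarrow> H v v y + A / 2 * R y \<le> eigvals u x0 a + A / 2 * R x0"
    using max_point[of A] by blast
  note E = adapted_props[OF e]
  define L where "L = eigvals u x0 a"
  have LB: "L \<le> B"
  proof (cases "L \<le> 1")
    case True
    then show ?thesis unfolding B by simp
  next
    case False
    then have L: "1 \<le> L" by simp
    obtain c where c: "supports x0 c" "\<And>i. i < DIM('a) - 1 \<Longrightarrow> c i \<ge> \<theta> * (\<Sum>i<DIM('a) - 1. c i)" "(\<Sum>i<DIM('a) - 1. c i) \<ge> \<tau>"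
      using sup[OF E(1)] by blast
    define T where "T = (\<Sum>i<DIM('a) - 1. c i)"
    have T: "T \<ge> \<tau>" "T > 0" using c(3) \<theta> by (auto simp: T_def)
    have c0: "c i \<ge> 0" if "i < DIM('a) - 1" for i
      using c(2)[OF that] T \<theta> by (metis T_def less_eq_real_def mult_nonneg_nonneg order_trans)
    define lam g f where "lam = eigvals u x0" "g = (\<lambda>i. dird (e i) h x0)" "f = (\<lambda>i. sgrad \<phi> x0 \<bullet> e i)"
    note defs = lam_g_f_def
    let ?\<beta> = "(real k + 1 - q) / 2"
    have ux: "u x0 > 0" "\<phi> x0 > 0" "R x0 > 0" using u_pos \<phi>_pos R_pos E(1) by auto
    have iu: "\<bar>1 / u x0\<bar> \<le> M" "\<bar>u x0\<bar> \<le> M" "\<bar>1 / R x0\<bar> \<le> M" "\<bar>1 / \<phi> x0\<bar> \<le> M"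
      using ub(1,2,5)[OF E(1)] \<phi>b(1)[OF E(1)] ux by simp_all
    have g: "\<bar>g i\<bar> \<le> M" if "i < DIM('a) - 1" for i
    proof -
      have "g i = sgrad u x0 \<bullet> e i"
        using dird_hext_sphere[OF E(1) u_differentiable[OF E(1)], of "e i"] E(7)[OF that]
        by (simp add: defs inner_add_left)
      then have "\<bar>g i\<bar> \<le> norm (sgrad u x0)" using Cauchy_Schwarz_ineq2[of "sgrad u x0" "e i"] E(5)[OF that] by simp
      then show ?thesis using ub(3)[OF E(1)] by simp
    qed
    have f: "\<bar>f i\<bar> \<le> M" if "i < DIM('a) - 1" for i
      using Cauchy_Schwarz_ineq2[of "sgrad \<phi> x0" "e i"] E(5)[OF that] \<phi>b(2)[OF E(1)] by (simp add: defs)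
    have s: "\<bar>shess \<phi> x0 (e a) (e a)\<bar> \<le> M"
      using \<phi>b(3)[OF E(1), of "e a"] E(5,6)[OF a(1)] by (simp add: tangent_unit_def)
    have lam: "\<bar>lam i\<bar> \<le> M * L" if "i < DIM('a) - 1" for i
    proof -
      have "- (real (DIM('a) - 1) * L) \<le> lam i"
        using hess_cone_lower_bound(2)[of "(DIM('a) - 1)" P l k "eigvals u x0" L i] dims eigvals_cone[OF E(1)] le that
        by (simp add: L_def defs)
      moreover have "real (DIM('a) - 1) * L \<le> M * L" using M L by (intro mult_right_mono) auto
      moreover have "lam i \<le> 1 * L" using le[OF that] by (simp add: L_def defs)
      moreover have "1 * L \<le> M * L" using M L by (intro mult_right_mono) auto
      ultimately show ?thesis by linarith
    qed
    let ?b2 = "\<lambda>i. (p - 1) * (g i * (1 / u x0)) + ?\<beta> * (2 * lam i * g i * (1 / R x0)) + f i * (1 / \<phi> x0)"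
    let ?S = "\<Sum>i<DIM('a) - 1. lam i * (g i)\<^sup>2"
    let ?c2 = "(p - 1) * ((L - u x0) * (1 / u x0) - (g a * (1 / u x0))\<^sup>2)
       + ?\<beta> * ((2 * L\<^sup>2 + 2 * (- (A * ?S) - u x0 * L)) * (1 / R x0) - (2 * L * g a * (1 / R x0))\<^sup>2)
       + (shess \<phi> x0 (e a) (e a) * (1 / \<phi> x0) - (f a * (1 / \<phi> x0))\<^sup>2)"
    have key: "?c2 - (real k - real l) - 2 * c a * L + T * L + A * (\<Sum>j<DIM('a) - 1. c j * (lam j)\<^sup>2)
       + A * ((\<Sum>i<DIM('a) - 1. g i * ?b2 i) - u x0 * (real k - real l)) \<le> 0"
      using key_inequality[OF e c(1) c0 a(1) max[OF _ E(5)[OF a(1)]]] unfolding L_def T_def defs by simp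
    have S: "\<bar>?S\<bar> \<le> M ^ 4 * L"
    proof -
      have "\<bar>?S\<bar> \<le> (\<Sum>i<DIM('a) - 1. M * L * (M * M))"
        by (rule order_trans[OF sum_abs]) (intro sum_mono abs_mult_le abs_square_le lam g, auto)
      also have "\<dots> = real (DIM('a) - 1) * (M * L * (M * M))" by simp
      also have "\<dots> \<le> M * (M * L * (M * M))" using M L by (intro mult_right_mono) auto
      finally show ?thesis by (simp add: power_numeral_reduce algebra_simps)
    qed
    have c2: "\<bar>?c2\<bar> \<le> 13 * M ^ 5 * L\<^sup>2 + 2 * A * M ^ 6 * L"
      using ux A0 by (intro log_rhs_hessian_bound M L iu g f s S a(1)) auto
    have b2: "\<bar>?b2 i\<bar> \<le> 4 * M ^ 4 * L" if "i < DIM('a) - 1" for i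
      by (intro log_rhs_gradient_bound M L iu g f lam that)
    have sb: "\<bar>\<Sum>i<DIM('a) - 1. g i * ?b2 i\<bar> \<le> 4 * M ^ 6 * L"
    proof -
      have "\<bar>\<Sum>i<DIM('a) - 1. g i * ?b2 i\<bar> \<le> (\<Sum>i<DIM('a) - 1. M * (4 * M ^ 4 * L))"
        by (rule order_trans[OF sum_abs]) (intro sum_mono abs_mult_le g b2, auto)
      also have "\<dots> = real (DIM('a) - 1) * (M * (4 * M ^ 4 * L))" by simp
      also have "\<dots> \<le> M * (M * (4 * M ^ 4 * L))" using M L by (intro mult_right_mono) auto
      finally show ?thesis by (simp add: power_numeral_reduce algebra_simps)
    qed
    have kl: "0 \<le> real k - real l" using dims by simp
    have uk: "u x0 * (real k - real l) \<le> M ^ 6 * L"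
    proof -
      have "u x0 * (real k - real l) \<le> M * M" using M ux iu kl by (intro mult_mono) auto
      then show ?thesis using power_mult_mono[OF M(1) L, of 2 6 0 1] by (simp add: power2_eq_square)
    qed
    have klM: "real k - real l \<le> M ^ 5 * L\<^sup>2"
      using power_mult_mono[OF M(1) L, of 1 5 0 2] M(5) by simp
    have "(\<Sum>j<DIM('a) - 1. c j * (lam j)\<^sup>2) \<ge> c a * (lam a)\<^sup>2"
      using a(1) c0 by (intro member_le_sum[of a "{..<DIM('a) - 1}" "\<lambda>j. c j * (lam j)\<^sup>2"]) auto
    moreover have "c a * (lam a)\<^sup>2 \<ge> \<theta> * T * L\<^sup>2"
      using c(2)[OF a(1)] by (auto simp: T_def L_def defs intro: mult_right_mono)
    ultimately have "A * (\<theta> * T * L\<^sup>2) \<le> A * (\<Sum>j<DIM('a) - 1. c j * (lam j)\<^sup>2)" using A0 by simp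
    moreover have "c a \<le> T" unfolding T_def using a(1) c0 by (intro member_le_sum[of a "{..<DIM('a) - 1}" c]) auto
    then have "c a * L \<le> T * L" using L by simp
    moreover have "A * (\<bar>\<Sum>i<DIM('a) - 1. g i * ?b2 i\<bar> + u x0 * (real k - real l)) \<le> A * (4 * M ^ 6 * L + M ^ 6 * L)"
      using A0 sb uk by (intro mult_left_mono add_mono) auto
    moreover have "- (A * (\<bar>\<Sum>i<DIM('a) - 1. g i * ?b2 i\<bar> + u x0 * (real k - real l)))
       \<le> A * ((\<Sum>i<DIM('a) - 1. g i * ?b2 i) - u x0 * (real k - real l))"
      using A0 unfolding mult_minus_right[symmetric] by (intro mult_left_mono) auto
    \<comment> \<open>Linear arithmetic on abstract atoms. Since c a is at most T, - 2 c a L + T L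
      is at least - T L; all other terms move to the right with their bounds.\<close>
    moreover have "Z \<le> C2 + K5 + TL + Y" if "Z \<le> Q" "ca * L \<le> TL" "W \<le> Y" "- W \<le> X"
      "c2 - kl - 2 * ca * L + TL + Q + X \<le> 0" "\<bar>c2\<bar> \<le> C2" "kl \<le> K5"
      for Z Q ca TL W Y X c2 kl C2 K5 :: real
      using that(1-5,7) abs_ge_minus_self[of c2] that(6) by (simp add: abs_le_iff)
    ultimately have "A * (\<theta> * T * L\<^sup>2) \<le> (13 * M ^ 5 * L\<^sup>2 + 2 * A * M ^ 6 * L) + M ^ 5 * L\<^sup>2 + T * L
        + A * (4 * M ^ 6 * L + M ^ 6 * L)"
      using key c2 klM by blast
    \<comment> \<open>14 = 13 + 1 and 7 = 2 + 4 + 1.\<close>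
    then have "A * (\<theta> * T * L\<^sup>2) \<le> 14 * M ^ 5 * L\<^sup>2 + 7 * A * M ^ 6 * L + T * L"
      by (simp add: algebra_simps)
    from largest_eigenvalue_bound[OF M(1) L \<theta> T(1) A this] show ?thesis unfolding B by simp
  qed
  obtain e' where e': "adapted x e'" using adapted_frame_exists[OF x] by blast
  note E' = adapted_props[OF e']
  define L' where "L' = B + A * M / 2"
  have up: "eigvals u x i \<le> L'" if "i < DIM('a) - 1" for i
  proof -
    have "eigvals u x i + A / 2 * R x \<le> L + A / 2 * R x0"
      using max[OF x E'(5)[OF that]] E'(9)[OF that that] by (simp add: L_def)
    moreover have "0 \<le> A / 2 * R x" "A / 2 * R x0 \<le> A / 2 * M"
      using A0 R_pos[OF x] ub(4)[OF E(1)] by simp_all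
    ultimately show ?thesis using LB by (simp add: L'_def)
  qed
  have L': "L' > 0" and lo: "\<And>i. i < DIM('a) - 1 \<Longrightarrow> - (real (DIM('a) - 1) * L') \<le> eigvals u x i"
    using hess_cone_lower_bound[of "(DIM('a) - 1)" P l k "eigvals u x" L'] dims eigvals_cone[OF x] up by auto
  have ab: "\<bar>eigvals u x i\<bar> \<le> M * L'" if "i < DIM('a) - 1" for i
  proof -
    have "real (DIM('a) - 1) * L' \<le> M * L'" "1 * L' \<le> M * L'" using M L' by (intro mult_right_mono; simp)+
    then show ?thesis using up[OF that] lo[OF that] by linarith
  qed
  have v: "norm v = 1" "v \<bullet> x = 0" "norm w = 1" "w \<bullet> x = 0" using vw by (auto simp: tangent_unit_def)
  have cs: "(\<Sum>i<DIM('a) - 1. \<bar>v \<bullet> e' i\<bar> * \<bar>w \<bullet> e' i\<bar>) \<le> 1"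
  proof -
    have p: "(\<Sum>i<DIM('a) - 1. (z \<bullet> e' i)\<^sup>2) = 1" if "norm z = 1" "z \<bullet> x = 0" for z
      using tangent_frame_parseval[OF E'(4), of z z] that by (simp add: dot_square_norm power2_eq_square)
    have "2 * (\<bar>v \<bullet> e' i\<bar> * \<bar>w \<bullet> e' i\<bar>) \<le> (v \<bullet> e' i)\<^sup>2 + (w \<bullet> e' i)\<^sup>2" for i
      using sum_squares_bound[of "\<bar>v \<bullet> e' i\<bar>" "\<bar>w \<bullet> e' i\<bar>"] by (simp add: mult.assoc)
    then have "(\<Sum>i<DIM('a) - 1. 2 * (\<bar>v \<bullet> e' i\<bar> * \<bar>w \<bullet> e' i\<bar>)) \<le> (\<Sum>i<DIM('a) - 1. (v \<bullet> e' i)\<^sup>2 + (w \<bullet> e' i)\<^sup>2)"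
      by (intro sum_mono) auto
    then show ?thesis using p[OF v(1,2)] p[OF v(3,4)] by (simp add: sum.distrib sum_distrib_left[symmetric])
  qed
  have "\<bar>H v w x\<bar> \<le> (\<Sum>i<DIM('a) - 1. \<bar>v \<bullet> e' i\<bar> * \<bar>w \<bullet> e' i\<bar> * (M * L'))"
    unfolding H_diag[OF e'] by (rule order_trans[OF sum_abs])
      (intro sum_mono, auto simp: abs_mult intro!: mult_left_mono ab)
  also have "\<dots> = (\<Sum>i<DIM('a) - 1. \<bar>v \<bullet> e' i\<bar> * \<bar>w \<bullet> e' i\<bar>) * (M * L')" by (simp add: sum_distrib_right)
  also have "\<dots> \<le> 1 * (M * L')" using cs M L' by (intro mult_right_mono) auto
  finally have "\<bar>H v w x\<bar> \<le> M * L'" by simp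
  also have "1 * (M * L') \<le> M * (M * L')" using M L' by (intro mult_right_mono) auto
  finally have 1: "\<bar>H v w x\<bar> \<le> M * (M * L')" by simp
  have "\<bar>u x * (v \<bullet> w)\<bar> \<le> M * 1"
    using Cauchy_Schwarz_ineq2[of v w] v ub(2)[OF x] u_pos[of x] x by (intro abs_mult_le) auto
  then show ?thesis using 1 H_tangent[OF x v(2,4)] unfolding L'_def by simp
qed

end

lemma abs_ln_le:
  fixes a b y :: real
  assumes "0 < a" "a \<le> y" "y \<le> b"
  shows "\<bar>ln y\<bar> \<le> \<bar>ln a\<bar> + \<bar>ln b\<bar>"
proof -
  have "ln a \<le> ln y" "ln y \<le> ln b" using assms by auto
  then show ?thesis by linarith
qed

text \<open>\<theta> comes from the cone alone, and all further constants are built from n, P, k, l,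
  p, q, m, K1 and K2 before u and \<phi> are introduced; this is the asserted dependence of
  C.\<close>

theorem theorem4p3:
  fixes P k l :: nat and p q m K1 K2 :: real
  assumes "DIM('a::euclidean_space) \<ge> 3"
    and "1 < P" and "P \<le> (DIM('a) - 1) - 1"
    and "l < k" and "k \<le> ((DIM('a) - 1) - 1) choose (P - 1)"
    and "p > q - real l"
    and "m > 0"
  shows "\<exists>C > 0. \<forall>(u :: 'a \<Rightarrow> real) (\<phi> :: 'a \<Rightarrow> real) U V.
     open U \<and> sphere 0 1 \<subseteq> U \<and> Ck_on 4 U u \<and>
     open V \<and> sphere 0 1 \<subseteq> V \<and> Ck_on 2 V \<phi> \<and>
     (\<forall>x \<in> sphere 0 1. \<phi> x > 0) \<and>
     (\<forall>x \<in> sphere 0 1. u x > 0) \<and>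
     admissible P k u \<and>
     (\<forall>x \<in> sphere 0 1.
        esym k (LamP (eigvals u x)) (multi_idx (DIM('a) - 1) P)
          / esym l (LamP (eigvals u x)) (multi_idx (DIM('a) - 1) P)
        = u x powr (p - 1) * ((u x)\<^sup>2 + (norm (sgrad u x))\<^sup>2) powr ((real k + 1 - q) / 2) * \<phi> x) \<and>
     (\<forall>x \<in> sphere 0 1. \<phi> x \<ge> m) \<and>
     (\<forall>x \<in> sphere 0 1. \<bar>u x\<bar> \<le> K1 \<and> norm (sgrad u x) \<le> K1) \<and>
     (\<forall>x \<in> sphere 0 1. \<bar>\<phi> x\<bar> \<le> K2 \<and> norm (sgrad \<phi> x) \<le> K2 \<and>
        (\<forall>v w. tangent_unit x v \<and> tangent_unit x w \<longrightarrow> \<bar>shess \<phi> x v w\<bar> \<le> K2))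
     \<longrightarrow> (\<forall>x \<in> sphere 0 1. \<forall>v w. tangent_unit x v \<and> tangent_unit x w \<longrightarrow>
            \<bar>shess u x v w\<bar> \<le> C)"
proof -
  have n: "0 < DIM('a) - 1" and P: "0 < P" using assms by auto
  obtain \<theta> where \<theta>: "\<theta> > 0" "\<And>lam0. hess_cone (DIM('a) - 1) P k lam0 \<Longrightarrow> \<exists>c.
      (\<Sum>i<DIM('a) - 1. c i * lam0 i) = real k - real l \<and> (\<Sum>i<DIM('a) - 1. c i) > 0 \<and>
      (\<forall>i<DIM('a) - 1. c i \<ge> \<theta> * (\<Sum>i<DIM('a) - 1. c i)) \<and>
      (\<forall>lam S. hess_cone (DIM('a) - 1) P k lam \<and> doubly_stochastic (DIM('a) - 1) S \<longrightarrow>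
         quot_ln (DIM('a) - 1) P k l lam \<le> quot_ln (DIM('a) - 1) P k l lam0
           + (\<Sum>i<DIM('a) - 1. c i * (\<Sum>j<DIM('a) - 1. S i j * lam j)) - (real k - real l))"
    using quot_ln_support[OF n P assms(4,5)] by blast
  define Q where "Q = quot_ln (DIM('a) - 1) P k l (\<lambda>_. 1)"
  define \<beta> where "\<beta> = (real k + 1 - q) / 2"
  define Ku where "Ku = max K1 1"
  define K\<phi> where "K\<phi> = max K2 1"
  \<comment> \<open>The lower bound for u: \<open>min_lower_bound\<close> solved for u, with
    \<open>K\<phi>\<close> bounding \<phi>.\<close>
  define \<delta> where "\<delta> = exp ((Q - ln K\<phi>) / (p - q + real l))"
  \<comment> \<open>An upper bound for \<open>\<psi>\<close>. The signs of p - 1 and \<beta> are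
    unknown, so absolute logarithms of both end points enter.\<close>
  define Z where "Z = \<bar>p - 1\<bar> * (\<bar>ln \<delta>\<bar> + \<bar>ln Ku\<bar>) + \<bar>\<beta>\<bar> * (\<bar>ln (\<delta>\<^sup>2)\<bar> + \<bar>ln (2 * Ku\<^sup>2)\<bar>) + ln K\<phi>"
  \<comment> \<open>Solves (k - l) ln s = Z - Q, so that \<open>supports_const\<close> leaves s
    times the sum of c at least k - l; this is the bound \<tau>.\<close>
  define s where "s = exp ((Z - Q) / (real k - real l))"
  define \<tau> where "\<tau> = (real k - real l) / s"
  \<comment> \<open>A sum of nonnegative quantities dominates each of them.\<close>
  define M where "M = 1 + real (DIM('a) - 1) + \<bar>p - 1\<bar> + \<bar>\<beta>\<bar> + (real k - real l) + 1 / \<delta> + Ku + 2 * Ku\<^sup>2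
     + 1 / \<delta>\<^sup>2 + 1 / m + K\<phi>"
  define A where "A = 28 * M ^ 5 / (\<theta> * \<tau>)"
  define B where "B = max 1 (14 * M ^ 6 / (\<theta> * \<tau>) + 2 / (A * \<theta>))"
  have kl: "real k - real l > 0" using assms(4) by simp
  have pq: "p - q + real l > 0" using assms(6) by simp
  have \<delta>: "\<delta> > 0" by (simp add: \<delta>_def)
  have K: "Ku \<ge> 1" "Ku \<ge> K1" "K\<phi> \<ge> 1" "K\<phi> \<ge> K2" by (auto simp: Ku_def K\<phi>_def)
  have s: "s > 0" by (simp add: s_def)
  have \<tau>: "\<tau> > 0" using kl s by (simp add: \<tau>_def)
  have pos: "0 \<le> real (DIM('a) - 1)" "0 \<le> \<bar>p - 1\<bar>" "0 \<le> \<bar>\<beta>\<bar>" "0 \<le> 1 / \<delta>" "0 \<le> 2 * Ku\<^sup>2" "0 \<le> 1 / \<delta>\<^sup>2" "0 \<le> 1 / m"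
    using \<delta> assms(7) by auto
  have M: "M \<ge> 1" "real (DIM('a) - 1) \<le> M" "\<bar>p - 1\<bar> \<le> M" "\<bar>\<beta>\<bar> \<le> M" "real k - real l \<le> M" "1 / \<delta> \<le> M" "Ku \<le> M"
    "2 * Ku\<^sup>2 \<le> M" "1 / \<delta>\<^sup>2 \<le> M" "1 / m \<le> M" "K\<phi> \<le> M"
    unfolding M_def using pos kl K by linarith+
  have A: "A > 0" unfolding A_def using M(1) \<theta>(1) \<tau> by simp
  have C: "M * (M * (B + A * M / 2)) + M > 0"
    using M(1) A by (intro add_pos_pos mult_pos_pos) (auto simp: B_def)
  show ?thesis
  proof (intro exI[of _ "M * (M * (B + A * M / 2)) + M"] conjI C allI impI ballI)
    fix u \<phi> :: "'a \<Rightarrow> real" and U V :: "'a set" and x v w :: 'a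
    assume hyp: "open U \<and> sphere 0 1 \<subseteq> U \<and> Ck_on 4 U u \<and>
     open V \<and> sphere 0 1 \<subseteq> V \<and> Ck_on 2 V \<phi> \<and>
     (\<forall>x \<in> sphere 0 1. \<phi> x > 0) \<and>
     (\<forall>x \<in> sphere 0 1. u x > 0) \<and>
     admissible P k u \<and>
     (\<forall>x \<in> sphere 0 1.
        esym k (LamP (eigvals u x)) (multi_idx (DIM('a) - 1) P)
          / esym l (LamP (eigvals u x)) (multi_idx (DIM('a) - 1) P)
        = u x powr (p - 1) * ((u x)\<^sup>2 + (norm (sgrad u x))\<^sup>2) powr ((real k + 1 - q) / 2) * \<phi> x) \<and>
     (\<forall>x \<in> sphere 0 1. \<phi> x \<ge> m) \<and>
     (\<forall>x \<in> sphere 0 1. \<bar>u x\<bar> \<le> K1 \<and> norm (sgrad u x) \<le> K1) \<and>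
     (\<forall>x \<in> sphere 0 1. \<bar>\<phi> x\<bar> \<le> K2 \<and> norm (sgrad \<phi> x) \<le> K2 \<and>
        (\<forall>v w. tangent_unit x v \<and> tangent_unit x w \<longrightarrow> \<bar>shess \<phi> x v w\<bar> \<le> K2))"
      and x: "x \<in> sphere 0 1" and vw: "tangent_unit x v \<and> tangent_unit x w"
    have hyps: "open U" "sphere 0 1 \<subseteq> U" "Ck_on 4 U u" "open V" "sphere 0 1 \<subseteq> V" "Ck_on 2 V \<phi>"
      "\<forall>x \<in> sphere 0 1. \<phi> x > 0" "\<forall>x \<in> sphere 0 1. u x > 0" "admissible P k u"
      "\<forall>x \<in> sphere 0 1.
        esym k (LamP (eigvals u x)) (multi_idx (DIM('a) - 1) P)
          / esym l (LamP (eigvals u x)) (multi_idx (DIM('a) - 1) P)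
        = u x powr (p - 1) * ((u x)\<^sup>2 + (norm (sgrad u x))\<^sup>2) powr ((real k + 1 - q) / 2) * \<phi> x"
      "\<forall>x \<in> sphere 0 1. \<phi> x \<ge> m" "\<forall>x \<in> sphere 0 1. \<bar>u x\<bar> \<le> K1 \<and> norm (sgrad u x) \<le> K1"
      "\<forall>x \<in> sphere 0 1. \<bar>\<phi> x\<bar> \<le> K2 \<and> norm (sgrad \<phi> x) \<le> K2 \<and>
        (\<forall>v w. tangent_unit x v \<and> tangent_unit x w \<longrightarrow> \<bar>shess \<phi> x v w\<bar> \<le> K2)"
      by (insert hyp, (elim conjE, assumption)+)
    have dim: "DIM('a) \<ge> 2" using assms(1) by simp
    interpret hessian_quotient_solution u \<phi> U V P k l p q
      by (rule hessian_quotient_solution.intro)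
        (rule hyps dim P assms | erule bspec[OF hyps(7)] | erule bspec[OF hyps(8)] | erule bspec[OF hyps(10)])+
    have S: "y \<in> sphere 0 1" if "norm y = 1" for y :: 'a using that by simp
    have ub: "u y > 0" "u y \<le> Ku" "norm (sgrad u y) \<le> Ku" if "norm y = 1" for y
      using u_pos[OF S[OF that]] bspec[OF hyps(12) S[OF that]] K(2) by linarith+
    have \<phi>b: "\<phi> y > 0" "\<phi> y \<ge> m" "\<phi> y \<le> K\<phi>" "norm (sgrad \<phi> y) \<le> K\<phi>" if "norm y = 1" for y
      using \<phi>_pos[OF S[OF that]] bspec[OF hyps(11) S[OF that]] bspec[OF hyps(13) S[OF that]] K(4) by linarith+
    have \<phi>h: "\<bar>shess \<phi> y z z\<bar> \<le> K\<phi>" if "norm y = 1" "tangent_unit y z" for y z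
      using bspec[OF hyps(13) S[OF that(1)]] that(2) K(4) by (meson order_trans)
    have sup: "\<exists>c. supports y c \<and> (\<forall>i<DIM('a) - 1. c i \<ge> \<theta> * (\<Sum>i<DIM('a) - 1. c i)) \<and> (\<Sum>i<DIM('a) - 1. c i) > 0"
      if "norm y = 1" for y
      using \<theta>(2)[OF eigvals_cone[OF that]] unfolding supports_def by blast
    have u_low: "\<delta> \<le> u y" if y: "norm y = 1" for y
    proof -
      have "continuous_on (sphere 0 1) u"
        using Ck_on_le[OF U(1,3), of 0] U(2) continuous_on_subset by auto
      then obtain z where z: "z \<in> sphere 0 1" "\<And>y. y \<in> sphere 0 1 \<Longrightarrow> u z \<le> u y"
        using continuous_attains_inf[of "sphere 0 1" u] x by auto
      have nz: "norm z = 1" using z by simp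
      obtain c where c: "supports z c" "\<forall>i<DIM('a) - 1. c i \<ge> \<theta> * (\<Sum>i<DIM('a) - 1. c i)" "(\<Sum>i<DIM('a) - 1. c i) > 0"
        using sup[OF nz] by blast
      have c0: "c i \<ge> 0" if "i < DIM('a) - 1" for i
        using c(2,3) that \<theta>(1) by (smt (verit) mult_pos_pos)
      have "Q - ln K\<phi> \<le> Q - ln (\<phi> z)" using \<phi>b(1,3)[OF nz] by simp
      also have "\<dots> \<le> (p - q + real l) * ln (u z)"
        unfolding Q_def using z by (intro min_lower_bound[OF nz _ c(1) c0]) auto
      finally have "(Q - ln K\<phi>) / (p - q + real l) \<le> ln (u z)" using pq by (simp add: pos_divide_le_eq mult.commute)
      then have "\<delta> \<le> u z" unfolding \<delta>_def using ub(1)[OF nz] by (metis exp_le_cancel_iff exp_ln)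
      then show ?thesis using z(2)[of y] y by simp
    qed
    have R_low: "\<delta>\<^sup>2 \<le> R y" and R_up: "R y \<le> 2 * Ku\<^sup>2" if y: "norm y = 1" for y
    proof -
      have "\<delta>\<^sup>2 \<le> (u y)\<^sup>2" using u_low[OF y] \<delta> by (intro power_mono) auto
      then show "\<delta>\<^sup>2 \<le> R y" unfolding R_sphere[OF y] using zero_le_power2[of "norm (sgrad u y)"] by linarith
      have "(u y)\<^sup>2 \<le> Ku\<^sup>2" "(norm (sgrad u y))\<^sup>2 \<le> Ku\<^sup>2" using ub[OF y] by (intro power_mono; simp)+
      then show "R y \<le> 2 * Ku\<^sup>2" unfolding R_sphere[OF y] by simp
    qed
    have \<psi>_le: "\<psi> y \<le> Z" if y: "norm y = 1" for y
    proof -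
      have "\<bar>(p - 1) * ln (u y)\<bar> \<le> \<bar>p - 1\<bar> * (\<bar>ln \<delta>\<bar> + \<bar>ln Ku\<bar>)"
        using u_low[OF y] ub[OF y] \<delta> by (intro abs_mult_le abs_ln_le) auto
      moreover have "\<bar>\<beta> * ln (R y)\<bar> \<le> \<bar>\<beta>\<bar> * (\<bar>ln (\<delta>\<^sup>2)\<bar> + \<bar>ln (2 * Ku\<^sup>2)\<bar>)"
        using R_low[OF y] R_up[OF y] \<delta> by (intro abs_mult_le abs_ln_le) auto
      moreover have "ln (\<phi> y) \<le> ln K\<phi>" using \<phi>b(1,3)[OF y] by simp
      ultimately show ?thesis unfolding \<psi>_def h_sphere[OF y] Z_def \<beta>_def[symmetric] by linarith
    qed
    have sup': "\<exists>c. supports y c \<and> (\<forall>i<DIM('a) - 1. c i \<ge> \<theta> * (\<Sum>i<DIM('a) - 1. c i)) \<and> (\<Sum>i<DIM('a) - 1. c i) \<ge> \<tau>"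
      if y: "norm y = 1" for y
    proof -
      obtain c where c: "supports y c" "\<forall>i<DIM('a) - 1. c i \<ge> \<theta> * (\<Sum>i<DIM('a) - 1. c i)"
        using sup[OF y] by blast
      have "(real k - real l) * ln s = Z - Q" using kl by (simp add: s_def)
      then have "real k - real l \<le> s * (\<Sum>i<DIM('a) - 1. c i)"
        using supports_const[OF c(1) y s] \<psi>_le[OF y] unfolding Q_def[symmetric] by linarith
      then have "\<tau> \<le> (\<Sum>i<DIM('a) - 1. c i)" using s by (simp add: \<tau>_def pos_divide_le_eq mult.commute)
      then show ?thesis using c by blast
    qed
    show "\<bar>shess u x v w\<bar> \<le> M * (M * (B + A * M / 2)) + M"
    proof (rule hessian_bound[OF M(1,2,3) M(4)[unfolded \<beta>_def] M(5) _ _ _ _ _ _ _ _ \<theta>(1) \<tau> sup' A_def B_def])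
      fix y :: 'a assume y: "norm y = 1"
      have "1 / u y \<le> 1 / \<delta>" using u_low[OF y] \<delta> by (intro divide_left_mono) auto
      then show "1 / u y \<le> M" using M(6) by linarith
      show "u y \<le> M" "norm (sgrad u y) \<le> M" using ub[OF y] M(7) by linarith+
      show "R y \<le> M" using R_up[OF y] M(8) by linarith
      have "1 / R y \<le> 1 / \<delta>\<^sup>2" using R_low[OF y] \<delta> R_pos[OF y] by (intro divide_left_mono) auto
      then show "1 / R y \<le> M" using M(9) by linarith
      have "1 / \<phi> y \<le> 1 / m" using \<phi>b(1,2)[OF y] assms(7) by (intro divide_left_mono) auto
      then show "1 / \<phi> y \<le> M" using M(10) by linarith
      show "norm (sgrad \<phi> y) \<le> M" using \<phi>b(4)[OF y] M(11) by linarith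
      fix z assume "tangent_unit y z"
      then show "\<bar>shess \<phi> y z z\<bar> \<le> M" using \<phi>h[OF y] M(11) by fastforce
    qed (use x vw in auto)
  qed
qed

end
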